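(* Let $k\geq 1$. If $\mathsf{QC\Sigma}_k = \mathsf{QC\Pi}_k$, then $\mathsf{QCPH} = \mathsf{QC\Sigma}_k$.
   Context: A promise problem is a pair $A=(A_{\mathrm{yes}},A_{\mathrm{no}})$ of disjoint subsets of $\{0,1\}^*$ (their union need not be all of $\{0,1\}^*$); complexity classes are classes of promise problems. A poly-time uniform family of quantum circuits $\{V_n\}_{n\in\mathbb N}$ is one for which a deterministic Turing machine, given an $n$-bit input, outputs in polynomial time a description of a circuit $V_n$ of 1- and 2-qubit gates, using all-zeros ancillas and outputting one qubit; $V_n$ accepts if measuring this qubit in the computational basis gives $1$. For $i\geq 1$ and poly-time computable $c,s:\mathbb N\to[0,1]$, $A\in\mathsf{QC\Sigma}_i(c,s)$ if there are a polynomial $p$ and such a family such that for every $n$-bit input $x$, $V_n$ takes $x$ and classical strings $y_1,\dots,y_i\in\{0,1\}^{p(n)}$, and: if $x\in A_{\mathrm{yes}}$ then $\exists y_1\forall y_2\exists y_3\cdots Q_iy_i$ with $\Pr[V_n\text{ accepts }(x,y_1,\dots,y_i)]\geq c(n)$; if $x\in A_{\mathrm{no}}$ then $\forall y_1\exists y_2\cdots\overline{Q}_iy_i$ with $\Pr[V_n\text{ accepts}]\leq s(n)$. Here $Q_i=\exists$ if $i$ is odd and $\forall$ if $i$ is even, and $\overline{Q}_i$ is the other quantifier. $\mathsf{QC\Pi}_i(c,s)$ is defined identically but with the quantifier sequences swapped: YES case $\forall y_1\exists y_2\cdots$ with acceptance probability $\geq c$, NO case $\exists y_1\forall y_2\cdots$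 with acceptance probability $\leq s$. Set $\mathsf{QC\Sigma}_i=\bigcup_{c-s\in\Omega(1/\mathrm{poly}(n))}\mathsf{QC\Sigma}_i(c,s)$, similarly $\mathsf{QC\Pi}_i$, and $\mathsf{QCPH}=\bigcup_i\mathsf{QC\Sigma}_i=\bigcup_i\mathsf{QC\Pi}_i$. *)

theory Defs
  imports "HOL-Analysis.Analysis" "HOL-Computational_Algebra.Polynomial"
begin

section \<open>Deterministic multi-tape Turing machines\<close>

text \<open>
  Symbols are natural numbers: 0 is the blank, 1 marks the leftmost cell of a tape, and 2 and 3
  stand for the bits 0 and 1; a machine may use further symbols below its alphabet size.  Tapes are
  infinite to the right, and a head on the leftmost cell that is told to move left stays there.
\<close>

type_synonym tape = "(nat \<Rightarrow> nat) \<times> nat"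

datatype move = MoveLeft | Stay | MoveRight

type_synonym command = "nat list \<Rightarrow> nat \<times> (nat \<times> move) list"

type_synonym config = "nat \<times> tape list"

text \<open>
  A machine is the list of the commands of its states.  The initial state is 0, and
  \<^term>\<open>length M\<close> is the halting state.
\<close>

type_synonym machine = "command list"

definition turing_machine :: "nat \<Rightarrow> nat \<Rightarrow> machine \<Rightarrow> bool" where
  "turing_machine k G M \<longleftrightarrow> k \<ge> 2 \<and> G \<ge> 4 \<and>
     (\<forall>cmd \<in> set M. \<forall>gs. length gs = k \<and> (\<forall>g \<in> set gs. g < G) \<longrightarrow>
        fst (cmd gs) \<le> length M \<and> length (snd (cmd gs)) = k \<and>
        (\<forall>a \<in> set (snd (cmd gs)). fst a < G))"

fun act :: "nat \<times> move \<Rightarrow> tape \<Rightarrow> tape" where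
  "act (h, d) (t, pos) =
     (t(pos := h),
      case d of MoveLeft \<Rightarrow> pos - 1 | Stay \<Rightarrow> pos | MoveRight \<Rightarrow> Suc pos)"

fun step :: "machine \<Rightarrow> config \<Rightarrow> config" where
  "step M (q, tps) =
     (if q < length M then
        (let (q', as) = (M ! q) (map (\<lambda>(t, pos). t pos) tps) in (q', map2 act as tps))
      else (q, tps))"

definition tape_contents :: "bool list \<Rightarrow> nat \<Rightarrow> nat" where
  "tape_contents x pos =
     (if pos = 0 then 1
      else if pos \<le> length x then (if x ! (pos - 1) then 3 else 2)
      else 0)"

definition start_config :: "nat \<Rightarrow> bool list \<Rightarrow> config" where
  "start_config k x = (0, (tape_contents x, 0) # replicate (k - 1) (tape_contents [], 0))"

text \<open>The input is on tape 0; the output is the final contents of tape 1.\<close>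

definition computes_within :: "nat \<Rightarrow> machine \<Rightarrow> bool list \<Rightarrow> bool list \<Rightarrow> nat \<Rightarrow> bool" where
  "computes_within k M x y T \<longleftrightarrow>
     (let (q, tps) = (step M ^^ T) (start_config k x)
      in q = length M \<and> fst (tps ! 1) = tape_contents y)"

definition poly_time_computable :: "(bool list \<Rightarrow> bool list) \<Rightarrow> bool" where
  "poly_time_computable f \<longleftrightarrow>
     (\<exists>k G M. \<exists>q :: nat poly. turing_machine k G M \<and>
        (\<forall>x. computes_within k M x (f x) (poly q (length x))))"

text \<open>
  A real-valued function of a natural number is poly-time computable if, given \<open>n\<close> and a precision
  \<open>r\<close> in unary, one can compute in polynomial time a binary fraction within \<open>2\<^sup>-\<^sup>r\<close> of its value
  at \<open>n\<close>.
\<close>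

definition binary_fraction :: "bool list \<Rightarrow> real" where
  "binary_fraction w = (\<Sum>j<length w. of_bool (w ! j) / 2 ^ Suc j)"

definition poly_time_real :: "(nat \<Rightarrow> real) \<Rightarrow> bool" where
  "poly_time_real c \<longleftrightarrow>
     (\<exists>f. poly_time_computable f \<and>
        (\<forall>n r. \<bar>c n - binary_fraction (f (replicate n True @ False # replicate r True))\<bar>
                 \<le> 1 / 2 ^ r))"


section \<open>Quantum circuits\<close>

text \<open>
  Bit strings serve as names of 1- and 2-qubit gates.  Everything below is relative to an arbitrary
  assignment of unitary matrices to names: this covers every finite gate set (several names may
  denote the same gate) as well as infinite families given by exact descriptions of the matrix
  entries.
\<close>

record gate_set =
  one_qubit :: "bool list \<Rightarrow> complex ^ bool ^ bool"
  two_qubit :: "bool list \<Rightarrow> complex ^ (bool \<times> bool) ^ (bool \<times> bool)"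

definition unitary_matrix :: "complex ^ 'n::finite ^ 'n \<Rightarrow> bool" where
  "unitary_matrix U \<longleftrightarrow> map_matrix cnj (transpose U) ** U = mat 1"

definition unitary_gates :: "gate_set \<Rightarrow> bool" where
  "unitary_gates \<G> \<longleftrightarrow>
     (\<forall>g. unitary_matrix (one_qubit \<G> g)) \<and> (\<forall>g. unitary_matrix (two_qubit \<G> g))"

text \<open>
  \<open>Proof_bit l j\<close> is the qubit holding bit \<open>j\<close> of the proof \<open>y\<^bsub>l+1\<^esub>\<close>; all indices start at 0.
\<close>

datatype wire = Input_bit nat | Proof_bit nat nat | Ancilla nat

datatype gate = Gate1 "bool list" wire | Gate2 "bool list" wire wire

datatype circuit = Circuit (gates: "gate list") (out_wire: wire)

definition input_wires :: "nat \<Rightarrow> nat \<Rightarrow> nat \<Rightarrow> wire set" where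
  "input_wires n i m =
     {Input_bit j | j. j < n} \<union> {Proof_bit l j | l j. l < i \<and> j < m} \<union> range Ancilla"

fun gate_on :: "wire set \<Rightarrow> gate \<Rightarrow> bool" where
  "gate_on W (Gate1 g v) \<longleftrightarrow> v \<in> W"
| "gate_on W (Gate2 g v w) \<longleftrightarrow> v \<in> W \<and> w \<in> W \<and> v \<noteq> w"

definition circuit_on :: "wire set \<Rightarrow> circuit \<Rightarrow> bool" where
  "circuit_on W C \<longleftrightarrow> (\<forall>g \<in> set (gates C). gate_on W g) \<and> out_wire C \<in> W"

text \<open>
  A state maps each computational basis state, i.e. each assignment of bits to the wires, to its
  amplitude.  The supply of ancillas is infinite, but the qubits that a circuit does not touch keep
  their initial value, so that all states below have finite support.
\<close>

type_synonym qstate = "(wire \<Rightarrow> bool) \<Rightarrow> complex"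

fun apply_gate :: "gate_set \<Rightarrow> gate \<Rightarrow> qstate \<Rightarrow> qstate" where
  "apply_gate \<G> (Gate1 g v) \<psi> =
     (\<lambda>b. \<Sum>a\<in>UNIV. one_qubit \<G> g $ (b v) $ a * \<psi> (b(v := a)))"
| "apply_gate \<G> (Gate2 g v w) \<psi> =
     (\<lambda>b. \<Sum>(a, a')\<in>UNIV. two_qubit \<G> g $ (b v, b w) $ (a, a') * \<psi> (b(v := a, w := a')))"

fun initial_bits :: "bool list \<Rightarrow> bool list list \<Rightarrow> wire \<Rightarrow> bool" where
  "initial_bits x ys (Input_bit j) \<longleftrightarrow> j < length x \<and> x ! j"
| "initial_bits x ys (Proof_bit l j) \<longleftrightarrow> l < length ys \<and> j < length (ys ! l) \<and> ys ! l ! j"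
| "initial_bits x ys (Ancilla j) \<longleftrightarrow> False"

definition initial_state :: "bool list \<Rightarrow> bool list list \<Rightarrow> qstate" where
  "initial_state x ys = (\<lambda>b. if b = initial_bits x ys then 1 else 0)"

definition final_state :: "gate_set \<Rightarrow> circuit \<Rightarrow> bool list \<Rightarrow> bool list list \<Rightarrow> qstate" where
  "final_state \<G> C x ys = fold (apply_gate \<G>) (gates C) (initial_state x ys)"

lemma finite_support_apply_gate:
  assumes "finite {b. \<psi> b \<noteq> 0}"
  shows "finite {b. apply_gate \<G> g \<psi> b \<noteq> 0}"
proof (cases g)
  case (Gate1 n v)
  have "{b. apply_gate \<G> g \<psi> b \<noteq> 0} \<subseteq> (\<Union>a. (\<lambda>b. b(v := a)) ` {b. \<psi> b \<noteq> 0})"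
  proof
    fix b assume "b \<in> {b. apply_gate \<G> g \<psi> b \<noteq> 0}"
    then have "\<not> (\<forall>a. \<psi> (b(v := a)) = 0)"
      by (intro notI) (simp add: Gate1)
    then obtain a where "\<psi> (b(v := a)) \<noteq> 0" by blast
    then have "b = (b(v := a))(v := b v)" "b(v := a) \<in> {b. \<psi> b \<noteq> 0}" by auto
    then show "b \<in> (\<Union>a. (\<lambda>b. b(v := a)) ` {b. \<psi> b \<noteq> 0})" by blast
  qed
  then show ?thesis using assms by (auto intro: finite_subset)
next
  case (Gate2 n v w)
  have "{b. apply_gate \<G> g \<psi> b \<noteq> 0}
          \<subseteq> (\<Union>a a'. (\<lambda>b. b(v := a, w := a')) ` {b. \<psi> b \<noteq> 0})"
  proof
    fix b assume "b \<in> {b. apply_gate \<G> g \<psi> b \<noteq> 0}"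
    then have "\<not> (\<forall>a a'. \<psi> (b(v := a, w := a')) = 0)"
      by (intro notI) (simp add: Gate2 case_prod_unfold)
    then obtain a a' where "\<psi> (b(v := a, w := a')) \<noteq> 0" by blast
    then have "b = (b(v := a, w := a'))(v := b v, w := b w)"
      "b(v := a, w := a') \<in> {b. \<psi> b \<noteq> 0}" by (auto simp: fun_eq_iff)
    then show "b \<in> (\<Union>a a'. (\<lambda>b. b(v := a, w := a')) ` {b. \<psi> b \<noteq> 0})" by blast
  qed
  then show ?thesis using assms by (auto intro: finite_subset)
qed

lemma finite_support_final_state: "finite {b. final_state \<G> C x ys b \<noteq> 0}"
proof -
  have "finite {b. fold (apply_gate \<G>) gs \<psi> b \<noteq> 0}" if "finite {b. \<psi> b \<noteq> 0}" for gs \<psi>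
    using that
  proof (induction gs arbitrary: \<psi>)
    case (Cons g gs)
    show ?case using Cons.IH[OF finite_support_apply_gate[OF Cons.prems]] by simp
  qed simp
  moreover have "finite {b. initial_state x ys b \<noteq> 0}"
    by (simp add: initial_state_def)
  ultimately show ?thesis by (simp add: final_state_def)
qed

text \<open>The probability that measuring the output qubit yields 1.\<close>

definition accept_prob :: "gate_set \<Rightarrow> circuit \<Rightarrow> bool list \<Rightarrow> bool list list \<Rightarrow> real" where
  "accept_prob \<G> C x ys =
     (\<Sum>b | final_state \<G> C x ys b \<noteq> 0 \<and> b (out_wire C). (cmod (final_state \<G> C x ys b))\<^sup>2)"


section \<open>Descriptions of circuits and uniformity\<close>

text \<open>
  Wire indices are written in unary.  This costs only a polynomial factor, since the ancillas of a
  circuit can be numbered consecutively.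
\<close>

definition enc_nat :: "nat \<Rightarrow> bool list" where
  "enc_nat n = replicate n True @ [False]"

definition enc_name :: "bool list \<Rightarrow> bool list" where
  "enc_name w = concat (map (\<lambda>b. [True, b]) w) @ [False]"

fun enc_wire :: "wire \<Rightarrow> bool list" where
  "enc_wire (Input_bit j) = enc_nat 0 @ enc_nat j"
| "enc_wire (Proof_bit l j) = enc_nat 1 @ enc_nat l @ enc_nat j"
| "enc_wire (Ancilla j) = enc_nat 2 @ enc_nat j"

fun enc_gate :: "gate \<Rightarrow> bool list" where
  "enc_gate (Gate1 g v) = False # enc_name g @ enc_wire v"
| "enc_gate (Gate2 g v w) = True # enc_name g @ enc_wire v @ enc_wire w"

definition enc_circuit :: "circuit \<Rightarrow> bool list" where
  "enc_circuit C =
     concat (map (\<lambda>g. True # enc_gate g) (gates C)) @ False # enc_wire (out_wire C)"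

lemma enc_nat_append_inject: "enc_nat m @ u = enc_nat n @ v \<longleftrightarrow> m = n \<and> u = v"
proof (induction m arbitrary: n)
  case 0
  show ?case by (cases n) (auto simp: enc_nat_def)
next
  case (Suc m)
  show ?case using Suc.IH by (cases n) (auto simp: enc_nat_def)
qed

lemma enc_name_append_inject: "enc_name x @ u = enc_name y @ v \<longleftrightarrow> x = y \<and> u = v"
proof (induction x arbitrary: y)
  case Nil
  show ?case by (cases y) (auto simp: enc_name_def)
next
  case (Cons a x)
  show ?case using Cons.IH by (cases y) (auto simp: enc_name_def)
qed

lemma enc_wire_append_inject: "enc_wire w @ u = enc_wire w' @ v \<longleftrightarrow> w = w' \<and> u = v"
  by (cases w; cases w') (simp_all add: enc_nat_append_inject)

lemma enc_gate_append_inject: "enc_gate g @ u = enc_gate g' @ v \<longleftrightarrow> g = g' \<and> u = v"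
  by (cases g; cases g') (auto simp: enc_name_append_inject enc_wire_append_inject)

lemma inj_enc_circuit: "inj enc_circuit"
proof (rule injI)
  fix C D :: circuit
  have "gs = hs \<and> v = w"
    if "concat (map (\<lambda>g. True # enc_gate g) gs) @ False # enc_wire v =
        concat (map (\<lambda>g. True # enc_gate g) hs) @ False # enc_wire w" for gs hs v w
    using that
  proof (induction gs arbitrary: hs)
    case Nil
    then show ?case using enc_wire_append_inject[of v "[]" w "[]"] by (cases hs) auto
  next
    case (Cons g gs)
    then show ?case by (cases hs) (auto simp: enc_gate_append_inject)
  qed
  then show "enc_circuit C = enc_circuit D \<Longrightarrow> C = D"
    unfolding enc_circuit_def by (metis circuit.expand)
qed

definition poly_time_uniform :: "(nat \<Rightarrow> circuit) \<Rightarrow> bool" where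
  "poly_time_uniform V \<longleftrightarrow> poly_time_computable (\<lambda>x. enc_circuit (V (length x)))"


section \<open>The quantum-classical polynomial hierarchy\<close>

text \<open>Promise problems are pairs (YES instances, NO instances).\<close>

type_synonym problem = "bool list set \<times> bool list set"

definition promise_problem :: "problem \<Rightarrow> bool" where
  "promise_problem A \<longleftrightarrow> fst A \<inter> snd A = {}"

text \<open>
  \<open>alternating True i m P\<close> is \<open>\<exists>y\<^sub>1 \<forall>y\<^sub>2 \<exists>y\<^sub>3 \<dots>. P [y\<^sub>1, \<dots>, y\<^sub>i]\<close> and \<open>alternating False i m P\<close> is
  \<open>\<forall>y\<^sub>1 \<exists>y\<^sub>2 \<forall>y\<^sub>3 \<dots>. P [y\<^sub>1, \<dots>, y\<^sub>i]\<close>, where the \<open>y\<^sub>j\<close> range over the bit strings of length \<open>m\<close>.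
\<close>

fun alternating :: "bool \<Rightarrow> nat \<Rightarrow> nat \<Rightarrow> (bool list list \<Rightarrow> bool) \<Rightarrow> bool" where
  "alternating e 0 m P \<longleftrightarrow> P []"
| "alternating True (Suc i) m P \<longleftrightarrow>
     (\<exists>y. length y = m \<and> alternating False i m (\<lambda>ys. P (y # ys)))"
| "alternating False (Suc i) m P \<longleftrightarrow>
     (\<forall>y. length y = m \<longrightarrow> alternating True i m (\<lambda>ys. P (y # ys)))"

text \<open>
  The first quantifier of the YES case is existential if \<open>e\<close> holds and universal otherwise; the NO
  case uses the opposite quantifiers.
\<close>

definition has_verifier ::
    "gate_set \<Rightarrow> bool \<Rightarrow> nat \<Rightarrow> (nat \<Rightarrow> real) \<Rightarrow> (nat \<Rightarrow> real) \<Rightarrow> problem \<Rightarrow> bool" where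
  "has_verifier \<G> e i c s A \<longleftrightarrow>
     (\<exists>(p :: nat poly) V.
        poly_time_uniform V \<and>
        (\<forall>n. circuit_on (input_wires n i (poly p n)) (V n)) \<and>
        (\<forall>n x. length x = n \<longrightarrow>
           (x \<in> fst A \<longrightarrow>
              alternating e i (poly p n) (\<lambda>ys. accept_prob \<G> (V n) x ys \<ge> c n)) \<and>
           (x \<in> snd A \<longrightarrow>
              alternating (\<not> e) i (poly p n) (\<lambda>ys. accept_prob \<G> (V n) x ys \<le> s n))))"

definition QCSigma_cs ::
    "gate_set \<Rightarrow> nat \<Rightarrow> (nat \<Rightarrow> real) \<Rightarrow> (nat \<Rightarrow> real) \<Rightarrow> problem set" where
  "QCSigma_cs \<G> i c s = {A. promise_problem A \<and> has_verifier \<G> True i c s A}"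

definition QCPi_cs ::
    "gate_set \<Rightarrow> nat \<Rightarrow> (nat \<Rightarrow> real) \<Rightarrow> (nat \<Rightarrow> real) \<Rightarrow> problem set" where
  "QCPi_cs \<G> i c s = {A. promise_problem A \<and> has_verifier \<G> False i c s A}"

text \<open>
  The last conjunct is \<open>c - s \<in> \<Omega>(1 / poly(n))\<close>.  It is spelled out because the Landau symbol of the
  library compares absolute values and would also admit \<open>c < s\<close>.
\<close>

definition admissible :: "(nat \<Rightarrow> real) \<Rightarrow> (nat \<Rightarrow> real) \<Rightarrow> bool" where
  "admissible c s \<longleftrightarrow>
     range c \<subseteq> {0..1} \<and> range s \<subseteq> {0..1} \<and> poly_time_real c \<and> poly_time_real s \<and>
     (\<exists>(q :: nat poly) C. q \<noteq> 0 \<and> C > 0 \<and>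
        (\<forall>\<^sub>F n in sequentially. c n - s n \<ge> C / real (poly q n)))"

definition QCSigma :: "gate_set \<Rightarrow> nat \<Rightarrow> problem set" where
  "QCSigma \<G> i = (\<Union>(c, s) \<in> {(c, s). admissible c s}. QCSigma_cs \<G> i c s)"

definition QCPi :: "gate_set \<Rightarrow> nat \<Rightarrow> problem set" where
  "QCPi \<G> i = (\<Union>(c, s) \<in> {(c, s). admissible c s}. QCPi_cs \<G> i c s)"

definition QCPH :: "gate_set \<Rightarrow> problem set" where
  "QCPH \<G> = (\<Union>i \<in> {1..}. QCSigma \<G> i)"

end

(*
  Adding a quantifier does not leave level k: the first proof of a problem in QC-Sigma_(i+1) is
  moved into the input, which gives a problem in QC-Pi_i.  If this is in QC-Sigma_k, then the moved
  proof is merged with the first proof of the new verifier, since both are quantified existentially.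
  The gates are arbitrary, so nothing can be added to a circuit, but both steps only rename its
  wires.  A verifier for the longer inputs has to recover the original length n; inputs are therefore
  padded to length pad^d(n), where pad n = n^2 + n + 1, which a machine inverts by subtracting
  1, 2, 4, 6, ...
*)

theory Submission
  imports Defs
begin

section \<open>Combining Turing machines\<close>

text \<open>Instances of the new problem keep the promise of the old one, together with the
  remaining quantified statement. This suffices: under a leading existential quantifier one good
  first proof is needed, and under a leading universal one every first proof yields an instance, so
  nothing has to be known about the new verifier outside its promise. A circuit family sees only the
  length of its input, so the recovery of n has to be a total function of lengths that a concrete
  machine computes. The form of \<open>pad\<close> comes from 2 + 4 + ... + 2n = n^2 + n: it needs
  only a counter that is walked over forth and back. Its iterates dominate every polynomial, so one
  pair of machines, iterated, serves all verifiers, and no machine ever evaluates the polynomial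
  that bounds the proofs. For the same reason the two merged proofs are interleaved rather than
  concatenated: the new name of a wire then depends on n alone and not on a proof length. The large
  share of Turing machines is due to uniformity: the encoding of a renamed circuit has to be
  produced by an explicit machine.\<close>

abbreviation read :: "tape list \<Rightarrow> nat list" where
  "read tps \<equiv> map (\<lambda>(t, pos). t pos) tps"

text \<open>Although \<open>T\<close> looks like an exact number of steps, it acts as an upper
  bound, because a halted machine no longer changes.\<close>

definition runs :: "machine \<Rightarrow> tape list \<Rightarrow> tape list \<Rightarrow> nat \<Rightarrow> bool" where
  "runs M a b T \<longleftrightarrow> (step M ^^ T) (0, a) = (length M, b)"

lemma steps_halted: "q \<ge> length M \<Longrightarrow> (step M ^^ T) (q, a) = (q, a)"
  by (induction T) auto

lemma runs_mono:
  assumes "runs M a b T" "T \<le> T'"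
  shows "runs M a b T'"
proof -
  have "(step M ^^ T') (0, a) = (step M ^^ (T' - T)) ((step M ^^ T) (0, a))"
    using assms(2) by (metis comp_apply funpow_add le_add_diff_inverse2)
  then show ?thesis using assms(1) by (simp add: runs_def steps_halted)
qed

definition relocate :: "nat \<Rightarrow> command \<Rightarrow> command" where
  "relocate d c = (\<lambda>gs. (d + fst (c gs), snd (c gs)))"

text \<open>The halting state of \<open>M\<close> becomes \<open>d + length M\<close>, the first
  state behind the block, so control falls through to whatever follows in \<open>N\<close>. The time
  is only bounded by \<open>T\<close>: \<open>M\<close> may halt early and idle, whereas
  \<open>N\<close> would go on.\<close>

lemma steps_relocated:
  assumes "(step M ^^ T) (q, a) = (length M, b)"
    and loc: "\<And>r. r < length M \<Longrightarrow> d + r < length N \<and> N ! (d + r) = relocate d (M ! r)"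
  shows "\<exists>t\<le>T. (step N ^^ t) (d + q, a) = (d + length M, b)"
  using assms(1)
proof (induction T arbitrary: q a)
  case 0
  then show ?case by auto
next
  case (Suc T)
  show ?case
  proof (cases "q < length M")
    case True
    obtain q' a' where s: "step M (q, a) = (q', a')" by fastforce
    then have "(step M ^^ T) (q', a') = (length M, b)"
      using Suc.prems by (simp add: funpow_swap1)
    from Suc.IH[OF this] obtain t where
      t: "t \<le> T" "(step N ^^ t) (d + q', a') = (d + length M, b)" by blast
    have "step N (d + q, a) = (d + q', a')"
      using s True loc[OF True] by (auto simp: relocate_def Let_def split: prod.splits)
    with t have "(step N ^^ Suc t) (d + q, a) = (d + length M, b)"
      by (simp add: funpow_swap1)
    with t(1) show ?thesis by (metis Suc_le_mono)
  next
    case False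
    then have "q = length M" "a = b"
      using Suc.prems steps_halted[of M q "Suc T" a] by auto
    then show ?thesis by (intro exI[of _ 0]) auto
  qed
qed

lemma steps_trans:
  assumes "\<exists>t\<le>T1. (step N ^^ t) u = v" "\<exists>t\<le>T2. (step N ^^ t) v = w"
  shows "\<exists>t\<le>T1 + T2. (step N ^^ t) u = w"
proof -
  obtain t1 t2 where "t1 \<le> T1" "(step N ^^ t1) u = v" "t2 \<le> T2" "(step N ^^ t2) v = w"
    using assms by blast
  then show ?thesis
    by (intro exI[of _ "t2 + t1"]) (auto simp: funpow_add)
qed

lemma runsI:
  assumes "\<exists>t\<le>T. (step M ^^ t) (0, a) = (length M, b)"
  shows "runs M a b T"
proof -
  obtain t where "t \<le> T" "runs M a b t" using assms by (auto simp: runs_def)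
  then show ?thesis by (blast intro: runs_mono)
qed

definition stay :: "nat list \<Rightarrow> (nat \<times> move) list" where
  "stay gs = map (\<lambda>g. (g, Stay)) gs"

lemma act_stay [simp]: "map2 act (stay (read tps)) tps = tps"
  by (induction tps) (auto simp: stay_def)

lemma act_update:
  "map2 act (as[i := a]) tps = (map2 act as tps)[i := act a (tps ! i)]"
  using zip_update[of as i a tps "tps ! i"] by (simp add: map_update)

section \<open>Programming constructs and their running times\<close>

definition DO :: "(nat list \<Rightarrow> (nat \<times> move) list) \<Rightarrow> machine" where
  "DO f = [\<lambda>gs. (1, f gs)]"

definition SEQ :: "machine \<Rightarrow> machine \<Rightarrow> machine"  (infixr \<open>;;\<close> 60) where
  "M1 ;; M2 = M1 @ map (relocate (length M1)) M2"

text \<open>State 0 tests, \<open>M1\<close> starts at state 1 and falls through to a state that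
  jumps over \<open>M2\<close>; in \<open>WHILE\<close> the corresponding state jumps back to 0. The
  test and the jump are the 2 extra steps in \<open>runs_IF\<close> and
  \<open>runs_WHILE_step\<close>.\<close>

definition IF :: "(nat list \<Rightarrow> bool) \<Rightarrow> machine \<Rightarrow> machine \<Rightarrow> machine" where
  "IF P M1 M2 =
     ([\<lambda>gs. (if P gs then 1 else 2 + length M1, stay gs)] @ map (relocate 1) M1 @
      [\<lambda>gs. (2 + length M1 + length M2, stay gs)]) @ map (relocate (2 + length M1)) M2"

definition WHILE :: "(nat list \<Rightarrow> bool) \<Rightarrow> machine \<Rightarrow> machine" where
  "WHILE P M =
     [\<lambda>gs. (if P gs then 1 else 2 + length M, stay gs)] @ map (relocate 1) M @
     [\<lambda>gs. (0, stay gs)]"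

lemma runs_DO: "map2 act (f (read a)) a = b \<Longrightarrow> runs (DO f) a b 1"
  by (simp add: runs_def DO_def)

lemma runs_SEQ:
  assumes "runs M1 a b T1" "runs M2 b c T2"
  shows "runs (M1 ;; M2) a c (T1 + T2)"
proof (rule runsI)
  let ?N = "M1 ;; M2"
  have 1: "\<exists>t\<le>T1. (step ?N ^^ t) (0 + 0, a) = (0 + length M1, b)"
    by (rule steps_relocated[where d = 0 and q = 0])
      (use assms(1) in \<open>auto simp: runs_def SEQ_def relocate_def nth_append\<close>)
  have 2: "\<exists>t\<le>T2. (step ?N ^^ t) (length M1 + 0, b) = (length M1 + length M2, c)"
    by (rule steps_relocated)
      (use assms(2) in \<open>auto simp: runs_def SEQ_def nth_append\<close>)
  show "\<exists>t\<le>T1 + T2. (step ?N ^^ t) (0, a) = (length ?N, c)"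
    using steps_trans[OF 1[unfolded add_0_left] 2[unfolded add_0_right]] by (simp add: SEQ_def)
qed

lemma IF_len: "length (IF P M1 M2) = 2 + length M1 + length M2"
  by (simp add: IF_def)

lemma runs_IF:
  assumes "P (read a) \<Longrightarrow> runs M1 a b T" "\<not> P (read a) \<Longrightarrow> runs M2 a b T"
  shows "runs (IF P M1 M2) a b (T + 2)"
proof (rule runsI)
  let ?N = "IF P M1 M2"
  show "\<exists>t\<le>T + 2. (step ?N ^^ t) (0, a) = (length ?N, b)"
  proof (cases "P (read a)")
    case True
    have "step ?N (0, a) = (1, a)" using True by (simp add: IF_def)
    then have 1: "\<exists>t\<le>1. (step ?N ^^ t) (0, a) = (1, a)" by (intro exI[of _ 1]) simp
    have 2: "\<exists>t\<le>T. (step ?N ^^ t) (1 + 0, a) = (1 + length M1, b)"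
      by (rule steps_relocated)
        (use assms(1)[OF True] in \<open>auto simp: runs_def IF_def nth_append\<close>)
    have 3: "\<exists>t\<le>1. (step ?N ^^ t) (1 + length M1, b) = (length ?N, b)"
      by (intro exI[of _ 1]) (simp add: IF_def nth_append)
    have eq: "1 + T + 1 = T + 2" by simp
    show ?thesis by (rule steps_trans[OF steps_trans[OF 1 2[unfolded add_0_right]] 3, unfolded eq])
  next
    case False
    have 1: "\<exists>t\<le>1. (step ?N ^^ t) (0, a) = (2 + length M1, a)"
      using False by (intro exI[of _ 1]) (simp add: IF_def)
    have nth: "?N ! (2 + length M1 + r) = relocate (2 + length M1) (M2 ! r)" if "r < length M2" for r
      using nth_append_length_plus[of "[\<lambda>gs. (if P gs then 1 else 2 + length M1, stay gs)] @
          map (relocate 1) M1 @ [\<lambda>gs. (2 + length M1 + length M2, stay gs)]" _ r] that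
      by (simp add: IF_def)
    have 2: "\<exists>t\<le>T. (step ?N ^^ t) (2 + length M1 + 0, a) = (2 + length M1 + length M2, b)"
    proof (rule steps_relocated)
      show "(step M2 ^^ T) (0, a) = (length M2, b)" using assms(2)[OF False] by (simp add: runs_def)
      show "2 + length M1 + r < length ?N \<and> ?N ! (2 + length M1 + r) = relocate (2 + length M1) (M2 ! r)"
        if "r < length M2" for r
        using nth[OF that] that by (simp add: IF_len)
    qed
    have "\<exists>t\<le>1+T. (step ?N ^^ t) (0, a) = (length ?N, b)"
      using steps_trans[OF 1 2[unfolded add_0_right]] by (simp add: IF_def)
    then obtain t where "t \<le> 1 + T" "(step ?N ^^ t) (0, a) = (length ?N, b)" by blast
    then show ?thesis by (intro exI[of _ t]) simp
  qed
qed

lemma runs_WHILE_done: "\<not> P (read a) \<Longrightarrow> runs (WHILE P M) a a 1"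
  by (simp add: runs_def WHILE_def)

lemma runs_WHILE_step:
  assumes "P (read a)" "runs M a b T1" "runs (WHILE P M) b c T2"
  shows "runs (WHILE P M) a c (T1 + T2 + 2)"
proof (rule runsI)
  let ?N = "WHILE P M"
  have 1: "\<exists>t\<le>1. (step ?N ^^ t) (0, a) = (1, a)"
    using assms(1) by (intro exI[of _ 1]) (auto simp: WHILE_def)
  have 2: "\<exists>t\<le>T1. (step ?N ^^ t) (1 + 0, a) = (1 + length M, b)"
    by (rule steps_relocated)
      (use assms(2) in \<open>auto simp: runs_def WHILE_def nth_append\<close>)
  have 3: "\<exists>t\<le>1. (step ?N ^^ t) (1 + length M, b) = (0, b)"
    by (intro exI[of _ 1]) (auto simp: WHILE_def nth_append)
  have 4: "\<exists>t\<le>T2. (step ?N ^^ t) (0, b) = (length ?N, c)"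
    using assms(3) by (auto simp: runs_def)
  have eq: "1 + T1 + 1 + T2 = T1 + T2 + 2" by simp
  show "\<exists>t\<le>T1 + T2 + 2. (step ?N ^^ t) (0, a) = (length ?N, c)"
    by (rule steps_trans[OF steps_trans[OF steps_trans[OF 1 2[unfolded add_0_right]] 3] 4, unfolded eq])
qed

text \<open>The condition of \<open>turing_machine\<close> for a single command. The bound
  \<open>n\<close> on the jump targets is a parameter because relocation changes it.\<close>

definition wf_command :: "nat \<Rightarrow> nat \<Rightarrow> nat \<Rightarrow> command \<Rightarrow> bool" where
  "wf_command k G n c \<longleftrightarrow>
     (\<forall>gs. length gs = k \<and> (\<forall>g \<in> set gs. g < G) \<longrightarrow>
        fst (c gs) \<le> n \<and> length (snd (c gs)) = k \<and> (\<forall>a \<in> set (snd (c gs)). fst a < G))"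

definition wf_machine :: "nat \<Rightarrow> nat \<Rightarrow> machine \<Rightarrow> bool" where
  "wf_machine k G M \<longleftrightarrow> (\<forall>c \<in> set M. wf_command k G (length M) c)"

lemma turing_machine_iff: "turing_machine k G M \<longleftrightarrow> k \<ge> 2 \<and> G \<ge> 4 \<and> wf_machine k G M"
  by (simp add: turing_machine_def wf_machine_def wf_command_def)

lemma wf_relocate:
  assumes "wf_command k G n c" "d + n \<le> n'"
  shows "wf_command k G n' (relocate d c)"
  unfolding wf_command_def
proof (intro allI impI)
  fix gs assume "length gs = k \<and> (\<forall>g \<in> set gs. g < G)"
  with assms(1) have "fst (c gs) \<le> n \<and> length (snd (c gs)) = k \<and> (\<forall>a \<in> set (snd (c gs)). fst a < G)"
    unfolding wf_command_def by blast
  with assms(2) show "fst (relocate d c gs) \<le> n' \<and> length (snd (relocate d c gs)) = k \<and>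
      (\<forall>a \<in> set (snd (relocate d c gs)). fst a < G)"
    by (simp add: relocate_def)
qed

lemma relocate_0: "relocate 0 c = c"
  by (simp add: relocate_def)

definition wf_action :: "nat \<Rightarrow> nat \<Rightarrow> (nat list \<Rightarrow> (nat \<times> move) list) \<Rightarrow> bool" where
  "wf_action k G f \<longleftrightarrow>
     (\<forall>gs. length gs = k \<and> (\<forall>g \<in> set gs. g < G) \<longrightarrow>
        length (f gs) = k \<and> (\<forall>a \<in> set (f gs). fst a < G))"

lemma wf_action_stay [simp]: "wf_action k G stay"
  by (auto simp: wf_action_def stay_def)

lemma wf_action_update:
  assumes "wf_action k G f"
    and "\<And>gs. length gs = k \<Longrightarrow> \<forall>g \<in> set gs. g < G \<Longrightarrow> fst (h gs) < G"
  shows "wf_action k G (\<lambda>gs. (f gs)[i := h gs])"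
  unfolding wf_action_def
proof (intro allI impI conjI ballI)
  fix gs assume gs: "length gs = k \<and> (\<forall>g \<in> set gs. g < G)"
  then show "length ((f gs)[i := h gs]) = k" using assms(1) by (simp add: wf_action_def)
  fix a assume "a \<in> set ((f gs)[i := h gs])"
  then have "a = h gs \<or> a \<in> set (f gs)" using set_update_subset_insert by fast
  then show "fst a < G" using gs assms unfolding wf_action_def by blast
qed

lemma wf_DO: "wf_action k G f \<Longrightarrow> wf_machine k G (DO f)"
  by (simp add: wf_machine_def DO_def wf_command_def wf_action_def)

lemma wf_command_stay: "(\<And>gs. t gs \<le> n) \<Longrightarrow> wf_command k G n (\<lambda>gs. (t gs, stay gs))"
  by (simp add: wf_command_def stay_def)

lemma wf_SEQ:
  assumes "wf_machine k G M1" "wf_machine k G M2"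
  shows "wf_machine k G (M1 ;; M2)"
proof -
  have "wf_command k G (length (M1 ;; M2)) c" if "c \<in> set M1" for c
    using wf_relocate[of k G "length M1" c 0] assms(1) that
    by (simp add: relocate_0 wf_machine_def SEQ_def)
  moreover have "wf_command k G (length (M1 ;; M2)) (relocate (length M1) c)" if "c \<in> set M2" for c
    by (rule wf_relocate[where n = "length M2"])
      (use assms(2) that in \<open>simp_all add: wf_machine_def SEQ_def\<close>)
  ultimately show ?thesis by (auto simp: wf_machine_def SEQ_def)
qed

lemma wf_IF:
  assumes "wf_machine k G M1" "wf_machine k G M2"
  shows "wf_machine k G (IF P M1 M2)"
proof -
  let ?n = "length (IF P M1 M2)"
  have "wf_command k G ?n (relocate 1 c)" if "c \<in> set M1" for c
    by (rule wf_relocate[where n = "length M1"])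
      (use assms(1) that in \<open>simp_all add: wf_machine_def IF_def\<close>)
  moreover have "wf_command k G ?n (relocate (2 + length M1) c)" if "c \<in> set M2" for c
    by (rule wf_relocate[where n = "length M2"])
      (use assms(2) that in \<open>simp_all add: wf_machine_def IF_def\<close>)
  moreover have "wf_command k G ?n (\<lambda>gs. (if P gs then 1 else 2 + length M1, stay gs))"
    "wf_command k G ?n (\<lambda>gs. (2 + length M1 + length M2, stay gs))"
    by (rule wf_command_stay, simp add: IF_def)+
  ultimately show ?thesis unfolding wf_machine_def
    by (subst IF_def) (simp add: ball_Un del: One_nat_def)
qed

lemma wf_WHILE:
  assumes "wf_machine k G M"
  shows "wf_machine k G (WHILE P M)"
proof -
  let ?n = "length (WHILE P M)"
  have "wf_command k G ?n (relocate 1 c)" if "c \<in> set M" for c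
    by (rule wf_relocate[where n = "length M"])
      (use assms that in \<open>simp_all add: wf_machine_def WHILE_def\<close>)
  moreover have "wf_command k G ?n (\<lambda>gs. (if P gs then 1 else 2 + length M, stay gs))"
    "wf_command k G ?n (\<lambda>gs. (0, stay gs))"
    by (rule wf_command_stay, simp add: WHILE_def)+
  ultimately show ?thesis unfolding wf_machine_def
    by (subst WHILE_def) (simp add: ball_Un del: One_nat_def)
qed

text \<open>Invariant for the embedding of machines: the commands of a machine are constrained only
  on symbols below its alphabet size.\<close>

definition tapes_below :: "nat \<Rightarrow> tape list \<Rightarrow> bool" where
  "tapes_below G ts \<longleftrightarrow> (\<forall>a \<in> set ts. \<forall>p. fst a p < G)"

lemma tapes_belowI: "(\<And>i p. i < length ts \<Longrightarrow> fst (ts ! i) p < G) \<Longrightarrow> tapes_below G ts"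
  unfolding tapes_below_def by (metis in_set_conv_nth)

lemma tapes_belowD: "tapes_below G ts \<Longrightarrow> i < length ts \<Longrightarrow> fst (ts ! i) p < G"
  by (auto simp: tapes_below_def)

lemma act_cases:
  obtains p where "act a (t, n) = (t(n := fst a), p)" "p \<le> Suc n"
  by (cases a; cases "snd a") auto

lemma step_tapes:
  assumes wf: "wf_machine k G M" and ts: "length ts = k" "tapes_below G ts"
    and st: "step M (q, ts) = (q', ts')"
  shows "length ts' = k \<and> tapes_below G ts' \<and>
    (\<forall>i<k. snd (ts' ! i) \<le> Suc (snd (ts ! i)) \<and>
       (\<forall>p. p \<noteq> snd (ts ! i) \<longrightarrow> fst (ts' ! i) p = fst (ts ! i) p))"
proof (cases "q < length M")
  case True
  define gs where "gs = read ts"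
  define as where "as = snd ((M ! q) gs)"
  have ts': "ts' = map2 act as ts"
    using st True by (auto simp: as_def gs_def Let_def split: prod.splits)
  have "length gs = k" "\<forall>g\<in>set gs. g < G"
    using ts by (auto simp: gs_def tapes_below_def)
  then have as: "length as = k" "\<forall>a\<in>set as. fst a < G"
    using wf nth_mem[OF True] unfolding as_def wf_machine_def wf_command_def by auto
  have loc: "snd (ts' ! i) \<le> Suc (snd (ts ! i)) \<and> fst (ts' ! i) = (fst (ts ! i))(snd (ts ! i) := fst (as ! i))"
    if "i < k" for i
  proof -
    obtain t n where tn: "ts ! i = (t, n)" by fastforce
    have "ts' ! i = act (as ! i) (t, n)" using that as ts tn by (simp add: ts')
    then show ?thesis using tn by (metis act_cases fst_conv snd_conv)
  qed
  moreover have "tapes_below G ts'"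
  proof (rule tapes_belowI)
    fix i p assume "i < length ts'"
    then have i: "i < k" using as ts by (simp add: ts')
    show "fst (ts' ! i) p < G"
      using loc[OF i] as i ts by (auto simp: tapes_belowD)
  qed
  ultimately show ?thesis using as ts by (auto simp: ts')
next
  case False
  then show ?thesis using st ts by auto
qed

text \<open>A head moves by at most one cell per step, so cells at distance \<open>T\<close> or more
  from its start are untouched. This later bounds the length of an output by the running
  time.\<close>

lemma steps_tapes:
  assumes wf: "wf_machine k G M" and ts: "length ts = k" "tapes_below G ts"
    and st: "(step M ^^ T) (q, ts) = (q', ts')"
  shows "length ts' = k \<and> tapes_below G ts' \<and>
    (\<forall>i<k. snd (ts' ! i) \<le> snd (ts ! i) + T \<and>
       (\<forall>p \<ge> snd (ts ! i) + T. fst (ts' ! i) p = fst (ts ! i) p))"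
  using st
proof (induction T arbitrary: q' ts')
  case 0
  then show ?case using ts by simp
next
  case (Suc T)
  obtain q1 ts1 where 1: "(step M ^^ T) (q, ts) = (q1, ts1)" by fastforce
  then have 2: "step M (q1, ts1) = (q', ts')" using Suc.prems by simp
  note IH = Suc.IH[OF 1]
  note loc = step_tapes[OF wf _ _ 2]
  have "snd (ts' ! i) \<le> snd (ts ! i) + Suc T \<and>
       (\<forall>p \<ge> snd (ts ! i) + Suc T. fst (ts' ! i) p = fst (ts ! i) p)" if "i < k" for i
  proof -
    have "snd (ts' ! i) \<le> Suc (snd (ts1 ! i))"
      "\<forall>p. p \<noteq> snd (ts1 ! i) \<longrightarrow> fst (ts' ! i) p = fst (ts1 ! i) p"
      "snd (ts1 ! i) \<le> snd (ts ! i) + T"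
      "\<forall>p \<ge> snd (ts ! i) + T. fst (ts1 ! i) p = fst (ts ! i) p"
      using IH loc that by auto
    then show ?thesis by fastforce
  qed
  then show ?case using IH loc by blast
qed

section \<open>Embedding a machine into one with more tapes\<close>

text \<open>Tape \<open>j\<close> of the small machine is played by tape \<open>\<sigma> j\<close>
  of the large one. On symbols from \<open>G\<close> on nothing is known about \<open>c\<close>; the
  idle command substituted there keeps the result well formed over a larger alphabet.\<close>

definition embed_command :: "(nat \<Rightarrow> nat) \<Rightarrow> nat \<Rightarrow> nat \<Rightarrow> command \<Rightarrow> command" where
  "embed_command \<sigma> k G c gs =
     (let hs = map (\<lambda>j. gs ! \<sigma> j) [0..<k]
      in if \<forall>h \<in> set hs. h < G then
           (fst (c hs),
            map (\<lambda>i. if i \<in> \<sigma> ` {..<k} then snd (c hs) ! inv_into {..<k} \<sigma> i else (gs ! i, Stay))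
              [0..<length gs])
         else (0, stay gs))"

definition embed :: "(nat \<Rightarrow> nat) \<Rightarrow> nat \<Rightarrow> nat \<Rightarrow> machine \<Rightarrow> machine" where
  "embed \<sigma> k G M = map (embed_command \<sigma> k G) M"

lemma embed_command_below:
  assumes "hs = map (\<lambda>j. gs ! \<sigma> j) [0..<k]" "\<forall>h \<in> set hs. h < G"
  shows "embed_command \<sigma> k G c gs =
    (fst (c hs), map (\<lambda>i. if i \<in> \<sigma> ` {..<k} then snd (c hs) ! inv_into {..<k} \<sigma> i else (gs ! i, Stay))
              [0..<length gs])"
  unfolding embed_command_def Let_def assms(1)[symmetric] if_P[OF assms(2)] ..

lemma embed_command_not_below:
  assumes "hs = map (\<lambda>j. gs ! \<sigma> j) [0..<k]" "\<not> (\<forall>h \<in> set hs. h < G)"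
  shows "embed_command \<sigma> k G c gs = (0, stay gs)"
  unfolding embed_command_def Let_def assms(1)[symmetric] if_not_P[OF assms(2)] ..

text \<open>The tapes \<open>ts\<close> of the small machine written over their places among the
  tapes \<open>tps\<close> of the large one; this is the simulation relation for
  \<open>embed\<close>.\<close>

definition merge :: "(nat \<Rightarrow> nat) \<Rightarrow> nat \<Rightarrow> tape list \<Rightarrow> tape list \<Rightarrow> tape list" where
  "merge \<sigma> k tps ts =
     map (\<lambda>i. if i \<in> \<sigma> ` {..<k} then ts ! inv_into {..<k} \<sigma> i else tps ! i) [0..<length tps]"

lemma length_merge [simp]: "length (merge \<sigma> k tps ts) = length tps"
  by (simp add: merge_def)

lemma merge_nth_image:
  assumes "inj_on \<sigma> {..<k}" "j < k" "\<sigma> j < length tps"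
  shows "merge \<sigma> k tps ts ! \<sigma> j = ts ! j"
  using assms by (simp add: merge_def inv_into_f_f)

lemma merge_nth_other:
  assumes "i \<notin> \<sigma> ` {..<k}" "i < length tps"
  shows "merge \<sigma> k tps ts ! i = tps ! i"
  using assms by (simp add: merge_def)

lemma merge_eqI:
  assumes "inj_on \<sigma> {..<k}" "length tps' = length tps"
    and "\<And>j. j < k \<Longrightarrow> \<sigma> j < length tps \<Longrightarrow> tps' ! \<sigma> j = ts ! j"
    and "\<And>i. i \<notin> \<sigma> ` {..<k} \<Longrightarrow> i < length tps \<Longrightarrow> tps' ! i = tps ! i"
  shows "merge \<sigma> k tps ts = tps'"
proof (rule nth_equalityI)
  fix i assume "i < length (merge \<sigma> k tps ts)"
  then have i: "i < length tps" by simp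
  show "merge \<sigma> k tps ts ! i = tps' ! i"
  proof (cases "i \<in> \<sigma> ` {..<k}")
    case True
    then obtain j where "j < k" "i = \<sigma> j" by auto
    then show ?thesis using assms i by (simp add: merge_nth_image)
  next
    case False
    then show ?thesis using assms i by (simp add: merge_nth_other)
  qed
qed (simp add: assms)

lemma read_nth: "i < length tps \<Longrightarrow> read tps ! i = fst (tps ! i) (snd (tps ! i))"
  by (simp add: case_prod_unfold)

lemma step_embed:
  assumes inj: "inj_on \<sigma> {..<k}" and sub: "\<sigma> ` {..<k} \<subseteq> {..<length tps}"
    and wf: "wf_machine k G M" and ts: "length ts = k" "tapes_below G ts"
    and st: "step M (q, ts) = (q', ts')"
  shows "step (embed \<sigma> k G M) (q, merge \<sigma> k tps ts) = (q', merge \<sigma> k tps ts')"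
proof (cases "q < length M")
  case True
  let ?mg = "merge \<sigma> k tps ts"
  define gs where "gs = read ?mg"
  define as where "as = snd ((M ! q) (read ts))"
  have gs: "length gs = length tps" by (simp add: gs_def)
  have \<sigma>: "\<sigma> j < length tps" if "j < k" for j using sub that by auto
  have hs: "map (\<lambda>j. gs ! \<sigma> j) [0..<k] = read ts"
  proof (rule nth_equalityI)
    fix j assume "j < length (map (\<lambda>j. gs ! \<sigma> j) [0..<k])"
    then have j: "j < k" by simp
    then have "gs ! \<sigma> j = fst (ts ! j) (snd (ts ! j))"
      using \<sigma>[OF j] inj unfolding gs_def by (subst read_nth) (simp_all add: merge_nth_image)
    then show "map (\<lambda>j. gs ! \<sigma> j) [0..<k] ! j = read ts ! j"
      using j ts(1) by (simp add: case_prod_unfold)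
  qed (simp add: ts)
  have below: "\<forall>h \<in> set (read ts). h < G"
    using ts(2) by (auto simp: tapes_below_def)
  then have as: "length as = k"
    using wf nth_mem[OF True] ts(1) unfolding as_def wf_machine_def wf_command_def by auto
  have st': "q' = fst ((M ! q) (read ts))" "ts' = map2 act as ts"
    using st True by (auto simp: as_def Let_def split: prod.splits)
  define bs where "bs = map (\<lambda>i. if i \<in> \<sigma> ` {..<k} then as ! inv_into {..<k} \<sigma> i
        else (gs ! i, Stay)) [0..<length gs]"
  have "(embed \<sigma> k G M ! q) gs = (q', bs)"
    using embed_command_below[OF hs[symmetric] below, of "M ! q"] True
    by (simp add: embed_def st' as_def bs_def)
  then have "step (embed \<sigma> k G M) (q, ?mg) = (q', map2 act bs ?mg)"
    using True by (simp add: gs_def embed_def)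
  also have "map2 act bs ?mg = merge \<sigma> k tps ts'"
  proof (rule merge_eqI[OF inj, symmetric])
    show "length (map2 act bs ?mg) = length tps" by (simp add: bs_def gs)
    show "map2 act bs ?mg ! \<sigma> j = ts' ! j" if "j < k" "\<sigma> j < length tps" for j
      using that inj ts as by (simp add: bs_def gs merge_nth_image st'(2) inv_into_f_f)
    show "map2 act bs ?mg ! i = tps ! i" if "i \<notin> \<sigma> ` {..<k}" "i < length tps" for i
    proof -
      have "gs ! i = fst (tps ! i) (snd (tps ! i))"
        using that unfolding gs_def by (subst read_nth) (simp_all add: merge_nth_other)
      then have "act (gs ! i, Stay) (tps ! i) = tps ! i"
        by (cases "tps ! i") simp
      then show ?thesis using that by (simp add: bs_def gs merge_nth_other)
    qed
  qed
  finally show ?thesis .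
next
  case False
  then show ?thesis using st by (auto simp: embed_def)
qed

lemma runs_embed:
  assumes inj: "inj_on \<sigma> {..<k}" and sub: "\<sigma> ` {..<k} \<subseteq> {..<length tps}"
    and wf: "wf_machine k G M" and ts: "length ts = k" "tapes_below G ts"
    and "runs M ts ts' T"
  shows "runs (embed \<sigma> k G M) (merge \<sigma> k tps ts) (merge \<sigma> k tps ts') T"
proof -
  have "(step (embed \<sigma> k G M) ^^ T) (q, merge \<sigma> k tps ts) = (q', merge \<sigma> k tps ts')"
    if "(step M ^^ T) (q, ts) = (q', ts')" for q q' ts'
    using that
  proof (induction T arbitrary: q' ts')
    case (Suc T)
    obtain q1 ts1 where 1: "(step M ^^ T) (q, ts) = (q1, ts1)" by fastforce
    then have 2: "step M (q1, ts1) = (q', ts')" using Suc.prems by simp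
    have "length ts1 = k" "tapes_below G ts1" using steps_tapes[OF wf ts 1] by auto
    then show ?case using step_embed[OF inj sub wf _ _ 2] Suc.IH[OF 1] by simp
  qed simp
  then show ?thesis using assms(6) by (simp add: runs_def embed_def)
qed

lemma wf_embed:
  assumes wf: "wf_machine k G M" and inj: "inj_on \<sigma> {..<k}" and sub: "\<sigma> ` {..<k} \<subseteq> {..<K}"
    and G: "G \<le> G'"
  shows "wf_machine K G' (embed \<sigma> k G M)"
  unfolding wf_machine_def
proof
  fix c' assume "c' \<in> set (embed \<sigma> k G M)"
  then obtain c where c: "c \<in> set M" "c' = embed_command \<sigma> k G c"
    unfolding embed_def by auto
  show "wf_command K G' (length (embed \<sigma> k G M)) c'"
    unfolding wf_command_def
  proof (intro allI impI)
    fix gs assume gs: "length gs = K \<and> (\<forall>g\<in>set gs. g < G')"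
    define hs where "hs = map (\<lambda>j. gs ! \<sigma> j) [0..<k]"
    show "fst (c' gs) \<le> length (embed \<sigma> k G M) \<and> length (snd (c' gs)) = K \<and>
        (\<forall>a\<in>set (snd (c' gs)). fst a < G')"
    proof (cases "\<forall>h\<in>set hs. h < G")
      case True
      have "length hs = k" by (simp add: hs_def)
      moreover have "wf_command k G (length M) c" using wf c(1) by (simp add: wf_machine_def)
      ultimately have "fst (c hs) \<le> length M \<and> length (snd (c hs)) = k \<and>
          (\<forall>a \<in> set (snd (c hs)). fst a < G)"
        using True unfolding wf_command_def by blast
      then have ch: "fst (c hs) \<le> length M" "length (snd (c hs)) = k"
        "\<forall>a \<in> set (snd (c hs)). fst a < G" by blast+
      define as where "as = map (\<lambda>i. if i \<in> \<sigma> ` {..<k} then snd (c hs) ! inv_into {..<k} \<sigma> i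
        else (gs ! i, Stay)) [0..<length gs]"
      have c': "c' gs = (fst (c hs), as)"
        using embed_command_below[OF hs_def True] by (simp add: c(2) as_def)
      have "fst a < G'" if a: "a \<in> set as" for a
      proof -
        obtain i where "i < length as" "as ! i = a" using a by (auto simp: in_set_conv_nth)
        moreover have "length as = length gs" unfolding as_def by simp
        ultimately have "i < K" using gs by simp
        have "as ! i = (if i \<in> \<sigma> ` {..<k} then snd (c hs) ! inv_into {..<k} \<sigma> i
          else (gs ! i, Stay))"
          using \<open>i < K\<close> gs unfolding as_def by (subst nth_map) simp_all
        with \<open>as ! i = a\<close> have i: "i < K" "a = (if i \<in> \<sigma> ` {..<k} then snd (c hs) ! inv_into {..<k} \<sigma> i
          else (gs ! i, Stay))" using \<open>i < K\<close> by simp_all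
        show ?thesis
        proof (cases "i \<in> \<sigma> ` {..<k}")
          case True
          then obtain j where "j < k" "i = \<sigma> j" by auto
          then have "a = snd (c hs) ! j" using i True inj by (simp add: inv_into_f_f)
          then have "fst a < G" using ch \<open>j < k\<close> by auto
          then show ?thesis using G by simp
        next
          case False
          then show ?thesis using i gs by simp
        qed
      qed
      moreover have "length as = K" using gs by (simp add: as_def)
      ultimately show ?thesis using ch by (simp add: c' embed_def)
    next
      case False
      then have "c' gs = (0, stay gs)" unfolding c(2) by (rule embed_command_not_below[OF hs_def])
      then show ?thesis using gs by (simp add: stay_def)
    qed
  qed
qed

section \<open>Composition of polynomial-time functions\<close>

lemma tape_contents_eq_1 [simp]: "tape_contents x p = 1 \<longleftrightarrow> p = 0"
  by (simp add: tape_contents_def)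

lemma tape_contents_eq_Suc_0 [simp]: "tape_contents x p = Suc 0 \<longleftrightarrow> p = 0"
  by (simp add: tape_contents_def)

lemma tape_contents_eq_0 [simp]: "tape_contents x p = 0 \<longleftrightarrow> p > length x"
  by (simp add: tape_contents_def)

lemma tape_contents_less: "G \<ge> 4 \<Longrightarrow> tape_contents x p < G"
  by (simp add: tape_contents_def)

lemma runs_DO1:
  "i < length a \<Longrightarrow> runs (DO (\<lambda>gs. (stay gs)[i := h gs])) a (a[i := act (h (read a)) (a ! i)]) 1"
  by (rule runs_DO) (simp add: act_update)

lemma runs_DO2:
  "runs (DO (\<lambda>gs. (stay gs)[i := h gs, j := h' gs])) a
     (a[i := act (h (read a)) (a ! i), j := act (h' (read a)) (a ! j)]) 1"
  by (rule runs_DO) (simp add: act_update)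

lemma WHILE_doneI: "\<not> P (read a) \<Longrightarrow> a = b \<Longrightarrow> 1 \<le> T \<Longrightarrow> runs (WHILE P M) a b T"
  using runs_WHILE_done runs_mono by blast

lemma WHILE_stepI:
  assumes "P (read a)" "runs M a b T1" "runs (WHILE P M) b c T2" "T1 + T2 + 2 \<le> T"
  shows "runs (WHILE P M) a c T"
  using runs_WHILE_step[OF assms(1-3)] assms(4) by (rule runs_mono)

lemma SEQ_I: "runs M1 a b T1 \<Longrightarrow> runs M2 b c T2 \<Longrightarrow> T1 + T2 \<le> T \<Longrightarrow> runs (M1 ;; M2) a c T"
  using runs_SEQ runs_mono by blast

text \<open>The marker 1 occurs only in the leftmost cell of a \<open>tape_contents\<close>, so it
  tells the head where to stop.\<close>

definition rewind :: "nat \<Rightarrow> machine" where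
  "rewind i = WHILE (\<lambda>gs. gs ! i \<noteq> 1) (DO (\<lambda>gs. (stay gs)[i := (gs ! i, MoveLeft)]))"

lemma runs_rewind:
  assumes "i < length a" "a ! i = (tape_contents x, n)"
  shows "runs (rewind i) a (a[i := (tape_contents x, 0)]) (3 * n + 1)"
  using assms
proof (induction n arbitrary: a)
  case 0
  then have "a[i := (tape_contents x, 0)] = a" by (metis list_update_id)
  with 0 show ?case
    unfolding rewind_def by (intro WHILE_doneI) (simp_all add: read_nth del: nth_map)
next
  case (Suc n)
  let ?b = "a[i := (tape_contents x, n)]"
  have step: "runs (DO (\<lambda>gs. (stay gs)[i := (gs ! i, MoveLeft)])) a ?b 1"
    using runs_DO1[OF Suc.prems(1), of "\<lambda>gs. (gs ! i, MoveLeft)"] Suc.prems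
    by (simp add: read_nth del: nth_map)
  have rest: "runs (rewind i) ?b (a[i := (tape_contents x, 0)]) (3 * n + 1)"
    using Suc.IH[of ?b] Suc.prems by simp
  show ?case unfolding rewind_def
    by (rule WHILE_stepI[OF _ step rest[unfolded rewind_def]])
      (use Suc.prems in \<open>simp_all add: read_nth del: nth_map\<close>)
qed

lemma wf_rewind: "wf_machine k G (rewind i)" if "i < k"
  unfolding rewind_def
  by (intro wf_WHILE wf_DO wf_action_update wf_action_stay) (use that in auto)

definition copy_tape :: "nat \<Rightarrow> nat \<Rightarrow> machine" where
  "copy_tape i j =
     WHILE (\<lambda>gs. gs ! i \<noteq> 0)
       (DO (\<lambda>gs. (stay gs)[i := (gs ! i, MoveRight), j := (gs ! i, MoveRight)])) ;;
     WHILE (\<lambda>gs. gs ! i \<noteq> 1)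
       (DO (\<lambda>gs. (stay gs)[i := (gs ! i, MoveLeft), j := (gs ! j, MoveLeft)]))"

lemma wf_copy_tape: "wf_machine k G (copy_tape i j)" if "i < k" "j < k"
  unfolding copy_tape_def
  by (intro wf_SEQ wf_WHILE wf_DO wf_action_update wf_action_stay) (use that in auto)

lemma tape_contents_take_update:
  assumes "p \<le> length x"
  shows "(tape_contents (take (p - 1) x))(p := tape_contents x p) = tape_contents (take p x)"
proof
  fix r
  show "((tape_contents (take (p - 1) x))(p := tape_contents x p)) r = tape_contents (take p x) r"
    using assms by (cases r p rule: linorder_cases) (auto simp: tape_contents_def)
qed

lemma runs_copy_tape:
  assumes ij: "i < length a" "j < length a" "i \<noteq> j"
    and a: "a ! i = (tape_contents x, 0)" "a ! j = (tape_contents [], 0)"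
  shows "runs (copy_tape i j) a (a[j := (tape_contents x, 0)]) (6 * length x + 8)"
proof -
  \<comment> \<open>Loop invariant with both heads on cell \<open>p\<close>: cells 1 to
    \<open>p - 1\<close> are copied. Truncated subtraction makes \<open>p = 0\<close> and
    \<open>p = 1\<close> agree, as cell 0 holds only the marker, which is on both tapes from the
    start.\<close>
  let ?f = "\<lambda>p. a[i := (tape_contents x, p), j := (tape_contents (take (p - 1) x), p)]"
  let ?b = "\<lambda>p. a[i := (tape_contents x, p), j := (tape_contents x, p)]"
  let ?M = "DO (\<lambda>gs. (stay gs)[i := (gs ! i, MoveRight), j := (gs ! i, MoveRight)])"
  let ?N = "DO (\<lambda>gs. (stay gs)[i := (gs ! i, MoveLeft), j := (gs ! j, MoveLeft)])"
  let ?P = "\<lambda>gs :: nat list. gs ! i \<noteq> 0" and ?Q = "\<lambda>gs :: nat list. gs ! i \<noteq> 1"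
  have 1: "runs (WHILE ?P ?M) (?f p) (?f (Suc (length x))) (3 * d + 1)"
    if "p + d = Suc (length x)" for p d
    using that
  proof (induction d arbitrary: p)
    case 0
    then show ?case using ij by (intro WHILE_doneI) (simp_all add: read_nth del: nth_map)
  next
    case (Suc d)
    have step: "runs ?M (?f p) (?f (Suc p)) 1"
      using runs_DO2[of i "\<lambda>gs. (gs ! i, MoveRight)" j "\<lambda>gs. (gs ! i, MoveRight)" "?f p"]
        tape_contents_take_update[of p x] Suc.prems ij
      by (simp add: read_nth list_update_swap[of i j] del: nth_map)
    show ?case
      by (rule WHILE_stepI[OF _ step Suc.IH]) (use Suc.prems ij in \<open>simp_all add: read_nth del: nth_map\<close>)
  qed
  have 2: "runs (WHILE ?Q ?N) (?b p) (?b 0) (3 * p + 1)" for p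
  proof (induction p)
    case 0
    then show ?case using ij by (intro WHILE_doneI) (simp_all add: read_nth del: nth_map)
  next
    case (Suc p)
    have step: "runs ?N (?b (Suc p)) (?b p) 1"
      using runs_DO2[of i "\<lambda>gs. (gs ! i, MoveLeft)" j "\<lambda>gs. (gs ! j, MoveLeft)" "?b (Suc p)"] ij
      by (simp add: read_nth list_update_swap[of i j] del: nth_map)
    show ?case
      by (rule WHILE_stepI[OF _ step Suc.IH]) (use ij in \<open>simp_all add: read_nth del: nth_map\<close>)
  qed
  have start: "?f 0 = a"
  proof -
    have "a[i := (tape_contents x, 0)] = a" "a[j := (tape_contents [], 0)] = a"
      using a by (metis list_update_id)+
    then show ?thesis by simp
  qed
  have mid: "?f (Suc (length x)) = ?b (Suc (length x))" by simp
  have fin: "?b 0 = a[j := (tape_contents x, 0)]"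
    using a by (metis list_update_id)
  have 3: "runs (WHILE ?P ?M) a (?b (Suc (length x))) (3 * Suc (length x) + 1)"
    using 1[of 0 "Suc (length x)"] unfolding start mid by simp
  show ?thesis unfolding copy_tape_def
    by (rule SEQ_I[OF 3 2[of "Suc (length x)", unfolded fin]]) simp
qed

definition tapes_of :: "nat \<Rightarrow> bool list list \<Rightarrow> tape list" where
  "tapes_of k ws = map (\<lambda>i. (tape_contents (if i < length ws then ws ! i else []), 0)) [0..<k]"

lemma length_tapes_of [simp]: "length (tapes_of k ws) = k"
  by (simp add: tapes_of_def)

lemma nth_tapes_of [simp]:
  "i < k \<Longrightarrow> tapes_of k ws ! i = (tape_contents (if i < length ws then ws ! i else []), 0)"
  by (simp add: tapes_of_def)

lemma tapes_below_tapes_of: "G \<ge> 4 \<Longrightarrow> tapes_below G (tapes_of k ws)"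
  by (rule tapes_belowI) (simp add: tape_contents_less)

lemma computes_within_iff:
  assumes "k \<ge> 1"
  shows "computes_within k M x y T \<longleftrightarrow>
     (\<exists>ts. runs M (tapes_of k [x]) ts T \<and> fst (ts ! 1) = tape_contents y)"
proof -
  have "start_config k x = (0, tapes_of k [x])"
    unfolding start_config_def using assms
    by (auto intro!: nth_equalityI simp: nth_Cons')
  then show ?thesis by (auto simp: computes_within_def runs_def split: prod.splits)
qed

lemma poly_nat_mono:
  fixes q :: "nat poly"
  shows "m \<le> n \<Longrightarrow> poly q m \<le> poly q n"
  by (induction q) (simp_all add: mult_mono add_mono)

text \<open>The machine \<open>M\<close> may assume that \<open>f x\<close> is already on tape 2
  while \<open>x\<close> is still on tape 0. Plain composition is one instance; the renaming of an
  encoded circuit is another, and there the original input is needed for its length.\<close>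

lemma poly_time_combine:
  assumes f: "poly_time_computable f"
    and k: "k \<ge> 3" and G: "G \<ge> 4" and wf: "wf_machine k G M"
    and M: "\<And>x. \<exists>ts. runs M (tapes_of k [x, [], f x]) ts (poly q (length x + length (f x))) \<and>
              fst (ts ! 1) = tape_contents (g x)"
  shows "poly_time_computable g"
proof -
  obtain k' G' M' q' where tm': "turing_machine k' G' M'"
    and comp': "\<And>x. computes_within k' M' x (f x) (poly q' (length x))"
    using f unfolding poly_time_computable_def by blast
  have k': "k' \<ge> 2" and G': "G' \<ge> 4" and wf': "wf_machine k' G' M'"
    using tm' by (auto simp: turing_machine_iff)
  define K where "K = k + k' - 1"
  \<comment> \<open>\<open>M'\<close> reads a copy of the input on tape \<open>k\<close>, so that
    tape 0 keeps \<open>x\<close> for \<open>M\<close>. Its output goes to tape 2, and its remaining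
    tapes lie behind tape \<open>k\<close>, so the other tapes of \<open>M\<close> stay
    blank.\<close>
  define \<sigma> where "\<sigma> = (\<lambda>j :: nat. if j = 0 then k else if j = 1 then 2 else k + j - 1)"
  define N where "N = copy_tape 0 k ;; embed \<sigma> k' G' M' ;; rewind 2 ;; embed id k G M"
  have inj: "inj_on \<sigma> {..<k'}" using k by (auto simp: inj_on_def \<sigma>_def)
  have sub: "\<sigma> ` {..<k'} \<subseteq> {..<K}" using k k' by (auto simp: \<sigma>_def K_def)
  have "wf_machine K (max G' G) N"
    unfolding N_def
    by (intro wf_SEQ wf_copy_tape wf_rewind wf_embed wf wf' inj sub) (use k k' in \<open>auto simp: K_def\<close>)
  then have tm: "turing_machine K (max G' G) N"
    using k k' G by (auto simp: turing_machine_iff K_def le_max_iff_disj)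
  \<comment> \<open>With \<open>T\<close> the time of \<open>M'\<close>: copying takes
    \<open>6 * length x + 8\<close>, running \<open>M'\<close> and rewinding its output at most
    \<open>4 * T + 1\<close>. \<open>M\<close> is charged at \<open>length x + T\<close>, since the
    output of \<open>M'\<close> is no longer than \<open>T\<close>.\<close>
  define Q where "Q = [:9, 6:] + 4 * q' + pcompose q ([:0, 1:] + q')"
  have "computes_within K N x (g x) (poly Q (length x))" for x
  proof -
    define T where "T = poly q' (length x)"
    define S1 where "S1 = (tapes_of K [x])[k := (tape_contents x, 0)]"
    have len1: "length S1 = K" by (simp add: S1_def)
    have kK: "k < K" "2 < K" using k k' by (auto simp: K_def)
    have r1: "runs (copy_tape 0 k) (tapes_of K [x]) S1 (6 * length x + 8)"
      unfolding S1_def by (rule runs_copy_tape) (use kK k in auto)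
    obtain ts where ts: "runs M' (tapes_of k' [x]) ts T" "fst (ts ! 1) = tape_contents (f x)"
      using comp'[of x] k' by (auto simp: computes_within_iff T_def)
    define S2 where "S2 = merge \<sigma> k' S1 ts"
    \<comment> \<open>Seen through \<open>\<sigma>\<close>, the tapes \<open>S1\<close> are already
      the initial tapes of \<open>M'\<close>.\<close>
    have "merge \<sigma> k' S1 (tapes_of k' [x]) = S1"
    proof (rule merge_eqI[OF inj])
      show "S1 ! \<sigma> j = tapes_of k' [x] ! j" if "j < k'" "\<sigma> j < length S1" for j
        using that k k' kK by (auto simp: S1_def \<sigma>_def K_def nth_list_update)
    qed auto
    then have r2: "runs (embed \<sigma> k' G' M') S1 S2 T"
      using runs_embed[OF inj _ wf' _ tapes_below_tapes_of[OF G'] ts(1), of S1] sub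
      by (simp add: S2_def len1)
    have ts_len: "length ts = k' \<and> (\<forall>i<k'. snd (ts ! i) \<le> T \<and>
        (\<forall>p\<ge>T. fst (ts ! i) p = fst (tapes_of k' [x] ! i) p))"
      using steps_tapes[OF wf' length_tapes_of tapes_below_tapes_of[OF G'] ts(1)[unfolded runs_def]]
      by simp
    \<comment> \<open>A longer output would have a bit in a cell that no head can have written
      within \<open>T\<close> steps and that was blank at the start.\<close>
    have bound: "length (f x) \<le> T"
    proof (rule ccontr)
      assume "\<not> length (f x) \<le> T"
      moreover have "fst (ts ! 1) p = tape_contents [] p" if "p \<ge> T" for p
        using ts_len that k' by auto
      ultimately have "tape_contents (f x) (length (f x)) = tape_contents [] (length (f x))"
        using ts(2) by simp
      then show False using \<open>\<not> length (f x) \<le> T\<close>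
        by (auto simp: tape_contents_def split: if_splits)
    qed
    obtain h where h: "ts ! 1 = (tape_contents (f x), h)" "h \<le> T"
      using ts(2) ts_len k' by (metis One_nat_def Suc_1 Suc_le_lessD prod.collapse)
    define S3 where "S3 = S2[2 := (tape_contents (f x), 0)]"
    have S2_2: "S2 ! 2 = (tape_contents (f x), h)"
      using merge_nth_image[OF inj, of 1 S1 ts] k' kK h by (simp add: S2_def len1 \<sigma>_def)
    have r3: "runs (rewind 2) S2 S3 (3 * T + 1)"
      using runs_mono[OF runs_rewind[OF _ S2_2], of "3 * T + 1"] h(2) kK
      by (simp add: S3_def S2_def len1)
    have S3: "S3 ! i = (tapes_of K [x]) ! i" if "i < k" "i \<noteq> 2" for i
    proof -
      have "i \<notin> \<sigma> ` {..<k'}" using that by (auto simp: \<sigma>_def)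
      then show ?thesis using that kK by (simp add: S3_def S2_def merge_nth_other S1_def)
    qed
    have len3: "length S3 = K" by (simp add: S3_def S2_def len1)
    have "merge id k S3 (tapes_of k [x, [], f x]) = S3"
    proof (rule merge_eqI)
      show "S3 ! id j = tapes_of k [x, [], f x] ! j" if "j < k" "id j < length S3" for j
      proof (cases "j = 2")
        case True
        then show ?thesis using k kK by (simp add: S3_def S2_def len1)
      next
        case False
        then show ?thesis using that S3[of j] kK
          by (cases "j = 0 \<or> j = 1") auto
      qed
    qed auto
    moreover obtain ts' where ts': "runs M (tapes_of k [x, [], f x]) ts' (poly q (length x + length (f x)))"
      "fst (ts' ! 1) = tape_contents (g x)" using M by blast
    ultimately have r4: "runs (embed id k G M) S3 (merge id k S3 ts') (poly q (length x + length (f x)))"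
      using runs_embed[OF _ _ wf _ tapes_below_tapes_of[OF G] ts'(1), of id S3] kK len3 by auto
    have time: "6 * length x + 8 + (T + (3 * T + 1 + poly q (length x + length (f x)))) \<le> poly Q (length x)"
      using poly_nat_mono[of "length x + length (f x)" "length x + T" q] bound
      by (simp add: Q_def T_def poly_pcompose)
    have r: "runs N (tapes_of K [x]) (merge id k S3 ts') (poly Q (length x))"
      unfolding N_def
      by (rule runs_mono[OF runs_SEQ[OF r1 runs_SEQ[OF r2 runs_SEQ[OF r3 r4]]] time])
    have "fst (merge id k S3 ts' ! 1) = tape_contents (g x)"
      using merge_nth_image[of id k 1 S3 ts'] k kK len3 ts'(2) by simp
    with r show ?thesis using kK by (subst computes_within_iff) auto
  qed
  with tm show ?thesis unfolding poly_time_computable_def by blast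
qed

lemma poly_time_compose:
  assumes f: "poly_time_computable f" and g: "poly_time_computable g"
  shows "poly_time_computable (\<lambda>x. g (f x))"
proof -
  obtain k G M q where tm: "turing_machine k G M"
    and comp: "\<And>x. computes_within k M x (g x) (poly q (length x))"
    using g unfolding poly_time_computable_def by blast
  have k: "k \<ge> 2" and G: "G \<ge> 4" and wf: "wf_machine k G M"
    using tm by (auto simp: turing_machine_iff)
  \<comment> \<open>The machine for \<open>g\<close> takes tape 2, where \<open>f x\<close> is, as
    its input tape and keeps tape 1 as its output tape; tape 0 is bypassed.\<close>
  define \<sigma> where "\<sigma> = (\<lambda>j :: nat. if j = 0 then 2 else if j = 1 then 1 else j + 1)"
  have inj: "inj_on \<sigma> {..<k}" by (auto simp: inj_on_def \<sigma>_def)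
  have sub: "\<sigma> ` {..<k} \<subseteq> {..<Suc k}" using k by (auto simp: \<sigma>_def)
  show ?thesis
  proof (rule poly_time_combine[OF f, of "Suc k" G "embed \<sigma> k G M" q])
    show "wf_machine (Suc k) G (embed \<sigma> k G M)" by (rule wf_embed[OF wf inj sub]) simp
    fix x
    obtain ts where ts: "runs M (tapes_of k [f x]) ts (poly q (length (f x)))"
      "fst (ts ! 1) = tape_contents (g (f x))"
      using comp[of "f x"] k by (auto simp: computes_within_iff)
    let ?S = "tapes_of (Suc k) [x, [], f x]"
    have "merge \<sigma> k ?S (tapes_of k [f x]) = ?S"
    proof (rule merge_eqI[OF inj])
      show "?S ! \<sigma> j = tapes_of k [f x] ! j" if "j < k" "\<sigma> j < length ?S" for j
        using that k by (auto simp: \<sigma>_def)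
    qed auto
    then have "runs (embed \<sigma> k G M) ?S (merge \<sigma> k ?S ts) (poly q (length (f x)))"
      using runs_embed[OF inj _ wf _ tapes_below_tapes_of[OF G] ts(1), of ?S] sub by simp
    then have "runs (embed \<sigma> k G M) ?S (merge \<sigma> k ?S ts) (poly q (length x + length (f x)))"
      by (rule runs_mono) (simp add: poly_nat_mono)
    moreover have "fst (merge \<sigma> k ?S ts ! 1) = tape_contents (g (f x))"
      using merge_nth_image[OF inj, of 1 ?S ts] k ts(2) by (simp add: \<sigma>_def)
    ultimately show "\<exists>ts. runs (embed \<sigma> k G M) ?S ts (poly q (length x + length (f x))) \<and>
        fst (ts ! 1) = tape_contents (g (f x))" by blast
  qed (use k G in auto)
qed

section \<open>Machines on three tapes\<close>

definition bit_symbol :: "bool \<Rightarrow> nat" where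
  "bit_symbol b = (if b then 3 else 2)"

lemma bit_symbol_simps [simp]: "bit_symbol True = 3" "bit_symbol False = 2"
  by (simp_all add: bit_symbol_def)

lemma bit_symbol_less: "G \<ge> 4 \<Longrightarrow> bit_symbol b < G"
  by (simp add: bit_symbol_def)

text \<open>The head is on the first cell of the second string.\<close>

definition zipper :: "bool list \<Rightarrow> bool list \<Rightarrow> tape" where
  "zipper u v = (tape_contents (u @ v), Suc (length u))"

lemma read_zipper [simp]:
  "(case zipper u [] of (t, p) \<Rightarrow> t p) = 0"
  "(case zipper u (b # v) of (t, p) \<Rightarrow> t p) = bit_symbol b"
  by (simp_all add: zipper_def tape_contents_def bit_symbol_def)

lemma tape_contents_append: "(tape_contents u)(Suc (length u) := bit_symbol b) = tape_contents (u @ [b])"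
  by (rule ext) (auto simp: tape_contents_def bit_symbol_def nth_append)

lemma act_zipper [simp]:
  "act (bit_symbol b, MoveRight) (zipper u []) = zipper (u @ [b]) []"
  "act (bit_symbol b, MoveRight) (zipper u (b # v)) = zipper (u @ [b]) v"
  by (simp_all add: zipper_def tape_contents_append fun_upd_idem_iff)
    (simp add: tape_contents_def bit_symbol_def)

definition put :: "nat \<Rightarrow> bool \<Rightarrow> machine" where
  "put i b = DO (\<lambda>gs. (stay gs)[i := (bit_symbol b, MoveRight)])"

definition move_head :: "nat \<Rightarrow> move \<Rightarrow> machine" where
  "move_head i d = DO (\<lambda>gs. (stay gs)[i := (gs ! i, d)])"

definition copy :: "nat \<Rightarrow> machine" where
  "copy i = DO (\<lambda>gs. (stay gs)[i := (gs ! i, MoveRight), 1 := (gs ! i, MoveRight)])"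

text \<open>Steps over the leftmost markers. In the programs below tape 0 holds the input, tape 1
  receives the output at its end, and tape 2 is a counter or holds the code of a circuit.\<close>

definition enter :: machine where
  "enter = DO (\<lambda>gs. (stay gs)[0 := (gs ! 0, MoveRight), 1 := (gs ! 1, MoveRight), 2 := (gs ! 2, MoveRight)])"

lemma wf_put: "wf_machine k G (put i b)" if "G \<ge> 4"
  unfolding put_def by (intro wf_DO wf_action_update wf_action_stay) (use that in \<open>auto simp: bit_symbol_less\<close>)

lemma wf_move_head: "wf_machine k G (move_head i d)" if "i < k"
  unfolding move_head_def by (intro wf_DO wf_action_update wf_action_stay) (use that in auto)

lemma wf_copy: "wf_machine k G (copy i)" if "i < k"
  unfolding copy_def by (intro wf_DO wf_action_update wf_action_stay) (use that in auto)

lemma wf_enter: "wf_machine k G enter" if "k \<ge> 3"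
  unfolding enter_def by (intro wf_DO wf_action_update wf_action_stay) (use that in auto)

lemmas wf_intros = wf_SEQ wf_IF wf_WHILE wf_put wf_move_head wf_copy wf_enter

lemma tapes_of_3: "tapes_of 3 [x, y, z] = [(tape_contents x, 0), (tape_contents y, 0), (tape_contents z, 0)]"
  by (simp add: tapes_of_def upt_rec eval_nat_numeral)

lemma tapes_of_3': "tapes_of 3 [x] = tapes_of 3 [x, [], []]"
  by (simp add: tapes_of_def upt_rec eval_nat_numeral)

lemma runs_enter:
  "runs enter (tapes_of 3 [x, y, z]) [zipper [] x, zipper [] y, zipper [] z] 1"
  unfolding enter_def tapes_of_3
  by (rule runs_DO) (simp add: stay_def numeral_2_eq_2 zipper_def)

lemma runs_put_1: "runs (put 1 b) [A, zipper u [], C] [A, zipper (u @ [b]) [], C] 1"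
  using runs_DO1[of 1 "[A, zipper u [], C]" "\<lambda>_. (bit_symbol b, MoveRight)"]
  by (simp add: put_def)

lemma runs_put_2: "runs (put 2 b) [A, B, zipper u []] [A, B, zipper (u @ [b]) []] 1"
  using runs_DO1[of 2 "[A, B, zipper u []]" "\<lambda>_. (bit_symbol b, MoveRight)"]
  by (simp add: put_def numeral_2_eq_2)

lemma runs_left:
  "runs (move_head 0 MoveLeft) [(t, p), B, C] [(t, p - 1), B, C] 1"
  "runs (move_head 1 MoveLeft) [A, (t, p), C] [A, (t, p - 1), C] 1"
  "runs (move_head 2 MoveLeft) [A, B, (t, p)] [A, B, (t, p - 1)] 1"
  using runs_DO1[of 0 "[(t, p), B, C]" "\<lambda>gs. (gs ! 0, MoveLeft)"]
    runs_DO1[of 1 "[A, (t, p), C]" "\<lambda>gs. (gs ! 1, MoveLeft)"]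
    runs_DO1[of 2 "[A, B, (t, p)]" "\<lambda>gs. (gs ! 2, MoveLeft)"]
  by (simp_all add: move_head_def numeral_2_eq_2)

lemma runs_right:
  "runs (move_head 0 MoveRight) [(t, p), B, C] [(t, Suc p), B, C] 1"
  "runs (move_head 1 MoveRight) [A, (t, p), C] [A, (t, Suc p), C] 1"
  "runs (move_head 2 MoveRight) [A, B, (t, p)] [A, B, (t, Suc p)] 1"
  using runs_DO1[of 0 "[(t, p), B, C]" "\<lambda>gs. (gs ! 0, MoveRight)"]
    runs_DO1[of 1 "[A, (t, p), C]" "\<lambda>gs. (gs ! 1, MoveRight)"]
    runs_DO1[of 2 "[A, B, (t, p)]" "\<lambda>gs. (gs ! 2, MoveRight)"]
  by (simp_all add: move_head_def numeral_2_eq_2)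

lemma runs_copy_0: "runs (copy 0) [zipper u (b # v), zipper y [], C] [zipper (u @ [b]) v, zipper (y @ [b]) [], C] 1"
  using runs_DO2[of 0 "\<lambda>gs. (gs ! 0, MoveRight)" 1 "\<lambda>gs. (gs ! 0, MoveRight)" "[zipper u (b # v), zipper y [], C]"]
  by (simp add: copy_def)

lemma runs_copy_2: "runs (copy 2) [A, zipper y [], zipper u (b # v)] [A, zipper (y @ [b]) [], zipper (u @ [b]) v] 1"
  using runs_DO2[of 2 "\<lambda>gs. (gs ! 2, MoveRight)" 1 "\<lambda>gs. (gs ! 2, MoveRight)" "[A, zipper y [], zipper u (b # v)]"]
  by (simp add: copy_def numeral_2_eq_2)

lemma runs_copy_rest:
  "runs (WHILE (\<lambda>gs. gs ! 0 \<noteq> 0) (copy 0)) [zipper u v, zipper y [], C]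
     [zipper (u @ v) [], zipper (y @ v) [], C] (3 * length v + 1)"
proof (induction v arbitrary: u y)
  case Nil
  then show ?case by (intro WHILE_doneI) simp_all
next
  case (Cons b v)
  show ?case
    using WHILE_stepI[OF _ runs_copy_0 Cons.IH[of "u @ [b]" "y @ [b]"]] by (simp add: bit_symbol_def)
qed

lemma poly_time_machine3:
  assumes wf: "wf_machine 3 4 M"
    and M: "\<And>x. \<exists>ts. runs M (tapes_of 3 [x, [], []]) ts (poly q (length x)) \<and> fst (ts ! 1) = tape_contents (f x)"
  shows "poly_time_computable f"
  unfolding poly_time_computable_def
proof (intro exI conjI allI)
  show "turing_machine 3 4 M" using wf by (simp add: turing_machine_iff)
  show "computes_within 3 M x (f x) (poly q (length x))" for x
    using M[of x] by (simp add: computes_within_iff tapes_of_3')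
qed

lemma fst_zipper [simp]: "fst (zipper u v) = tape_contents (u @ v)"
  by (simp add: zipper_def)

definition put_length :: machine where
  "put_length = WHILE (\<lambda>gs. gs ! 0 \<noteq> 0) (put 1 True ;; move_head 0 MoveRight)"

lemma runs_put_length:
  "runs put_length [zipper u v, zipper y [], C]
     [zipper (u @ v) [], zipper (y @ replicate (length v) True) [], C] (4 * length v + 1)"
  unfolding put_length_def
proof (induction v arbitrary: u y)
  case Nil
  then show ?case by (intro WHILE_doneI) simp_all
next
  case (Cons b v)
  have r: "runs (move_head 0 MoveRight) [zipper u (b # v), B, C] [zipper (u @ [b]) v, B, C] 1" for B C
    using runs_right(1)[of "tape_contents (u @ b # v)" "Suc (length u)" B C] by (simp add: zipper_def)
  show ?case
    using WHILE_stepI[OF _ runs_SEQ[OF runs_put_1 r] Cons.IH[of "u @ [b]" "y @ [True]"]]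
    by (simp add: bit_symbol_def)
qed

lemma wf_put_length: "wf_machine 3 4 put_length"
  unfolding put_length_def by (intro wf_intros) auto

lemma poly_time_length: "poly_time_computable (\<lambda>x. replicate (length x) True)"
proof (rule poly_time_machine3)
  show "wf_machine 3 4 (enter ;; put_length)" by (intro wf_intros wf_put_length) auto
  show "\<exists>ts. runs (enter ;; put_length) (tapes_of 3 [x, [], []]) ts (poly [:2, 4:] (length x)) \<and>
      fst (ts ! 1) = tape_contents (replicate (length x) True)" for x
    by (intro exI conjI, rule runs_mono[OF runs_SEQ[OF runs_enter runs_put_length]]) simp_all
qed

section \<open>Machines working on a unary prefix\<close>

text \<open>Acting on the leading ones and keeping the rest lets the same machine transform a length
  written in unary and the argument of a \<open>poly_time_real\<close> function, where the precision
  follows behind a \<open>False\<close>.\<close>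

definition map_prefix :: "(nat \<Rightarrow> nat) \<Rightarrow> bool list \<Rightarrow> bool list" where
  "map_prefix h w = replicate (h (length (takeWhile id w))) True @ dropWhile id w"

lemma split_prefix: "w = replicate (length (takeWhile id w)) True @ dropWhile id w"
proof -
  have "takeWhile id w = replicate (length (takeWhile id w)) True"
    by (rule replicate_eqI) (auto dest: set_takeWhileD)
  then show ?thesis using takeWhile_dropWhile_id[of id w] by metis
qed

text \<open>The empty list is included because a bare length in unary has nothing behind its
  ones.\<close>

definition unary_end :: "bool list \<Rightarrow> bool" where
  "unary_end r \<longleftrightarrow> r = [] \<or> \<not> hd r"

lemma unary_end_dropWhile: "unary_end (dropWhile id w)"
  using hd_dropWhile[of id w] by (auto simp: unary_end_def)

lemma read_unary_end:
  "unary_end r \<Longrightarrow> (case zipper u r of (t, p) \<Rightarrow> t p) \<noteq> 3"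
  by (cases r) (auto simp: unary_end_def)

lemma zipper_unary_right:
  "runs (move_head 0 MoveRight) [zipper (replicate k True) (True # v), B, C] [zipper (replicate (Suc k) True) v, B, C] 1"
  using runs_right(1)[of "tape_contents (replicate k True @ True # v)" "Suc k" B C]
  by (simp add: zipper_def replicate_app_Cons_same)

lemma poly_time_map_prefix:
  assumes wf: "wf_machine 3 4 M"
    and M: "\<And>m r. unary_end r \<Longrightarrow>
      \<exists>ts. runs M (tapes_of 3 [replicate m True @ r, [], []]) ts (poly q (m + length r)) \<and>
           fst (ts ! 1) = tape_contents (replicate (h m) True @ r)"
  shows "poly_time_computable (map_prefix h)"
proof (rule poly_time_machine3[OF wf])
  fix x :: "bool list"
  let ?m = "length (takeWhile id x)" and ?r = "dropWhile id x"
  have "?m + length ?r = length x"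
    by (metis length_append takeWhile_dropWhile_id)
  with M[OF unary_end_dropWhile, of ?m x] split_prefix[of x]
  show "\<exists>ts. runs M (tapes_of 3 [x, [], []]) ts (poly q (length x)) \<and>
      fst (ts ! 1) = tape_contents (map_prefix h x)"
    by (simp add: map_prefix_def)
qed

lemma zipper_replicate: "zipper (replicate k True) [] = (tape_contents (replicate k True), Suc k)"
  by (simp add: zipper_def)

abbreviation sweep_left :: "nat \<Rightarrow> machine \<Rightarrow> machine" where
  "sweep_left i M \<equiv> WHILE (\<lambda>gs. gs ! i \<noteq> 1) (M ;; move_head i MoveLeft)"

abbreviation sweep_right :: "nat \<Rightarrow> machine \<Rightarrow> machine" where
  "sweep_right i M \<equiv> WHILE (\<lambda>gs. gs ! i \<noteq> 0) (M ;; move_head i MoveRight)"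

section \<open>Machines for the padding function and its inverse\<close>

definition pad :: "nat \<Rightarrow> nat" where
  "pad n = n * n + n + 1"

text \<open>The counter on tape 2 grows from \<open>k\<close> to \<open>k + 1\<close> ones and is
  then walked over once in each direction; every visited cell puts a one on tape 1, hence
  \<open>2 * (k + 1)\<close> of them.\<close>

definition pad_round :: machine where
  "pad_round = put 2 True ;; move_head 2 MoveLeft ;; sweep_left 2 (put 1 True) ;;
     move_head 2 MoveRight ;; sweep_right 2 (put 1 True) ;; move_head 0 MoveRight"

definition pad_machine :: machine where
  "pad_machine = enter ;; WHILE (\<lambda>gs. gs ! 0 = 3) pad_round ;; put 1 True ;;
     WHILE (\<lambda>gs. gs ! 0 \<noteq> 0) (copy 0)"

lemma runs_pad_left:
  "runs (sweep_left 2 (put 1 True)) [A, zipper y [], (tape_contents w, p)]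
     [A, zipper (y @ replicate p True) [], (tape_contents w, 0)] (4 * p + 1)"
proof (induction p arbitrary: y)
  case 0
  then show ?case by (intro WHILE_doneI) simp_all
next
  case (Suc p)
  have 1: "runs (put 1 True ;; move_head 2 MoveLeft) [A, zipper y [], (tape_contents w, Suc p)]
      [A, zipper (y @ [True]) [], (tape_contents w, p)] 2"
    using runs_SEQ[OF runs_put_1 runs_left(3)[of _ _ "tape_contents w" "Suc p"]] by (simp add: numeral_2_eq_2)
  show ?case
    by (rule WHILE_stepI[OF _ 1 Suc.IH[of "y @ [True]", unfolded append_assoc append_Cons append_Nil replicate_Suc[symmetric]]]) simp_all
qed

lemma runs_pad_right:
  "p + d = Suc (length w) \<Longrightarrow>
   runs (sweep_right 2 (put 1 True)) [A, zipper y [], (tape_contents w, p)]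
     [A, zipper (y @ replicate d True) [], (tape_contents w, Suc (length w))] (4 * d + 1)"
proof (induction d arbitrary: y p)
  case 0
  then show ?case by (intro WHILE_doneI) simp_all
next
  case (Suc d)
  have 1: "runs (put 1 True ;; move_head 2 MoveRight) [A, zipper y [], (tape_contents w, p)]
      [A, zipper (y @ [True]) [], (tape_contents w, Suc p)] 2"
    using runs_SEQ[OF runs_put_1 runs_right(3)[of _ _ "tape_contents w" p]] by (simp add: numeral_2_eq_2)
  show ?case
    by (rule WHILE_stepI[OF _ 1 Suc.IH[of "Suc p" "y @ [True]", unfolded append_assoc append_Cons append_Nil replicate_Suc[symmetric]]])
      (use Suc.prems in simp_all)
qed

lemma runs_pad_round:
  "runs pad_round [zipper (replicate k True) (True # v), zipper y [], zipper (replicate k True) []]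
     [zipper (replicate (Suc k) True) v, zipper (y @ replicate (2 * Suc k) True) [],
      zipper (replicate (Suc k) True) []] (8 * k + 14)"
proof -
  let ?A = "zipper (replicate k True) (True # v)" and ?S = "tape_contents (replicate (Suc k) True)"
  have 1: "runs (put 2 True) [?A, zipper y [], zipper (replicate k True) []] [?A, zipper y [], (?S, Suc (Suc k))] 1"
    using runs_put_2[of True ?A "zipper y []" "replicate k True"]
    by (simp add: zipper_def replicate_append_same)
  have 2: "runs (move_head 2 MoveLeft) [?A, zipper y [], (?S, Suc (Suc k))] [?A, zipper y [], (?S, Suc k)] 1"
    using runs_left(3)[of ?A "zipper y []" ?S "Suc (Suc k)"] by simp
  note 3 = runs_pad_left[of ?A y "replicate (Suc k) True" "Suc k"]
  note 4 = runs_right(3)[of ?A "zipper (y @ replicate (Suc k) True) []" ?S 0]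
  have 5: "runs (sweep_right 2 (put 1 True)) [?A, zipper (y @ replicate (Suc k) True) [], (?S, Suc 0)]
     [?A, zipper (y @ replicate (2 * Suc k) True) [], zipper (replicate (Suc k) True) []] (4 * Suc k + 1)"
    using runs_pad_right[of "Suc 0" "Suc k" "replicate (Suc k) True" ?A "y @ replicate (Suc k) True"]
    by (simp only: append_assoc replicate_add[symmetric] mult_2 zipper_replicate length_replicate)
  note 6 = zipper_unary_right[of k v "zipper (y @ replicate (2 * Suc k) True) []" "zipper (replicate (Suc k) True) []"]
  show ?thesis unfolding pad_round_def
    by (rule runs_mono[OF runs_SEQ[OF 1 runs_SEQ[OF 2 runs_SEQ[OF 3 runs_SEQ[OF 4 runs_SEQ[OF 5 6]]]]]]) simp
qed

text \<open>The number \<open>d * (2 * k + d + 1)\<close> is the sum 2(k + 1) + ... + 2(k + d). For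
  \<open>k = 0\<close> it is one less than \<open>pad d\<close>, and \<open>pad_machine\<close> adds
  the missing one.\<close>

lemma runs_pad_rounds:
  assumes "unary_end r"
  shows "runs (WHILE (\<lambda>gs. gs ! 0 = 3) pad_round)
     [zipper (replicate k True) (replicate d True @ r), zipper y [], zipper (replicate k True) []]
     [zipper (replicate (k + d) True) r, zipper (y @ replicate (d * (2 * k + d + 1)) True) [],
      zipper (replicate (k + d) True) []] (d * (8 * (k + d) + 16) + 1)"
proof (induction d arbitrary: k y)
  case 0
  then show ?case using read_unary_end[OF assms] by (intro WHILE_doneI) simp_all
next
  case (Suc d)
  have eq: "2 * Suc k + d * (2 * Suc k + d + 1) = Suc d * (2 * k + Suc d + 1)"
    by (simp add: algebra_simps)
  have IH: "runs (WHILE (\<lambda>gs. gs ! 0 = 3) pad_round)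
     [zipper (replicate (Suc k) True) (replicate d True @ r), zipper (y @ replicate (2 * Suc k) True) [],
      zipper (replicate (Suc k) True) []]
     [zipper (replicate (k + Suc d) True) r, zipper (y @ replicate (Suc d * (2 * k + Suc d + 1)) True) [],
      zipper (replicate (k + Suc d) True) []] (d * (8 * (Suc k + d) + 16) + 1)"
    using Suc.IH[of "Suc k" "y @ replicate (2 * Suc k) True"]
    unfolding append_assoc replicate_add[symmetric] eq by simp
  show ?case
    unfolding replicate_Suc[of d] append_Cons by (rule WHILE_stepI[OF _ runs_pad_round IH]) (simp_all add: algebra_simps)
qed

lemma poly_time_pad: "poly_time_computable (map_prefix pad)"
proof (rule poly_time_map_prefix)
  show "wf_machine 3 4 pad_machine"
    unfolding pad_machine_def pad_round_def by (intro wf_intros) auto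
  fix m :: nat and r :: "bool list"
  assume r: "unary_end r"
  have 1: "runs (WHILE (\<lambda>gs. gs ! 0 = 3) pad_round)
     [zipper [] (replicate m True @ r), zipper [] [], zipper [] []]
     [zipper (replicate m True) r, zipper (replicate (m * (m + 1)) True) [], zipper (replicate m True) []]
     (m * (8 * m + 16) + 1)"
    using runs_pad_rounds[OF r, of 0 m "[]"] by simp
  have 2: "runs (put 1 True)
     [zipper (replicate m True) r, zipper (replicate (m * (m + 1)) True) [], zipper (replicate m True) []]
     [zipper (replicate m True) r, zipper (replicate (pad m) True) [], zipper (replicate m True) []] 1"
    using runs_put_1[of True "zipper (replicate m True) r" "replicate (m * (m + 1)) True" "zipper (replicate m True) []"]
    by (simp add: replicate_append_same pad_def del: replicate.simps) (simp add: algebra_simps)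
  have "m * (8 * m + 16) + 3 * length r + 10 \<le> 24 * (m + length r) * (m + length r) + 24 * (m + length r) + 24"
    by (simp add: algebra_simps)
  then have time: "1 + (m * (8 * m + 16) + 1 + (1 + (3 * length r + 1))) \<le> poly [:24, 24, 24:] (m + length r)"
    by (simp add: algebra_simps)
  show "\<exists>ts. runs pad_machine (tapes_of 3 [replicate m True @ r, [], []]) ts (poly [:24, 24, 24:] (m + length r)) \<and>
           fst (ts ! 1) = tape_contents (replicate (pad m) True @ r)"
    unfolding pad_machine_def
    by (intro exI conjI,
        rule runs_mono[OF runs_SEQ[OF runs_enter runs_SEQ[OF 1 runs_SEQ[OF 2 runs_copy_rest]]] time]) simp
qed

text \<open>The head stops behind the last one instead of running on, which implements truncated
  subtraction.\<close>

definition eat :: machine where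
  "eat = DO (\<lambda>gs. (stay gs)[0 := (gs ! 0, if gs ! 0 = 3 then MoveRight else Stay)])"

text \<open>\<open>k\<close> counts the rounds done and \<open>c\<close> is what is left. A last
  incomplete round counts as well, because subtraction stops at 0; hence \<open>unpad\<close> is
  total and rounds up between two values of \<open>pad\<close>.\<close>

fun rounds :: "nat \<Rightarrow> nat \<Rightarrow> nat" where
  "rounds k 0 = k"
| "rounds k (Suc c) = rounds (Suc k) (Suc c - 2 * Suc k)"

definition unpad :: "nat \<Rightarrow> nat" where
  "unpad m = rounds 0 (m - 1)"

text \<open>The counter is kept on tape 1, where it is also the result. Each of its cells eats a one
  of the input on the way left and again on the way right.\<close>

definition unpad_round :: machine where
  "unpad_round = put 1 True ;; move_head 1 MoveLeft ;; sweep_left 1 eat ;;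
     move_head 1 MoveRight ;; sweep_right 1 eat"

definition unpad_machine :: machine where
  "unpad_machine = enter ;; IF (\<lambda>gs. gs ! 0 = 3) (move_head 0 MoveRight) [] ;;
     WHILE (\<lambda>gs. gs ! 0 = 3) unpad_round ;; WHILE (\<lambda>gs. gs ! 0 \<noteq> 0) (copy 0)"

text \<open>Of the \<open>m\<close> ones, \<open>c\<close> are still ahead of the head.\<close>

definition unary_tape :: "nat \<Rightarrow> bool list \<Rightarrow> nat \<Rightarrow> tape" where
  "unary_tape m r c = zipper (replicate (m - c) True) (replicate c True @ r)"

lemma read_unary_tape:
  "unary_end r \<Longrightarrow> (case unary_tape m r c of (t, p) \<Rightarrow> t p) = 3 \<longleftrightarrow> c > 0"
  using read_unary_end[of r "replicate m True"] by (cases c) (simp_all add: unary_tape_def)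

lemma runs_eat:
  assumes "unary_end r" "c \<le> m"
  shows "runs eat [unary_tape m r c, B, C] [unary_tape m r (c - 1), B, C] 1"
proof (cases c)
  case 0
  obtain t p where tp: "unary_tape m r 0 = (t, p)" by fastforce
  then have "t p \<noteq> 3" using read_unary_tape[OF assms(1), of m 0] by simp
  then show ?thesis
    using runs_DO1[of 0 "[unary_tape m r c, B, C]" "\<lambda>gs. (gs ! 0, if gs ! 0 = 3 then MoveRight else Stay)"] 0
    by (simp add: eat_def tp)
next
  case (Suc c')
  then have "m - c' = Suc (m - c)" using assms(2) by simp
  then have "unary_tape m r c' = zipper (replicate (m - c) True @ [True]) (replicate c' True @ r)"
    by (simp add: unary_tape_def replicate_append_same)
  moreover have "unary_tape m r c = zipper (replicate (m - c) True) (True # replicate c' True @ r)"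
    by (simp add: unary_tape_def Suc)
  ultimately show ?thesis
    using runs_DO1[of 0 "[unary_tape m r c, B, C]" "\<lambda>gs. (gs ! 0, if gs ! 0 = 3 then MoveRight else Stay)"] Suc
      act_zipper(2)[of True]
    by (simp add: eat_def)
qed

lemma runs_unpad_left:
  assumes "unary_end r"
  shows "c \<le> m \<Longrightarrow> runs (sweep_left 1 eat) [unary_tape m r c, (tape_contents w, p), C]
     [unary_tape m r (c - p), (tape_contents w, 0), C] (4 * p + 1)"
proof (induction p arbitrary: c)
  case 0
  then show ?case by (intro WHILE_doneI) simp_all
next
  case (Suc p)
  have 1: "runs (eat ;; move_head 1 MoveLeft) [unary_tape m r c, (tape_contents w, Suc p), C]
      [unary_tape m r (c - 1), (tape_contents w, p), C] 2"
    using runs_SEQ[OF runs_eat[OF assms Suc.prems] runs_left(2)[of _ "tape_contents w" "Suc p"]] by (simp add: numeral_2_eq_2)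
  show ?case
    by (rule WHILE_stepI[OF _ 1 Suc.IH[of "c - 1", unfolded diff_diff_left plus_1_eq_Suc]])
      (use Suc.prems in simp_all)
qed

lemma runs_unpad_right:
  assumes "unary_end r"
  shows "c \<le> m \<Longrightarrow> p + d = Suc (length w) \<Longrightarrow>
    runs (sweep_right 1 eat) [unary_tape m r c, (tape_contents w, p), C]
     [unary_tape m r (c - d), (tape_contents w, Suc (length w)), C] (4 * d + 1)"
proof (induction d arbitrary: c p)
  case 0
  then show ?case by (intro WHILE_doneI) simp_all
next
  case (Suc d)
  have 1: "runs (eat ;; move_head 1 MoveRight) [unary_tape m r c, (tape_contents w, p), C]
      [unary_tape m r (c - 1), (tape_contents w, Suc p), C] 2"
    using runs_SEQ[OF runs_eat[OF assms Suc.prems(1)] runs_right(2)[of _ "tape_contents w" p]] by (simp add: numeral_2_eq_2)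
  show ?case
    by (rule WHILE_stepI[OF _ 1 Suc.IH[of "c - 1" "Suc p", unfolded diff_diff_left plus_1_eq_Suc]])
      (use Suc.prems in simp_all)
qed

lemma runs_unpad_round:
  assumes "unary_end r" "c \<le> m"
  shows "runs unpad_round [unary_tape m r c, zipper (replicate k True) [], C]
     [unary_tape m r (c - 2 * Suc k), zipper (replicate (Suc k) True) [], C] (8 * k + 13)"
proof -
  let ?A = "unary_tape m r" and ?S = "tape_contents (replicate (Suc k) True)"
  have 1: "runs (put 1 True) [?A c, zipper (replicate k True) [], C] [?A c, (?S, Suc (Suc k)), C] 1"
    using runs_put_1[of True "?A c" "replicate k True" C]
    by (simp add: zipper_def replicate_append_same)
  have 2: "runs (move_head 1 MoveLeft) [?A c, (?S, Suc (Suc k)), C] [?A c, (?S, Suc k), C] 1"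
    using runs_left(2)[of "?A c" ?S "Suc (Suc k)" C] by simp
  note 3 = runs_unpad_left[OF assms, of "replicate (Suc k) True" "Suc k" C]
  note 4 = runs_right(2)[of "?A (c - Suc k)" ?S 0 C]
  have 5: "runs (sweep_right 1 eat) [?A (c - Suc k), (?S, Suc 0), C]
     [?A (c - 2 * Suc k), zipper (replicate (Suc k) True) [], C] (4 * Suc k + 1)"
    using runs_unpad_right[OF assms(1), of "c - Suc k" m "Suc 0" "Suc k" "replicate (Suc k) True" C] assms(2)
    by (simp add: zipper_replicate mult_2 del: replicate.simps)
  show ?thesis unfolding unpad_round_def
    by (rule runs_mono[OF runs_SEQ[OF 1 runs_SEQ[OF 2 runs_SEQ[OF 3 runs_SEQ[OF 4 5]]]]]) simp
qed

lemma runs_unpad_rounds: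
  assumes "unary_end r"
  shows "c \<le> m \<Longrightarrow> runs (WHILE (\<lambda>gs. gs ! 0 = 3) unpad_round)
     [unary_tape m r c, zipper (replicate k True) [], C]
     [unary_tape m r 0, zipper (replicate (rounds k c) True) [], C] (c * (8 * (k + c) + 16) + 1)"
proof (induction k c rule: rounds.induct)
  case (1 k)
  then show ?case using read_unary_tape[OF assms, of m 0] by (intro WHILE_doneI) simp_all
next
  case (2 k c)
  define e where "e = Suc c - 2 * Suc k"
  have e: "e \<le> c" by (simp add: e_def)
  have "e * (8 * (Suc k + e) + 16) \<le> c * (8 * (Suc k + c) + 16)"
    using e by (intro mult_mono add_mono) auto
  then have time: "8 * k + 13 + (e * (8 * (Suc k + e) + 16) + 1) + 2 \<le> Suc c * (8 * (k + Suc c) + 16) + 1"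
    by simp
  have IH: "runs (WHILE (\<lambda>gs. gs ! 0 = 3) unpad_round)
     [unary_tape m r e, zipper (replicate (Suc k) True) [], C]
     [unary_tape m r 0, zipper (replicate (rounds k (Suc c)) True) [], C] (e * (8 * (Suc k + e) + 16) + 1)"
    using 2 e by (simp add: e_def del: replicate.simps)
  show ?case
    by (rule WHILE_stepI[OF _ runs_unpad_round[OF assms "2.prems"] IH[unfolded e_def] time[unfolded e_def]])
      (use read_unary_tape[OF assms, of m "Suc c"] in simp)
qed

lemma poly_time_unpad: "poly_time_computable (map_prefix unpad)"
proof (rule poly_time_map_prefix)
  show "wf_machine 3 4 unpad_machine"
    unfolding unpad_machine_def unpad_round_def eat_def
    by (intro wf_intros wf_DO wf_action_update wf_action_stay) (auto simp: wf_machine_def)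
  fix m :: nat and r :: "bool list"
  assume r: "unary_end r"
  let ?u = "unary_tape m r"
  have start: "zipper [] (replicate m True @ r) = ?u m" by (simp add: unary_tape_def)
  \<comment> \<open>This undoes the summand 1 of \<open>pad\<close>; the test covers
    \<open>m = 0\<close>, where nothing can be removed.\<close>
  have 1: "runs (IF (\<lambda>gs. gs ! 0 = 3) (move_head 0 MoveRight) [])
     [?u m, zipper [] [], zipper [] []] [?u (m - 1), zipper [] [], zipper [] []] (1 + 2)"
  proof (rule runs_IF)
    assume "read [?u m, zipper [] [], zipper [] []] ! 0 = 3"
    then have "m > 0" using read_unary_tape[OF r, of m m] by simp
    then obtain m' where m': "m = Suc m'" by (cases m) auto
    show "runs (move_head 0 MoveRight) [?u m, zipper [] [], zipper [] []] [?u (m - 1), zipper [] [], zipper [] []] 1"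
      using zipper_unary_right[of 0 "replicate m' True @ r"] by (simp add: unary_tape_def m' Suc_diff_le)
  next
    assume "read [?u m, zipper [] [], zipper [] []] ! 0 \<noteq> 3"
    then have "m = 0" using read_unary_tape[OF r, of m m] by simp
    then show "runs [] [?u m, zipper [] [], zipper [] []] [?u (m - 1), zipper [] [], zipper [] []] 1"
      by (simp add: runs_def)
  qed
  have 2: "runs (WHILE (\<lambda>gs. gs ! 0 = 3) unpad_round)
     [?u (m - 1), zipper [] [], zipper [] []]
     [zipper (replicate m True) r, zipper (replicate (unpad m) True) [], zipper [] []]
     ((m - 1) * (8 * (m - 1) + 16) + 1)"
    using runs_unpad_rounds[OF r, of "m - 1" m 0 "zipper [] []"] by (simp add: unpad_def unary_tape_def)
  have "(m - 1) * (8 * (m - 1) + 16) \<le> m * (8 * m + 16)" by (intro mult_mono) auto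
  then have time: "1 + (1 + 2 + ((m - 1) * (8 * (m - 1) + 16) + 1 + (3 * length r + 1))) \<le> poly [:24, 24, 24:] (m + length r)"
    by (simp add: algebra_simps)
  show "\<exists>ts. runs unpad_machine (tapes_of 3 [replicate m True @ r, [], []]) ts (poly [:24, 24, 24:] (m + length r)) \<and>
           fst (ts ! 1) = tape_contents (replicate (unpad m) True @ r)"
    unfolding unpad_machine_def
    by (intro exI conjI,
        rule runs_mono[OF runs_SEQ[OF runs_enter[of "replicate m True @ r" "[]" "[]", unfolded start] runs_SEQ[OF 1 runs_SEQ[OF 2 runs_copy_rest]]] time]) simp
qed

section \<open>Renaming the wires of encoded circuits\<close>

fun rename_gate :: "(wire \<Rightarrow> wire) \<Rightarrow> gate \<Rightarrow> gate" where
  "rename_gate \<rho> (Gate1 g v) = Gate1 g (\<rho> v)"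
| "rename_gate \<rho> (Gate2 g v w) = Gate2 g (\<rho> v) (\<rho> w)"

definition rename :: "(wire \<Rightarrow> wire) \<Rightarrow> circuit \<Rightarrow> circuit" where
  "rename \<rho> C = Circuit (map (rename_gate \<rho>) (gates C)) (\<rho> (out_wire C))"

lemma IF_true: "P (read a) \<Longrightarrow> runs M1 a b T \<Longrightarrow> runs (IF P M1 M2) a b (T + 2)"
  using runs_IF[of P a M1 b T M2] by blast

lemma IF_false: "\<not> P (read a) \<Longrightarrow> runs M2 a b T \<Longrightarrow> runs (IF P M1 M2) a b (T + 2)"
  using runs_IF[of P a M1 b T M2] by blast

lemma runs_skip: "runs (move_head 2 MoveRight) [A, B, zipper u (b # v)] [A, B, zipper (u @ [b]) v] 1"
  using runs_right(3)[of A B "tape_contents (u @ b # v)" "Suc (length u)"] by (simp add: zipper_def)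

definition copy_ones :: machine where
  "copy_ones = WHILE (\<lambda>gs. gs ! 2 = 3) (copy 2)"

lemma runs_copy_ones:
  assumes "unary_end r"
  shows "runs copy_ones [A, zipper y [], zipper u (replicate j True @ r)]
     [A, zipper (y @ replicate j True) [], zipper (u @ replicate j True) r] (3 * j + 1)"
  unfolding copy_ones_def
proof (induction j arbitrary: y u)
  case 0
  then show ?case using read_unary_end[OF assms] by (intro WHILE_doneI) simp_all
next
  case (Suc j)
  show ?case unfolding replicate_Suc append_Cons
    by (rule WHILE_stepI[OF _ runs_copy_2 Suc.IH[of "y @ [True]" "u @ [True]", unfolded append_assoc append_Cons append_Nil]])
      simp_all
qed

definition copy_nat :: machine where
  "copy_nat = copy_ones ;; copy 2"

lemma runs_copy_nat:
  "runs copy_nat [A, zipper y [], zipper u (enc_nat j @ r)]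
     [A, zipper (y @ enc_nat j) [], zipper (u @ enc_nat j) r] (3 * j + 2)"
proof -
  have 1: "runs copy_ones [A, zipper y [], zipper u (enc_nat j @ r)]
     [A, zipper (y @ replicate j True) [], zipper (u @ replicate j True) (False # r)] (3 * j + 1)"
    using runs_copy_ones[of "False # r" A y u j] by (simp add: enc_nat_def unary_end_def)
  have 2: "runs (copy 2) [A, zipper (y @ replicate j True) [], zipper (u @ replicate j True) (False # r)]
     [A, zipper (y @ enc_nat j) [], zipper (u @ enc_nat j) r] 1"
    using runs_copy_2[of A "y @ replicate j True" "u @ replicate j True" False r]
    by (simp add: enc_nat_def)
  show ?thesis unfolding copy_nat_def by (rule runs_mono[OF runs_SEQ[OF 1 2]]) simp
qed

definition copy_name :: machine where
  "copy_name = WHILE (\<lambda>gs. gs ! 2 = 3) (copy 2 ;; copy 2) ;; copy 2"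

lemma runs_copy_name:
  "runs copy_name [A, zipper y [], zipper u (enc_name w @ r)]
     [A, zipper (y @ enc_name w) [], zipper (u @ enc_name w) r] (2 * length (enc_name w))"
proof -
  let ?e = "\<lambda>w. concat (map (\<lambda>b. [True, b]) w)"
  have 1: "runs (WHILE (\<lambda>gs. gs ! 2 = 3) (copy 2 ;; copy 2)) [A, zipper y [], zipper u (?e w @ False # r)]
     [A, zipper (y @ ?e w) [], zipper (u @ ?e w) (False # r)] (4 * length w + 1)" for y u
  proof (induction w arbitrary: y u)
    case Nil
    then show ?case by (intro WHILE_doneI) simp_all
  next
    case (Cons b w)
    have step: "runs (copy 2 ;; copy 2) [A, zipper y [], zipper u (True # b # ?e w @ False # r)]
        [A, zipper (y @ [True, b]) [], zipper (u @ [True, b]) (?e w @ False # r)] (Suc (Suc 0))"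
      using runs_SEQ[OF runs_copy_2[of A y u True "b # ?e w @ False # r"] runs_copy_2[of A _ _ b "?e w @ False # r"]]
      by (simp add: numeral_2_eq_2)
    show ?case unfolding list.map concat.simps append_Cons append_Nil
      by (rule WHILE_stepI[OF _ step Cons.IH[of "y @ [True, b]" "u @ [True, b]", unfolded append_assoc append_Cons append_Nil]])
        simp_all
  qed
  have 2: "runs (copy 2) [A, zipper (y @ ?e w) [], zipper (u @ ?e w) (False # r)]
     [A, zipper (y @ enc_name w) [], zipper (u @ enc_name w) r] 1"
    using runs_copy_2[of A "y @ ?e w" "u @ ?e w" False r] by (simp add: enc_name_def)
  have len: "length (?e w) = 2 * length w" by (induction w) auto
  have 3: "zipper u (enc_name w @ r) = zipper u (?e w @ False # r)" by (simp add: enc_name_def)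
  show ?thesis unfolding copy_name_def 3
    by (rule runs_mono[OF runs_SEQ[OF 1 2]]) (simp add: enc_name_def len)
qed

text \<open>Contract for a subroutine that translates one wire. Tape 0 makes the number
  \<open>length z\<close> available to \<open>\<rho>\<close> and must be restored for the next call.
  Time proportional to the code of the wire adds up to time proportional to the code of the
  circuit.\<close>

definition renames_wires :: "bool list \<Rightarrow> machine \<Rightarrow> (wire \<Rightarrow> wire) \<Rightarrow> nat \<Rightarrow> bool" where
  "renames_wires z W \<rho> D \<longleftrightarrow>
     (\<forall>v y u r. runs W [zipper [] z, zipper y [], zipper u (enc_wire v @ r)]
        [zipper [] z, zipper (y @ enc_wire (\<rho> v)) [], zipper (u @ enc_wire v) r] (D * length (enc_wire v)))"

text \<open>The first \<open>copy 2\<close> takes the flag that announces another gate, the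
  \<open>copy 2\<close> inside each branch the arity bit that was just tested.\<close>

definition gate_machine :: "machine \<Rightarrow> machine" where
  "gate_machine W = copy 2 ;; IF (\<lambda>gs. gs ! 2 = 3) (copy 2 ;; copy_name ;; W ;; W) (copy 2 ;; copy_name ;; W)"

lemma runs_gate_machine:
  assumes W: "renames_wires z W \<rho> D"
  shows "runs (gate_machine W) [zipper [] z, zipper y [], zipper u (True # enc_gate g @ r)]
    [zipper [] z, zipper (y @ True # enc_gate (rename_gate \<rho> g)) [], zipper (u @ True # enc_gate g) r]
    ((D + 2) * length (enc_gate g) + 2)"
proof -
  let ?A = "zipper [] z"
  note W' = W[unfolded renames_wires_def, rule_format]
  note c = runs_copy_2[of ?A y u True "enc_gate g @ r"]
  show ?thesis
  proof (cases g)
    case (Gate1 nm v)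
    note 2 = runs_copy_2[of ?A "y @ [True]" "u @ [True]" False "enc_name nm @ enc_wire v @ r"]
    note 3 = runs_copy_name[of ?A "y @ [True, False]" "u @ [True, False]" nm "enc_wire v @ r"]
    note 4 = W'[of "y @ [True, False] @ enc_name nm" "u @ [True, False] @ enc_name nm" v r]
    have "runs (IF (\<lambda>gs. gs ! 2 = 3) (copy 2 ;; copy_name ;; W ;; W) (copy 2 ;; copy_name ;; W))
      [?A, zipper (y @ [True]) [], zipper (u @ [True]) (False # enc_name nm @ enc_wire v @ r)]
      [?A, zipper (y @ [True, False] @ enc_name nm @ enc_wire (\<rho> v)) [],
       zipper (u @ [True, False] @ enc_name nm @ enc_wire v) r]
      ((1 + (2 * length (enc_name nm) + D * length (enc_wire v))) + 2)"
      by (rule IF_false, simp, rule runs_SEQ[OF 2 runs_SEQ])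
        (use 3 4 in simp_all)
    from runs_SEQ[OF c[unfolded Gate1 enc_gate.simps append_Cons append_assoc] this] show ?thesis
      unfolding gate_machine_def by (rule_tac runs_mono) (simp_all add: Gate1 algebra_simps, linarith)
  next
    case (Gate2 nm v w)
    note 2 = runs_copy_2[of ?A "y @ [True]" "u @ [True]" True "enc_name nm @ enc_wire v @ enc_wire w @ r"]
    note 3 = runs_copy_name[of ?A "y @ [True, True]" "u @ [True, True]" nm "enc_wire v @ enc_wire w @ r"]
    note 4 = W'[of "y @ [True, True] @ enc_name nm" "u @ [True, True] @ enc_name nm" v "enc_wire w @ r"]
    note 5 = W'[of "y @ [True, True] @ enc_name nm @ enc_wire (\<rho> v)" "u @ [True, True] @ enc_name nm @ enc_wire v" w r]
    have "runs (IF (\<lambda>gs. gs ! 2 = 3) (copy 2 ;; copy_name ;; W ;; W) (copy 2 ;; copy_name ;; W))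
      [?A, zipper (y @ [True]) [], zipper (u @ [True]) (True # enc_name nm @ enc_wire v @ enc_wire w @ r)]
      [?A, zipper (y @ [True, True] @ enc_name nm @ enc_wire (\<rho> v) @ enc_wire (\<rho> w)) [],
       zipper (u @ [True, True] @ enc_name nm @ enc_wire v @ enc_wire w) r]
      ((1 + (2 * length (enc_name nm) + (D * length (enc_wire v) + D * length (enc_wire w)))) + 2)"
      by (rule IF_true, simp, rule runs_SEQ[OF 2 runs_SEQ[OF _ runs_SEQ]])
        (use 3 4 5 in simp_all)
    from runs_SEQ[OF c[unfolded Gate2 enc_gate.simps append_Cons append_assoc] this] show ?thesis
      unfolding gate_machine_def by (rule_tac runs_mono) (simp_all add: Gate2 algebra_simps, linarith)
  qed
qed

definition circuit_machine :: "machine \<Rightarrow> machine" where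
  "circuit_machine W = WHILE (\<lambda>gs. gs ! 2 = 3) (gate_machine W) ;; copy 2 ;; W"

lemma runs_circuit_machine:
  assumes W: "renames_wires z W \<rho> D"
  shows "runs (circuit_machine W) [zipper [] z, zipper [] [], zipper [] (enc_circuit C)]
    [zipper [] z, zipper (enc_circuit (rename \<rho> C)) [], zipper (enc_circuit C) []]
    ((D + 5) * length (enc_circuit C))"
proof -
  let ?A = "zipper [] z"
  let ?e = "\<lambda>gs. concat (map (\<lambda>g. True # enc_gate g) gs)"
  have 1: "runs (WHILE (\<lambda>gs. gs ! 2 = 3) (gate_machine W)) [?A, zipper y [], zipper u (?e gs @ False # r)]
     [?A, zipper (y @ ?e (map (rename_gate \<rho>) gs)) [], zipper (u @ ?e gs) (False # r)]
     ((D + 5) * length (?e gs) + 1)" for y u gs r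
  proof (induction gs arbitrary: y u)
    case Nil
    then show ?case by (intro WHILE_doneI) simp_all
  next
    case (Cons g gs)
    show ?case unfolding list.map concat.simps append_Cons append_assoc
      by (rule WHILE_stepI[OF _ runs_gate_machine[OF W] Cons.IH[of "y @ True # enc_gate (rename_gate \<rho> g)" "u @ True # enc_gate g",
            unfolded append_assoc append_Cons]])
        (simp_all add: algebra_simps)
  qed
  note W' = W[unfolded renames_wires_def, rule_format]
  let ?v = "out_wire C"
  let ?y = "?e (map (rename_gate \<rho>) (gates C))" and ?u = "?e (gates C)"
  have 2: "runs (copy 2) [?A, zipper ?y [], zipper ?u (False # enc_wire ?v)]
     [?A, zipper (?y @ [False]) [], zipper (?u @ [False]) (enc_wire ?v @ [])] 1"
    using runs_copy_2[of ?A ?y ?u False "enc_wire ?v"] by simp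
  note 3 = W'[of "?y @ [False]" "?u @ [False]" ?v "[]"]
  have "runs (circuit_machine W) [?A, zipper [] [], zipper [] (?u @ False # enc_wire ?v)]
    [?A, zipper ((?y @ [False]) @ enc_wire (\<rho> ?v)) [], zipper ((?u @ [False]) @ enc_wire ?v) []]
    ((D + 5) * length ?u + 1 + (1 + D * length (enc_wire ?v)))"
    unfolding circuit_machine_def
    using 1[of "[]" "[]" "gates C" "enc_wire ?v"] by (intro runs_SEQ[OF _ runs_SEQ[OF 2 3]]) simp
  then show ?thesis
    by (rule_tac runs_mono) (simp_all add: enc_circuit_def rename_def algebra_simps, linarith)
qed

lemma wf_circuit_machine: "wf_machine 3 4 W \<Longrightarrow> wf_machine 3 4 (circuit_machine W)"
  unfolding circuit_machine_def gate_machine_def copy_name_def by (intro wf_intros) auto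

lemma poly_time_rename:
  assumes C: "poly_time_computable (\<lambda>x. enc_circuit (C x))" and wf: "wf_machine 3 4 W"
    and W: "\<And>x. renames_wires x W (\<rho> x) (c * (length x + 1))"
  shows "poly_time_computable (\<lambda>x. enc_circuit (rename (\<rho> x) (C x)))"
proof (rule poly_time_combine[OF C, of 3 4 "enter ;; circuit_machine W" "[:1, c + 5, c:]"])
  show "wf_machine 3 4 (enter ;; circuit_machine W)"
    by (intro wf_intros wf_circuit_machine wf) auto
  fix x
  let ?l = "length (enc_circuit (C x))"
  have "?l \<le> length x + ?l" "(c * (length x + 1) + 5) \<le> c * (length x + ?l + 1) + 5" by simp_all
  then have "(c * (length x + 1) + 5) * ?l \<le> (c * (length x + ?l + 1) + 5) * (length x + ?l)"
    by (intro mult_mono) auto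
  then have time: "1 + (c * (length x + 1) + 5) * ?l \<le> poly [:1, c + 5, c:] (length x + ?l)"
    by (simp add: algebra_simps)
  show "\<exists>ts. runs (enter ;; circuit_machine W) (tapes_of 3 [x, [], enc_circuit (C x)]) ts
           (poly [:1, c + 5, c:] (length x + ?l)) \<and>
         fst (ts ! 1) = tape_contents (enc_circuit (rename (\<rho> x) (C x)))"
    by (intro exI conjI, rule runs_mono[OF runs_SEQ[OF runs_enter runs_circuit_machine[OF W]] time]) simp
qed auto

lemma enc_nat_simps: "enc_nat 0 = [False]" "enc_nat (Suc j) = True # enc_nat j"
  by (simp_all add: enc_nat_def)

text \<open>The kind of a wire is the tag 0, 1 or 2 in unary; spelled out, its bits are what the
  machines branch on.\<close>

lemma enc_wire_Cons:
  "enc_wire (Input_bit j) = False # enc_nat j"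
  "enc_wire (Proof_bit l j) = True # False # enc_nat l @ enc_nat j"
  "enc_wire (Ancilla j) = True # True # False # enc_nat j"
  by (simp_all add: enc_nat_def numeral_2_eq_2)

declare enc_wire.simps [simp del]

lemma runs_cong: "runs M a' b' T' \<Longrightarrow> a = a' \<Longrightarrow> b = b' \<Longrightarrow> T' \<le> T \<Longrightarrow> runs M a b T"
  using runs_mono by blast

lemma length_enc_nat: "length (enc_nat j) = Suc j"
  by (simp add: enc_nat_def)

definition home :: machine where
  "home = rewind 0 ;; move_head 0 MoveRight"

lemma runs_home: "runs home [(tape_contents z, p), B, C] [zipper [] z, B, C] (3 * p + 2)"
proof -
  have 1: "runs (rewind 0) [(tape_contents z, p), B, C] [(tape_contents z, 0), B, C] (3 * p + 1)"
    using runs_rewind[of 0 "[(tape_contents z, p), B, C]" z p] by simp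
  have 2: "runs (move_head 0 MoveRight) [(tape_contents z, 0), B, C] [zipper [] z, B, C] 1"
    using runs_right(1)[of "tape_contents z" 0] by (simp add: zipper_def)
  show ?thesis unfolding home_def by (rule runs_mono[OF runs_SEQ[OF 1 2]]) simp
qed

abbreviation skip :: machine where
  "skip \<equiv> move_head 2 MoveRight"

section \<open>From the first proof to the input\<close>

fun proof_to_input :: "nat \<Rightarrow> wire \<Rightarrow> wire" where
  "proof_to_input n (Input_bit j) = Input_bit j"
| "proof_to_input n (Proof_bit 0 j) = Input_bit (n + j)"
| "proof_to_input n (Proof_bit (Suc l) j) = Proof_bit l j"
| "proof_to_input n (Ancilla j) = Ancilla j"

text \<open>Addition in unary is concatenation: \<open>length z\<close> ones in front of the code of
  \<open>j\<close> give the code of \<open>length z + j\<close>. The leading \<open>False\<close> is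
  the tag of an input bit.\<close>

definition shift_machine :: machine where
  "shift_machine = put 1 False ;; put_length ;; home ;; copy_nat"

text \<open>Tag bits after a leading \<open>True\<close> are skipped at first, since a bit of the
  first proof changes its kind; the other branches write them again. For a later proof, skipping one
  of the ones of its index is the decrement.\<close>

definition proof_to_input_machine :: machine where
  "proof_to_input_machine =
     IF (\<lambda>gs. gs ! 2 = 2) (copy 2 ;; copy_nat)
      (skip ;; IF (\<lambda>gs. gs ! 2 = 3) (put 1 True ;; copy 2 ;; copy 2 ;; copy_nat)
        (skip ;; IF (\<lambda>gs. gs ! 2 = 2) (skip ;; shift_machine)
          (skip ;; put 1 True ;; put 1 False ;; copy_nat ;; copy_nat)))"

lemma runs_shift_machine:
  "runs shift_machine [zipper [] z, zipper y [], zipper u (enc_nat j @ r)]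
     [zipper [] z, zipper (y @ False # enc_nat (length z + j)) [], zipper (u @ enc_nat j) r]
     (7 * length z + 3 * j + 9)"
proof -
  let ?C = "zipper u (enc_nat j @ r)"
  have 3: "runs home [zipper ([] @ z) [], B, C] [zipper [] z, B, C] (3 * (length z + 1) + 2)" for B C
    using runs_home[of z "length z + 1" B C] by (simp add: zipper_def)
  show ?thesis unfolding shift_machine_def
    by (rule runs_cong[OF runs_SEQ[OF runs_put_1[of False "zipper [] z" y ?C]
            runs_SEQ[OF runs_put_length runs_SEQ[OF 3 runs_copy_nat]]]])
      (simp_all add: enc_nat_def replicate_add)
qed

lemma renames_proof_to_input:
  "renames_wires z proof_to_input_machine (proof_to_input (length z)) (20 * (length z + 1))"
  unfolding renames_wires_def
proof (intro allI)
  fix v y u r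
  let ?A = "zipper [] z"
  show "runs proof_to_input_machine [?A, zipper y [], zipper u (enc_wire v @ r)]
      [?A, zipper (y @ enc_wire (proof_to_input (length z) v)) [], zipper (u @ enc_wire v) r]
      (20 * (length z + 1) * length (enc_wire v))"
  proof (cases v)
    case (Input_bit j)
    have "runs proof_to_input_machine [?A, zipper y [], zipper u (False # enc_nat j @ r)]
      [?A, zipper ((y @ [False]) @ enc_nat j) [], zipper ((u @ [False]) @ enc_nat j) r] (1 + (3 * j + 2) + 2)"
      unfolding proof_to_input_machine_def
      by (rule IF_true, simp, rule runs_SEQ[OF runs_copy_2 runs_copy_nat])
    then show ?thesis
      by (rule runs_cong) (simp_all add: Input_bit enc_wire_Cons length_enc_nat algebra_simps)
  next
    case (Ancilla j)
    have "runs proof_to_input_machine [?A, zipper y [], zipper u (True # True # False # enc_nat j @ r)]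
      [?A, zipper ((((y @ [True]) @ [True]) @ [False]) @ enc_nat j) [],
       zipper ((((u @ [True]) @ [True]) @ [False]) @ enc_nat j) r]
      (1 + (1 + (1 + (1 + (3 * j + 2))) + 2) + 2)"
      unfolding proof_to_input_machine_def
      by (rule IF_false, simp, rule runs_SEQ[OF runs_skip], rule IF_true, simp,
          rule runs_SEQ[OF runs_put_1 runs_SEQ[OF runs_copy_2 runs_SEQ[OF runs_copy_2 runs_copy_nat]]])
    then show ?thesis
      by (rule runs_cong) (simp_all add: Ancilla enc_wire_Cons length_enc_nat algebra_simps)
  next
    case (Proof_bit l j)
    show ?thesis
    proof (cases l)
      case 0
      have "runs proof_to_input_machine [?A, zipper y [], zipper u (True # False # False # enc_nat j @ r)]
        [?A, zipper (y @ False # enc_nat (length z + j)) [],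
         zipper ((((u @ [True]) @ [False]) @ [False]) @ enc_nat j) r]
        (1 + (1 + (1 + (7 * length z + 3 * j + 9) + 2) + 2) + 2)"
        unfolding proof_to_input_machine_def
        by (rule IF_false, simp, rule runs_SEQ[OF runs_skip], rule IF_false, simp,
            rule runs_SEQ[OF runs_skip], rule IF_true, simp, rule runs_SEQ[OF runs_skip runs_shift_machine])
      then show ?thesis
        by (rule runs_cong) (simp_all add: Proof_bit 0 enc_wire_Cons enc_nat_simps length_enc_nat algebra_simps)
    next
      case (Suc l')
      have "runs proof_to_input_machine [?A, zipper y [], zipper u (True # False # True # enc_nat l' @ enc_nat j @ r)]
        [?A, zipper ((((y @ [True]) @ [False]) @ enc_nat l') @ enc_nat j) [],
         zipper (((((u @ [True]) @ [False]) @ [True]) @ enc_nat l') @ enc_nat j) r]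
        (1 + (1 + (1 + (1 + (1 + (3 * l' + 2 + (3 * j + 2)))) + 2) + 2) + 2)"
        unfolding proof_to_input_machine_def
        by (rule IF_false, simp, rule runs_SEQ[OF runs_skip], rule IF_false, simp,
            rule runs_SEQ[OF runs_skip], rule IF_false, simp,
            rule runs_SEQ[OF runs_skip runs_SEQ[OF runs_put_1 runs_SEQ[OF runs_put_1 runs_SEQ[OF runs_copy_nat runs_copy_nat]]]])
      then show ?thesis
        by (rule runs_cong) (simp_all add: Proof_bit Suc enc_wire_Cons enc_nat_simps length_enc_nat algebra_simps)
    qed
  qed
qed

lemma wf_home: "wf_machine 3 4 home"
  unfolding home_def by (intro wf_intros wf_rewind) auto

lemma wf_copy_nat: "wf_machine 3 4 copy_nat"
  unfolding copy_nat_def copy_ones_def by (intro wf_intros) auto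

lemma wf_proof_to_input_machine: "wf_machine 3 4 proof_to_input_machine"
  unfolding proof_to_input_machine_def shift_machine_def
  by (intro wf_intros wf_home wf_copy_nat wf_put_length) auto

section \<open>From the input to the first proof\<close>

text \<open>Even positions receive the moved input bits, odd ones the first proof that was there
  before. Placing one string behind the other would require the length of one of them; this needs
  only \<open>n\<close>.\<close>

fun input_to_proof :: "nat \<Rightarrow> wire \<Rightarrow> wire" where
  "input_to_proof n (Input_bit j) = (if j < n then Input_bit j else Proof_bit 0 (2 * (j - n)))"
| "input_to_proof n (Proof_bit 0 j) = Proof_bit 0 (2 * j + 1)"
| "input_to_proof n (Proof_bit (Suc l) j) = Proof_bit (Suc l) j"
| "input_to_proof n (Ancilla j) = Ancilla j"

definition double_ones :: machine where
  "double_ones = WHILE (\<lambda>gs. gs ! 2 = 3) (put 1 True ;; put 1 True ;; skip)"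

lemma runs_double_ones:
  assumes "unary_end r"
  shows "runs double_ones [A, zipper y [], zipper u (replicate j True @ r)]
     [A, zipper (y @ replicate (2 * j) True) [], zipper (u @ replicate j True) r] (5 * j + 1)"
  unfolding double_ones_def
proof (induction j arbitrary: y u)
  case 0
  then show ?case using read_unary_end[OF assms] by (intro WHILE_doneI) simp_all
next
  case (Suc j)
  have rest: "runs (WHILE (\<lambda>gs. gs ! 2 = 3) (put 1 True ;; put 1 True ;; skip))
     [A, zipper ((y @ [True]) @ [True]) [], zipper (u @ [True]) (replicate j True @ r)]
     [A, zipper (y @ replicate (2 * Suc j) True) [], zipper (u @ replicate (Suc j) True) r] (5 * j + 1)"
    by (rule runs_cong[OF Suc.IH[of "(y @ [True]) @ [True]" "u @ [True]"]]) simp_all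
  show ?case unfolding replicate_Suc[of j] append_Cons
    by (rule WHILE_stepI[OF _ runs_SEQ[OF runs_put_1 runs_SEQ[OF runs_put_1 runs_skip]] rest[unfolded replicate_Suc[of j]]])
      simp_all
qed

text \<open>Tapes 0 and 2 advance in parallel. Afterwards the head on tape 0 is on a blank exactly
  if the index \<open>j\<close> is at least \<open>length z\<close>, and then
  \<open>j - length z\<close> ones are left on tape 2.\<close>

definition compare_ones :: machine where
  "compare_ones = WHILE (\<lambda>gs. gs ! 2 = 3 \<and> gs ! 0 \<noteq> 0) (skip ;; move_head 0 MoveRight)"

lemma runs_compare_ones:
  assumes "unary_end r"
  shows "p \<le> length z \<Longrightarrow> runs compare_ones [(tape_contents z, Suc p), B, zipper u (replicate d True @ r)]
     [(tape_contents z, Suc (min (p + d) (length z))), B,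
      zipper (u @ replicate (min d (length z - p)) True) (replicate (d - (length z - p)) True @ r)] (4 * d + 1)"
  unfolding compare_ones_def
proof (induction d arbitrary: p u)
  case 0
  then show ?case using read_unary_end[OF assms] by (intro WHILE_doneI) simp_all
next
  case (Suc d)
  show ?case
  proof (cases "p < length z")
    case True
    then have eq: "Suc d - (length z - p) = d - (length z - Suc p)"
      "min (Suc d) (length z - p) = Suc (min d (length z - Suc p))"
      "min (p + Suc d) (length z) = min (Suc p + d) (length z)" by auto
    show ?thesis unfolding eq replicate_Suc append_Cons
      by (rule WHILE_stepI[OF _ runs_SEQ[OF runs_skip runs_right(1)]
          Suc.IH[of "Suc p" "u @ [True]", unfolded append_assoc append_Cons append_Nil]])
        (use True in simp_all)
  next
    case False
    then have "p = length z" using Suc.prems by simp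
    then show ?thesis by (intro WHILE_doneI) simp_all
  qed
qed

text \<open>If \<open>j < length z\<close>, the comparison has consumed the ones of \<open>j\<close>
  without copying them. After one step to the left the position on tape 0 is \<open>j\<close>, so
  returning to the marker writes exactly these ones.\<close>

definition put_back :: machine where
  "put_back = WHILE (\<lambda>gs. gs ! 0 \<noteq> 1) (put 1 True ;; move_head 0 MoveLeft)"

lemma runs_put_back:
  "runs put_back [(tape_contents z, p), zipper y [], C]
     [(tape_contents z, 0), zipper (y @ replicate p True) [], C] (4 * p + 1)"
  unfolding put_back_def
proof (induction p arbitrary: y)
  case 0
  then show ?case by (intro WHILE_doneI) simp_all
next
  case (Suc p)
  have 1: "runs (put 1 True ;; move_head 0 MoveLeft) [(tape_contents z, Suc p), zipper y [], C]
      [(tape_contents z, p), zipper (y @ [True]) [], C] (Suc (Suc 0))"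
    using runs_SEQ[OF runs_put_1 runs_left(1)[of "tape_contents z" "Suc p"]] by (simp add: numeral_2_eq_2)
  show ?case
    by (rule WHILE_stepI[OF _ 1 Suc.IH[of "y @ [True]", unfolded append_assoc append_Cons append_Nil replicate_Suc[symmetric]]]) simp_all
qed

text \<open>The bits \<open>True\<close>, \<open>False\<close>, \<open>False\<close> are the tag of
  a proof bit and proof index 0; the single \<open>False\<close> of the other branch is the tag of
  an input bit.\<close>

definition split_machine :: machine where
  "split_machine = compare_ones ;;
     IF (\<lambda>gs. gs ! 0 = 0) (put 1 True ;; put 1 False ;; put 1 False ;; double_ones ;; copy 2 ;; home)
       (put 1 False ;; move_head 0 MoveLeft ;; put_back ;; move_head 0 MoveRight ;; copy 2)"

lemma runs_split_machine:
  "runs split_machine [zipper [] z, zipper y [], zipper u (enc_nat j @ r)]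
     [zipper [] z, zipper (y @ enc_wire (input_to_proof (length z) (Input_bit j))) [], zipper (u @ enc_nat j) r]
     (9 * j + 3 * length z + 20)"
proof -
  let ?t = "tape_contents z" and ?d = "j - length z"
  have start: "[zipper [] z, zipper y [], zipper u (enc_nat j @ r)] =
     [(?t, Suc 0), zipper y [], zipper u (replicate j True @ False # r)]"
    by (simp add: zipper_def enc_nat_def)
  have 1: "runs compare_ones [(?t, Suc 0), zipper y [], zipper u (replicate j True @ False # r)]
     [(?t, Suc (min j (length z))), zipper y [],
      zipper (u @ replicate (min j (length z)) True) (replicate ?d True @ False # r)] (4 * j + 1)"
    using runs_compare_ones[of "False # r" 0 z "zipper y []" u j] by (simp add: unary_end_def)
  have 2: "runs (IF (\<lambda>gs. gs ! 0 = 0) (put 1 True ;; put 1 False ;; put 1 False ;; double_ones ;; copy 2 ;; home)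
       (put 1 False ;; move_head 0 MoveLeft ;; put_back ;; move_head 0 MoveRight ;; copy 2))
     [(?t, Suc (min j (length z))), zipper y [],
      zipper (u @ replicate (min j (length z)) True) (replicate ?d True @ False # r)]
     [zipper [] z, zipper (y @ enc_wire (input_to_proof (length z) (Input_bit j))) [], zipper (u @ enc_nat j) r]
     (5 * j + 3 * length z + 19)"
  proof (cases "j < length z")
    case True
    have a: "runs (move_head 0 MoveLeft) [(?t, Suc (min j (length z))), B, C] [(?t, j), B, C] 1" for B C
      using runs_left(1)[of ?t "Suc j" B C] True by simp
    have b: "runs (move_head 0 MoveRight) [(?t, 0), B, C] [zipper [] z, B, C] 1" for B C
      using runs_right(1)[of ?t 0 B C] by (simp add: zipper_def)
    have "runs (IF (\<lambda>gs. gs ! 0 = 0) (put 1 True ;; put 1 False ;; put 1 False ;; double_ones ;; copy 2 ;; home)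
       (put 1 False ;; move_head 0 MoveLeft ;; put_back ;; move_head 0 MoveRight ;; copy 2))
      [(?t, Suc (min j (length z))), zipper y [], zipper (u @ replicate (min j (length z)) True) (False # r)]
      [zipper [] z, zipper (((y @ [False]) @ replicate j True) @ [False]) [],
       zipper ((u @ replicate (min j (length z)) True) @ [False]) r] (1 + (1 + (4 * j + 1 + (1 + 1))) + 2)"
      by (rule IF_false, use True in simp,
          rule runs_SEQ[OF runs_put_1 runs_SEQ[OF a runs_SEQ[OF runs_put_back runs_SEQ[OF b runs_copy_2]]]])
    then show ?thesis
      by (rule runs_cong) (use True in \<open>simp_all add: enc_wire_Cons enc_nat_def\<close>)
  next
    case False
    have e: "unary_end (False # r)" by (simp add: unary_end_def)
    have "runs (IF (\<lambda>gs. gs ! 0 = 0) (put 1 True ;; put 1 False ;; put 1 False ;; double_ones ;; copy 2 ;; home)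
       (put 1 False ;; move_head 0 MoveLeft ;; put_back ;; move_head 0 MoveRight ;; copy 2))
      [(?t, Suc (min j (length z))), zipper y [],
        zipper (u @ replicate (min j (length z)) True) (replicate ?d True @ False # r)]
      [zipper [] z, zipper (((((y @ [True]) @ [False]) @ [False]) @ replicate (2 * ?d) True) @ [False]) [],
       zipper (((u @ replicate (min j (length z)) True) @ replicate ?d True) @ [False]) r]
      (1 + (1 + (1 + (5 * ?d + 1 + (1 + (3 * Suc (min j (length z)) + 2))))) + 2)"
      by (rule IF_true, use False in simp,
          rule runs_SEQ[OF runs_put_1 runs_SEQ[OF runs_put_1 runs_SEQ[OF runs_put_1
            runs_SEQ[OF runs_double_ones[OF e] runs_SEQ[OF runs_copy_2 runs_home]]]]])
    moreover have "replicate (length z) True @ replicate ?d True @ xs = replicate j True @ xs" for xs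
      using False by (simp add: replicate_add[symmetric] flip: append_assoc)
    ultimately show ?thesis
      by (elim runs_cong) (use False in \<open>simp_all add: enc_wire_Cons enc_nat_simps enc_nat_def\<close>)
  qed
  show ?thesis unfolding split_machine_def start by (rule runs_mono[OF runs_SEQ[OF 1 2]]) simp
qed

definition input_to_proof_machine :: machine where
  "input_to_proof_machine =
     IF (\<lambda>gs. gs ! 2 = 2) (skip ;; split_machine)
      (copy 2 ;; IF (\<lambda>gs. gs ! 2 = 3) (copy 2 ;; copy 2 ;; copy_nat)
        (copy 2 ;; IF (\<lambda>gs. gs ! 2 = 2) (copy 2 ;; double_ones ;; put 1 True ;; copy 2)
          (copy_nat ;; copy_nat)))"

lemma renames_input_to_proof:
  "renames_wires z input_to_proof_machine (input_to_proof (length z)) (40 * (length z + 1))"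
  unfolding renames_wires_def
proof (intro allI)
  fix v y u r
  let ?A = "zipper [] z"
  show "runs input_to_proof_machine [?A, zipper y [], zipper u (enc_wire v @ r)]
      [?A, zipper (y @ enc_wire (input_to_proof (length z) v)) [], zipper (u @ enc_wire v) r]
      (40 * (length z + 1) * length (enc_wire v))"
  proof (cases v)
    case (Input_bit j)
    have "runs input_to_proof_machine [?A, zipper y [], zipper u (False # enc_nat j @ r)]
      [?A, zipper (y @ enc_wire (input_to_proof (length z) (Input_bit j))) [], zipper ((u @ [False]) @ enc_nat j) r]
      (1 + (9 * j + 3 * length z + 20) + 2)"
      unfolding input_to_proof_machine_def
      by (rule IF_true, simp, rule runs_SEQ[OF runs_skip runs_split_machine])
    then show ?thesis unfolding Input_bit
      by (rule runs_cong) (simp_all add: enc_wire_Cons(1)[of j] length_enc_nat algebra_simps del: input_to_proof.simps)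
  next
    case (Ancilla j)
    have "runs input_to_proof_machine [?A, zipper y [], zipper u (True # True # False # enc_nat j @ r)]
      [?A, zipper ((((y @ [True]) @ [True]) @ [False]) @ enc_nat j) [],
       zipper ((((u @ [True]) @ [True]) @ [False]) @ enc_nat j) r]
      (1 + (1 + (1 + (3 * j + 2)) + 2) + 2)"
      unfolding input_to_proof_machine_def
      by (rule IF_false, simp, rule runs_SEQ[OF runs_copy_2], rule IF_true, simp,
          rule runs_SEQ[OF runs_copy_2 runs_SEQ[OF runs_copy_2 runs_copy_nat]])
    then show ?thesis
      by (rule runs_cong) (simp_all add: Ancilla enc_wire_Cons length_enc_nat algebra_simps)
  next
    case (Proof_bit l j)
    show ?thesis
    proof (cases l)
      case 0
      have e: "unary_end (False # r)" by (simp add: unary_end_def)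
      have "runs input_to_proof_machine [?A, zipper y [], zipper u (True # False # False # replicate j True @ False # r)]
        [?A, zipper ((((((y @ [True]) @ [False]) @ [False]) @ replicate (2 * j) True) @ [True]) @ [False]) [],
         zipper (((((u @ [True]) @ [False]) @ [False]) @ replicate j True) @ [False]) r]
        (1 + (1 + (1 + (5 * j + 1 + (1 + 1)) + 2) + 2) + 2)"
        unfolding input_to_proof_machine_def
        by (rule IF_false, simp, rule runs_SEQ[OF runs_copy_2], rule IF_false, simp,
            rule runs_SEQ[OF runs_copy_2], rule IF_true, simp,
            rule runs_SEQ[OF runs_copy_2 runs_SEQ[OF runs_double_ones[OF e] runs_SEQ[OF runs_put_1 runs_copy_2]]])
      then show ?thesis
        by (rule runs_cong)
          (simp_all add: Proof_bit 0 enc_wire_Cons enc_nat_def replicate_app_Cons_same algebra_simps)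
    next
      case (Suc l')
      have "runs input_to_proof_machine [?A, zipper y [], zipper u (True # False # enc_nat l @ enc_nat j @ r)]
        [?A, zipper ((((y @ [True]) @ [False]) @ enc_nat l) @ enc_nat j) [],
         zipper ((((u @ [True]) @ [False]) @ enc_nat l) @ enc_nat j) r]
        (1 + (1 + (3 * l + 2 + (3 * j + 2) + 2) + 2) + 2)"
        unfolding input_to_proof_machine_def
        by (rule IF_false, simp, rule runs_SEQ[OF runs_copy_2], rule IF_false, simp,
            rule runs_SEQ[OF runs_copy_2], rule IF_false, simp add: Suc enc_nat_simps,
            rule runs_SEQ[OF runs_copy_nat runs_copy_nat])
      then show ?thesis
        by (rule runs_cong) (simp_all add: Proof_bit Suc enc_wire_Cons length_enc_nat algebra_simps)
    qed
  qed
qed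

lemma wf_input_to_proof_machine: "wf_machine 3 4 input_to_proof_machine"
  unfolding input_to_proof_machine_def split_machine_def compare_ones_def double_ones_def put_back_def
  by (intro wf_intros wf_home wf_copy_nat) auto

section \<open>Replacing the output on short inputs\<close>

lemma runs_copy_rest_2:
  "runs (WHILE (\<lambda>gs. gs ! 2 \<noteq> 0) (copy 2)) [A, zipper y [], zipper u v]
     [A, zipper (y @ v) [], zipper (u @ v) []] (3 * length v + 1)"
proof (induction v arbitrary: u y)
  case Nil
  then show ?case by (intro WHILE_doneI) simp_all
next
  case (Cons b v)
  show ?case
    using WHILE_stepI[OF _ runs_copy_2 Cons.IH[of "y @ [b]" "u @ [b]"]] by (simp add: bit_symbol_def)
qed

lemma runs_empty: "runs [] a a 0"
  by (simp add: runs_def)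

lemma wf_empty: "wf_machine k G []"
  by (simp add: wf_machine_def)

primrec puts :: "bool list \<Rightarrow> machine" where
  "puts [] = []"
| "puts (b # w) = put 1 b ;; puts w"

lemma runs_puts: "runs (puts w) [A, zipper y [], C] [A, zipper (y @ w) [], C] (length w)"
proof (induction w arbitrary: y)
  case (Cons b w)
  show ?case unfolding puts.simps by (rule runs_cong[OF runs_SEQ[OF runs_put_1 Cons.IH]]) simp_all
qed (simp add: runs_empty)

lemma wf_puts: "wf_machine 3 4 (puts w)"
  by (induction w) (auto intro: wf_intros wf_empty)

primrec advance :: "nat \<Rightarrow> machine" where
  "advance 0 = []"
| "advance (Suc n) = move_head 0 MoveRight ;; advance n"

lemma runs_advance: "runs (advance n) [(t, p), B, C] [(t, p + n), B, C] n"
proof (induction n arbitrary: p)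
  case (Suc n)
  show ?case unfolding advance.simps
    by (rule runs_cong[OF runs_SEQ[OF runs_right(1) Suc.IH]]) simp_all
qed (simp add: runs_empty)

lemma wf_advance: "wf_machine 3 4 (advance n)"
  by (induction n) (auto intro!: wf_intros wf_empty)

text \<open>One cell decides whether the input is shorter than the constant \<open>N\<close>: cell
  \<open>N\<close> is blank or not. This provides a default circuit at lengths too small to hold an
  instance together with a first proof.\<close>

lemma poly_time_if_short:
  assumes f: "poly_time_computable f"
  shows "poly_time_computable (\<lambda>x. if length x < N then y else f x)"
proof (cases N)
  case 0
  then show ?thesis using f by simp
next
  case (Suc n)
  let ?I = "IF (\<lambda>gs. gs ! 0 = 0) (puts y) (WHILE (\<lambda>gs. gs ! 2 \<noteq> 0) (copy 2))"
  show ?thesis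
  proof (rule poly_time_combine[OF f, of 3 4 "enter ;; advance n ;; ?I" "[:length y + n + 4, 3:]"])
    show "wf_machine 3 4 (enter ;; advance n ;; ?I)"
      by (intro wf_intros wf_puts wf_advance) auto
    fix x
    let ?g = "if length x < N then y else f x"
    have 1: "runs (advance n) [zipper [] x, zipper [] [], zipper [] (f x)]
        [(tape_contents x, Suc n), zipper [] [], zipper [] (f x)] n"
      using runs_advance[of n "tape_contents x" "Suc 0"] by (simp add: zipper_def)
    obtain C where 2: "runs ?I [(tape_contents x, Suc n), zipper [] [], zipper [] (f x)]
        [(tape_contents x, Suc n), zipper ?g [], C] (length y + 3 * length (f x) + 1 + 2)"
    proof (cases "length x < N")
      case True
      have "runs ?I [(tape_contents x, Suc n), zipper [] [], zipper [] (f x)]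
        [(tape_contents x, Suc n), zipper ?g [], zipper [] (f x)] (length y + 2)"
        by (rule IF_true) (use True Suc runs_puts[of y _ "[]"] in simp_all)
      then show ?thesis by (intro that) (erule runs_mono, simp)
    next
      case False
      have "runs ?I [(tape_contents x, Suc n), zipper [] [], zipper [] (f x)]
        [(tape_contents x, Suc n), zipper ?g [], zipper (f x) []] (3 * length (f x) + 1 + 2)"
        by (rule IF_false) (use False Suc runs_copy_rest_2[of _ "[]" "[]" "f x"] in simp_all)
      then show ?thesis by (intro that) (erule runs_mono, simp)
    qed
    have "runs (enter ;; advance n ;; ?I) (tapes_of 3 [x, [], f x])
        [(tape_contents x, Suc n), zipper ?g [], C] (poly [:length y + n + 4, 3:] (length x + length (f x)))"
      by (rule runs_mono[OF runs_SEQ[OF runs_enter runs_SEQ[OF 1 2]]]) simp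
    then show "\<exists>ts. runs (enter ;; advance n ;; ?I) (tapes_of 3 [x, [], f x]) ts
          (poly [:length y + n + 4, 3:] (length x + length (f x))) \<and>
        fst (ts ! 1) = tape_contents ?g"
      by (intro exI conjI) (assumption, simp)
  qed auto
qed

section \<open>Padding lengths\<close>

text \<open>A complete round preserves \<open>k * k + k + c\<close>, because (k + 1)(k + 2) - k(k +
  1) = 2(k + 1). An incomplete round raises it to the next number of the form n^2 + n, and this does
  not affect which numbers of that form bound it from above.\<close>

lemma rounds_le_iff: "rounds k c \<le> n \<longleftrightarrow> k * k + k + c \<le> n * n + n"
proof (induction k c rule: rounds.induct)
  case (1 k)
  have "k * k + k \<le> n * n + n" if "k \<le> n" using that by (intro add_mono mult_mono) auto
  moreover have "n * n + n < k * k + k" if "n < k" using that by (intro add_le_less_mono mult_mono) auto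
  ultimately show ?case by (auto simp: not_le[symmetric])
next
  case (2 k c)
  show ?case
  proof (cases "Suc c < 2 * Suc k")
    case True
    have a: "Suc k * Suc k + Suc k \<le> n * n + n" if "Suc k \<le> n" using that by (intro add_mono mult_mono) auto
    have b: "n * n + n \<le> k * k + k" if "n \<le> k" using that by (intro add_mono mult_mono) auto
    show ?thesis
    proof (cases "Suc k \<le> n")
      case True
      then show ?thesis using 2 a \<open>Suc c < 2 * Suc k\<close> by simp
    next
      case False
      then show ?thesis using 2 b \<open>Suc c < 2 * Suc k\<close> by simp
    qed
  next
    case False
    then show ?thesis using 2 by (auto simp: algebra_simps)
  qed
qed

text \<open>A Galois connection. It passes to iterates, and the left inverse, the growth bound and
  the divergence of \<open>unpad ^^ d\<close> are derived from it.\<close>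

lemma unpad_le_iff: "unpad m \<le> n \<longleftrightarrow> m \<le> pad n"
  by (auto simp: unpad_def rounds_le_iff pad_def)

lemma unpad_funpow_le_iff: "(unpad ^^ d) m \<le> n \<longleftrightarrow> m \<le> (pad ^^ d) n"
proof (induction d arbitrary: m)
  case (Suc d)
  have "(unpad ^^ Suc d) m \<le> n \<longleftrightarrow> (unpad ^^ d) (unpad m) \<le> n" by (simp add: funpow_swap1)
  also have "\<dots> \<longleftrightarrow> m \<le> (pad ^^ Suc d) n" by (simp add: Suc unpad_le_iff)
  finally show ?case .
qed simp

lemma pad_strict_mono: "m < n \<Longrightarrow> (pad ^^ d) m < (pad ^^ d) n"
proof (induction d)
  case (Suc d)
  let ?m = "(pad ^^ d) m" and ?n = "(pad ^^ d) n"
  have "?m < ?n" using Suc by simp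
  then have "?m * ?m + ?m < ?n * ?n + ?n" by (intro add_le_less_mono mult_mono) auto
  then show ?case by (simp add: pad_def[of ?m] pad_def[of ?n])
qed simp

lemma unpad_pad_funpow: "(unpad ^^ d) ((pad ^^ d) n) = n"
proof (rule antisym)
  show "(unpad ^^ d) ((pad ^^ d) n) \<le> n" by (simp add: unpad_funpow_le_iff)
  show "n \<le> (unpad ^^ d) ((pad ^^ d) n)"
    using unpad_funpow_le_iff[of d "(pad ^^ d) n" "(unpad ^^ d) ((pad ^^ d) n)"]
      pad_strict_mono[of "(unpad ^^ d) ((pad ^^ d) n)" n d] by (meson leD leI order_refl)
qed

lemma pad_ge: "n + d \<le> (pad ^^ d) n"
  by (induction d) (auto simp: pad_def)

lemma unpad_funpow_le: "(unpad ^^ d) m \<le> m"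
  using pad_ge[of m d] by (simp add: unpad_funpow_le_iff)

lemma filterlim_unpad_funpow: "filterlim (unpad ^^ d) sequentially sequentially"
  unfolding filterlim_at_top
proof
  fix N
  have "N \<le> (unpad ^^ d) m" if "m > (pad ^^ d) N" for m
    using that unpad_funpow_le_iff[of d m N] by linarith
  then show "\<forall>\<^sub>F m in sequentially. N \<le> (unpad ^^ d) m"
    using eventually_gt_at_top by (rule eventually_mono[rotated])
qed

lemma filterlim_pad_funpow: "filterlim (pad ^^ d) sequentially sequentially"
  unfolding filterlim_at_top
proof
  fix N
  have "N \<le> (pad ^^ d) m" if "m \<ge> N" for m
    using that pad_ge[of m d] by linarith
  then show "\<forall>\<^sub>F m in sequentially. N \<le> (pad ^^ d) m"
    using eventually_ge_at_top by (rule eventually_mono[rotated])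
qed

text \<open>Horner's scheme: one application of \<open>pad\<close> absorbs a multiplication by
  \<open>n\<close>, since \<open>pad\<close> exceeds the square, and \<open>a\<close> further ones
  absorb the coefficient \<open>a\<close>, since each adds at least 1.\<close>

lemma pad_dominates_poly:
  fixes p :: "nat poly"
  shows "\<exists>d. \<forall>n. poly p n \<le> (pad ^^ d) n"
proof (induction p)
  case (pCons a p)
  then obtain d where d: "\<And>n. poly p n \<le> (pad ^^ d) n" by blast
  have "poly (pCons a p) n \<le> (pad ^^ (a + Suc d)) n" for n
  proof -
    let ?P = "(pad ^^ d) n"
    have "n * poly p n \<le> ?P * ?P" using d pad_ge[of n d] by (intro mult_mono) auto
    then have "poly (pCons a p) n \<le> pad ?P + a" by (simp add: pad_def)
    also have "\<dots> \<le> (pad ^^ a) (pad ?P)" by (rule pad_ge)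
    finally show ?thesis by (simp only: funpow_add o_apply funpow.simps)
  qed
  then show ?case by blast
qed simp

lemma pad_funpow_poly: "\<exists>l :: nat poly. \<forall>n. poly l n = (pad ^^ d) n"
proof (induction d)
  case 0
  show ?case by (intro exI[of _ "[:0, 1:]"]) simp
next
  case (Suc d)
  then obtain l :: "nat poly" where "\<forall>n. poly l n = (pad ^^ d) n" by blast
  then show ?case
    by (intro exI[of _ "l * l + l + 1"]) (simp add: pad_def[of "(pad ^^ d) _"])
qed

section \<open>Effect of a change of length on thresholds and uniform families\<close>

lemma takeWhile_replicate_append:
  "unary_end r \<Longrightarrow> takeWhile id (replicate n True @ r) = replicate n True"
  "unary_end r \<Longrightarrow> dropWhile id (replicate n True @ r) = r"
  by (induction n; cases r; simp add: unary_end_def)+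

lemma map_prefix_replicate:
  "unary_end r \<Longrightarrow> map_prefix h (replicate n True @ r) = replicate (h n) True @ r"
  by (simp add: map_prefix_def takeWhile_replicate_append)

lemma map_prefix_replicate_Nil: "map_prefix h (replicate n True) = replicate (h n) True"
  using map_prefix_replicate[of "[]" h n] by (simp add: unary_end_def)

lemma map_prefix_compose: "map_prefix h (map_prefix g w) = map_prefix (h \<circ> g) w"
  unfolding map_prefix_def[of g] map_prefix_replicate[OF unary_end_dropWhile]
  by (simp add: map_prefix_def)

lemma poly_time_map_prefix_funpow:
  assumes "poly_time_computable (map_prefix h)"
  shows "poly_time_computable (map_prefix (h ^^ Suc d))"
proof (induction d)
  case 0
  show ?case using assms by simp
next
  case (Suc d)
  have "map_prefix (h ^^ Suc (Suc d)) = (\<lambda>w. map_prefix h (map_prefix (h ^^ Suc d) w))"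
    by (rule ext) (simp add: map_prefix_compose comp_assoc)
  then show ?case using poly_time_compose[OF Suc assms] by (simp only:)
qed

text \<open>Rewriting the unary prefix turns a query at \<open>n\<close> into a query at
  \<open>h n\<close> with the same precision.\<close>

lemma poly_time_real_compose:
  assumes c: "poly_time_real c" and h: "poly_time_computable (map_prefix h)"
  shows "poly_time_real (\<lambda>n. c (h n))"
proof -
  obtain f where f: "poly_time_computable f"
    "\<And>n r. \<bar>c n - binary_fraction (f (replicate n True @ False # replicate r True))\<bar> \<le> 1 / 2 ^ r"
    using c unfolding poly_time_real_def by blast
  show ?thesis unfolding poly_time_real_def
    using poly_time_compose[OF h f(1)] f(2)
    by (intro exI[of _ "\<lambda>w. f (map_prefix h w)"]) (simp add: map_prefix_replicate unary_end_def)
qed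

text \<open>The renaming depends on the actual length \<open>n\<close>, so the circuit for length
  \<open>h n\<close> is generated first and then renamed with the original input still at
  hand.\<close>

lemma poly_time_uniform_rename_after:
  assumes V: "poly_time_uniform V" and h: "poly_time_computable (map_prefix h)"
    and wf: "wf_machine 3 4 W"
    and W: "\<And>x. renames_wires x W (\<rho> (length x)) (c * (length x + 1))"
  shows "poly_time_uniform (\<lambda>n. rename (\<rho> n) (V (h n)))"
proof -
  have "poly_time_computable (\<lambda>x. enc_circuit (V (length (map_prefix h (replicate (length x) True)))))"
    by (rule poly_time_compose[OF poly_time_compose[OF poly_time_length h] V[unfolded poly_time_uniform_def]])
  then have "poly_time_computable (\<lambda>x. enc_circuit (V (h (length x))))"
    by (simp add: map_prefix_replicate_Nil)
  then show ?thesis unfolding poly_time_uniform_def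
    by (rule poly_time_rename[OF _ wf W])
qed

text \<open>Here the renaming depends on the recovered length \<open>h m\<close>. So the family is
  renamed at its own lengths, and passing from \<open>m\<close> to \<open>h m\<close> is a
  precomposition.\<close>

lemma poly_time_uniform_rename_before:
  assumes V: "poly_time_uniform V" and h: "poly_time_computable (map_prefix h)"
    and wf: "wf_machine 3 4 W"
    and W: "\<And>x. renames_wires x W (\<rho> (length x)) (c * (length x + 1))"
  shows "poly_time_uniform (\<lambda>m. if m < N then C else rename (\<rho> (h m)) (V (h m)))"
proof -
  have "poly_time_computable (\<lambda>x. enc_circuit (rename (\<rho> (length x)) (V (length x))))"
    by (rule poly_time_rename[OF V[unfolded poly_time_uniform_def] wf W])
  from poly_time_compose[OF poly_time_compose[OF poly_time_length h] this]
  have "poly_time_computable (\<lambda>x. enc_circuit (rename (\<rho> (h (length x))) (V (h (length x)))))"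
    by (simp add: map_prefix_replicate_Nil)
  from poly_time_if_short[OF this, of N "enc_circuit C"] show ?thesis
    unfolding poly_time_uniform_def by (simp add: if_distrib)
qed

section \<open>Renaming the wires and acceptance\<close>

lemma circuit_on_rename:
  assumes "circuit_on W C" "inj_on \<rho> W" "\<rho> ` W \<subseteq> W'"
  shows "circuit_on W' (rename \<rho> C)"
proof -
  have "gate_on W' (rename_gate \<rho> g)" if "gate_on W g" for g
  proof (cases g)
    case (Gate2 nm v w)
    then show ?thesis using that assms(2,3) inj_on_eq_iff[OF assms(2), of v w] by auto
  qed (use that assms(3) in auto)
  then show ?thesis using assms by (auto simp: circuit_on_def rename_def)
qed

text \<open>\<open>\<beta>\<close> and \<open>\<beta>'\<close> are the initial bits of the original
  and of the renamed circuit. Wires that the gates do not touch keep these bits, so only basis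
  states in \<open>inside\<close> and \<open>inside'\<close> have nonzero amplitude;
  \<open>lift\<close> is a bijection between the two sets and carries one evolution to the
  other.\<close>

locale renaming =
  fixes W :: "wire set" and \<rho> :: "wire \<Rightarrow> wire" and \<beta> \<beta>' :: "wire \<Rightarrow> bool"
  assumes inj: "inj_on \<rho> W" and bits: "\<And>v. v \<in> W \<Longrightarrow> \<beta>' (\<rho> v) = \<beta> v"
begin

definition lift :: "(wire \<Rightarrow> bool) \<Rightarrow> wire \<Rightarrow> bool" where
  "lift b w = (if w \<in> \<rho> ` W then b (inv_into W \<rho> w) else \<beta>' w)"

definition inside :: "(wire \<Rightarrow> bool) set" where
  "inside = {b. \<forall>w. w \<notin> W \<longrightarrow> b w = \<beta> w}"

definition inside' :: "(wire \<Rightarrow> bool) set" where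
  "inside' = {b. \<forall>w. w \<notin> \<rho> ` W \<longrightarrow> b w = \<beta>' w}"

definition related :: "qstate \<Rightarrow> qstate \<Rightarrow> bool" where
  "related \<psi> \<psi>' \<longleftrightarrow> (\<forall>b \<in> inside. \<psi>' (lift b) = \<psi> b) \<and>
     (\<forall>b. \<psi> b \<noteq> 0 \<longrightarrow> b \<in> inside) \<and> (\<forall>b. \<psi>' b \<noteq> 0 \<longrightarrow> b \<in> inside')"

lemma lift_wire [simp]: "v \<in> W \<Longrightarrow> lift b (\<rho> v) = b v"
  using inj by (simp add: lift_def)

lemma lift_update:
  assumes v: "v \<in> W"
  shows "(lift b)(\<rho> v := a) = lift (b(v := a))"
proof
  fix w
  show "((lift b)(\<rho> v := a)) w = lift (b(v := a)) w"
  proof (cases "w \<in> \<rho> ` W")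
    case True
    then obtain v' where v': "v' \<in> W" "w = \<rho> v'" by blast
    then show ?thesis using v inj_on_eq_iff[OF inj, of v v'] lift_wire[of v'] by auto
  next
    case False
    then show ?thesis using v by (auto simp: lift_def)
  qed
qed

lemma inside_update [simp]: "v \<in> W \<Longrightarrow> b(v := a) \<in> inside \<longleftrightarrow> b \<in> inside"
  by (auto simp: inside_def)

lemma inside'_update [simp]: "v \<in> W \<Longrightarrow> b(\<rho> v := a) \<in> inside' \<longleftrightarrow> b \<in> inside'"
  by (auto simp: inside'_def)

lemma bij_lift: "bij_betw lift inside inside'"
  unfolding bij_betw_def
proof
  show "inj_on lift inside"
  proof (rule inj_onI, rule ext)
    fix b b' w assume b: "b \<in> inside" "b' \<in> inside" "lift b = lift b'"
    show "b w = b' w"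
    proof (cases "w \<in> W")
      case True
      then show ?thesis using lift_wire[of w b] lift_wire[of w b'] b(3) by simp
    next
      case False
      then show ?thesis using b by (simp add: inside_def)
    qed
  qed
  show "lift ` inside = inside'"
  proof
    show "lift ` inside \<subseteq> inside'"
    proof
      fix b assume "b \<in> lift ` inside"
      then obtain b0 where "b = lift b0" by blast
      then show "b \<in> inside'" by (simp add: inside'_def lift_def)
    qed
    show "inside' \<subseteq> lift ` inside"
    proof
      fix b assume b: "b \<in> inside'"
      let ?b = "\<lambda>v. if v \<in> W then b (\<rho> v) else \<beta> v"
      have "lift ?b w = b w" for w
      proof (cases "w \<in> \<rho> ` W")
        case True
        then obtain v where v: "v \<in> W" "w = \<rho> v" by blast
        then show ?thesis using lift_wire[of v ?b] by simp
      next
        case False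
        then show ?thesis using b by (simp add: lift_def inside'_def)
      qed
      then have "lift ?b = b" by (rule ext)
      moreover have "?b \<in> inside" by (simp add: inside_def)
      ultimately show "b \<in> lift ` inside" by (rule image_eqI[OF sym])
    qed
  qed
qed

lemma related_initial:
  "related (\<lambda>b. if b = \<beta> then 1 else 0) (\<lambda>b. if b = \<beta>' then 1 else 0)"
proof -
  have "lift \<beta> = \<beta>'" using bits inj by (auto simp: lift_def fun_eq_iff)
  moreover have "b = \<beta>" if "b \<in> inside" "lift b = lift \<beta>" for b
    using that bij_lift by (auto simp: bij_betw_def inside_def dest: inj_onD)
  ultimately show ?thesis by (auto simp: related_def inside_def inside'_def)
qed

lemma related_apply_gate:
  assumes "related \<psi> \<psi>'" "gate_on W g"
  shows "related (apply_gate \<G> g \<psi>) (apply_gate \<G> (rename_gate \<rho> g) \<psi>')"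
proof (cases g)
  case (Gate1 nm v)
  then have v: "v \<in> W" using assms(2) by simp
  have eq: "apply_gate \<G> (rename_gate \<rho> g) \<psi>' (lift b) = apply_gate \<G> g \<psi> b" if "b \<in> inside" for b
    using assms(1) that v by (simp add: Gate1 lift_update related_def)
  have out: "b \<in> inside" if "apply_gate \<G> g \<psi> b \<noteq> 0" for b
  proof -
    have "\<not> (\<forall>a. \<psi> (b(v := a)) = 0)" using that by (intro notI) (simp add: Gate1)
    then obtain a where "\<psi> (b(v := a)) \<noteq> 0" by blast
    then have "b(v := a) \<in> inside" using assms(1) unfolding related_def by blast
    then show ?thesis using v by simp
  qed
  have out': "b \<in> inside'" if "apply_gate \<G> (rename_gate \<rho> g) \<psi>' b \<noteq> 0" for b
  proof -
    have "\<not> (\<forall>a. \<psi>' (b(\<rho> v := a)) = 0)" using that by (intro notI) (simp add: Gate1)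
    then obtain a where "\<psi>' (b(\<rho> v := a)) \<noteq> 0" by blast
    then have "b(\<rho> v := a) \<in> inside'" using assms(1) unfolding related_def by blast
    then show ?thesis using v by simp
  qed
  show ?thesis using eq out out' unfolding related_def by blast
next
  case (Gate2 nm v w)
  then have v: "v \<in> W" "w \<in> W" using assms(2) by simp_all
  have eq: "apply_gate \<G> (rename_gate \<rho> g) \<psi>' (lift b) = apply_gate \<G> g \<psi> b" if "b \<in> inside" for b
    using assms(1) that v by (simp add: Gate2 lift_update related_def case_prod_unfold)
  have out: "b \<in> inside" if "apply_gate \<G> g \<psi> b \<noteq> 0" for b
  proof -
    have "\<not> (\<forall>a a'. \<psi> (b(v := a, w := a')) = 0)"
      using that by (intro notI) (simp add: Gate2 case_prod_unfold)
    then obtain a a' where "\<psi> (b(v := a, w := a')) \<noteq> 0" by blast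
    then have "b(v := a, w := a') \<in> inside" using assms(1) unfolding related_def by blast
    then show ?thesis using v by simp
  qed
  have out': "b \<in> inside'" if "apply_gate \<G> (rename_gate \<rho> g) \<psi>' b \<noteq> 0" for b
  proof -
    have "\<not> (\<forall>a a'. \<psi>' (b(\<rho> v := a, \<rho> w := a')) = 0)"
      using that by (intro notI) (simp add: Gate2 case_prod_unfold)
    then obtain a a' where "\<psi>' (b(\<rho> v := a, \<rho> w := a')) \<noteq> 0" by blast
    then have "b(\<rho> v := a, \<rho> w := a') \<in> inside'" using assms(1) unfolding related_def by blast
    then show ?thesis using v by simp
  qed
  show ?thesis using eq out out' unfolding related_def by blast
qed

lemma related_fold:
  assumes "related \<psi> \<psi>'" "\<forall>g \<in> set gs. gate_on W g"
  shows "related (fold (apply_gate \<G>) gs \<psi>) (fold (apply_gate \<G>) (map (rename_gate \<rho>) gs) \<psi>')"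
  using assms by (induction gs arbitrary: \<psi> \<psi>') (auto simp: related_apply_gate)

lemma related_sum:
  assumes "related \<psi> \<psi>'" "v \<in> W"
  shows "(\<Sum>b | \<psi>' b \<noteq> 0 \<and> b (\<rho> v). (cmod (\<psi>' b))\<^sup>2) = (\<Sum>b | \<psi> b \<noteq> 0 \<and> b v. (cmod (\<psi> b))\<^sup>2)"
proof (rule sum.reindex_bij_witness[where i = lift and j = "inv_into inside lift"])
  note bij = bij_lift[unfolded bij_betw_def]
  fix b assume b: "b \<in> {b. \<psi>' b \<noteq> 0 \<and> b (\<rho> v)}"
  then have "b \<in> lift ` inside" using assms(1) bij by (auto simp: related_def)
  then obtain b0 where b0: "b0 \<in> inside" "b = lift b0" by blast
  then have inv: "inv_into inside lift (lift b0) = b0" using bij by simp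
  show "lift (inv_into inside lift b) = b" by (simp add: inv b0)
  show "inv_into inside lift b \<in> {b. \<psi> b \<noteq> 0 \<and> b v}"
    using b b0 assms by (simp add: inv related_def)
  show "(cmod (\<psi> (inv_into inside lift b)))\<^sup>2 = (cmod (\<psi>' b))\<^sup>2"
    using b0 assms by (simp add: inv related_def)
next
  note bij = bij_lift[unfolded bij_betw_def]
  fix b assume b: "b \<in> {b. \<psi> b \<noteq> 0 \<and> b v}"
  then have b': "b \<in> inside" using assms(1) by (auto simp: related_def)
  then show "inv_into inside lift (lift b) = b" using bij by simp
  show "lift b \<in> {b. \<psi>' b \<noteq> 0 \<and> b (\<rho> v)}" using b b' assms by (auto simp: related_def)
qed

end

lemma accept_prob_rename:
  assumes "circuit_on W C" "inj_on \<rho> W"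
    and "\<And>v. v \<in> W \<Longrightarrow> initial_bits x' ys' (\<rho> v) = initial_bits x ys v"
  shows "accept_prob \<G> (rename \<rho> C) x' ys' = accept_prob \<G> C x ys"
proof -
  interpret renaming W \<rho> "initial_bits x ys" "initial_bits x' ys'"
    by unfold_locales (use assms in auto)
  have "related (final_state \<G> C x ys) (final_state \<G> (rename \<rho> C) x' ys')"
    unfolding final_state_def initial_state_def rename_def circuit.sel
    by (rule related_fold[OF related_initial]) (use assms(1) in \<open>simp add: circuit_on_def\<close>)
  from related_sum[OF this] assms(1) show ?thesis
    by (simp add: accept_prob_def rename_def circuit_on_def)
qed

lemma rename_id: "rename (\<lambda>v. v) C = C"
proof -
  have "rename_gate (\<lambda>v. v) g = g" for g by (cases g) auto
  then show ?thesis by (simp add: rename_def map_idI)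
qed

lemma accept_prob_cong:
  assumes "circuit_on W C"
    and "\<And>v. v \<in> W \<Longrightarrow> initial_bits x' ys' v = initial_bits x ys v"
  shows "accept_prob \<G> C x' ys' = accept_prob \<G> C x ys"
  using accept_prob_rename[OF assms(1), of "\<lambda>v. v" x' ys' x ys] assms(2) by (simp add: rename_id)

section \<open>Quantifiers over proofs\<close>

definition quantify :: "bool \<Rightarrow> nat \<Rightarrow> (bool list \<Rightarrow> bool) \<Rightarrow> bool" where
  "quantify e m P = (if e then \<exists>y. length y = m \<and> P y else \<forall>y. length y = m \<longrightarrow> P y)"

lemma alternating_Suc:
  "alternating e (Suc i) m P = quantify e m (\<lambda>y. alternating (\<not> e) i m (\<lambda>ys. P (y # ys)))"
  by (cases e) (simp_all add: quantify_def)

lemma quantify_mono: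
  "quantify e m P \<Longrightarrow> (\<And>y. length y = m \<Longrightarrow> P y \<Longrightarrow> Q y) \<Longrightarrow> quantify e m Q"
  by (auto simp: quantify_def split: if_splits)

lemma alternating_mono:
  "alternating e i m P \<Longrightarrow>
   (\<And>ys. length ys = i \<Longrightarrow> \<forall>y \<in> set ys. length y = m \<Longrightarrow> P ys \<Longrightarrow> Q ys) \<Longrightarrow> alternating e i m Q"
proof (induction i arbitrary: e P Q)
  case (Suc i)
  show ?case unfolding alternating_Suc
  proof (rule quantify_mono[OF Suc.prems(1)[unfolded alternating_Suc]])
    fix y :: "bool list" assume y: "length y = m" "alternating (\<not> e) i m (\<lambda>ys. P (y # ys))"
    show "alternating (\<not> e) i m (\<lambda>ys. Q (y # ys))"
      by (rule Suc.IH[OF y(2)]) (use y(1) Suc.prems(2) in auto)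
  qed
qed simp

lemma quantify_map:
  assumes "\<And>y. length y = m' \<Longrightarrow> length (f y) = m"
    and "\<And>y. length y = m \<Longrightarrow> \<exists>y'. length y' = m' \<and> f y' = y"
  shows "quantify e m' (\<lambda>y. P (f y)) = quantify e m P"
  unfolding quantify_def using assms by metis

lemma quantify_take:
  assumes "m \<le> m'"
  shows "quantify e m' (\<lambda>y. P (take m y)) = quantify e m P"
proof (rule quantify_map)
  show "\<exists>y'. length y' = m' \<and> take m y' = y" if "length y = m" for y :: "bool list"
    using that assms by (intro exI[of _ "y @ replicate (m' - m) False"]) simp
qed (use assms in simp)

text \<open>All proofs of a verifier have one common length, so shorter ones must be lengthened by
  bits that the circuit ignores. Truncation is onto, hence every quantifier keeps its
  meaning.\<close>

lemma alternating_take: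
  assumes "m \<le> m'"
  shows "alternating e i m' (\<lambda>ys. P (map (take m) ys)) = alternating e i m P"
proof (induction i arbitrary: e P)
  case (Suc i)
  have "alternating (\<not> e) i m' (\<lambda>ys. P (map (take m) (y # ys))) =
      alternating (\<not> e) i m (\<lambda>ys. P (take m y # ys))" for y
    using Suc.IH[of "\<not> e" "\<lambda>ys. P (take m y # ys)"] by simp
  then show ?case unfolding alternating_Suc
    using quantify_take[OF assms, of e "\<lambda>y. alternating (\<not> e) i m (\<lambda>ys. P (y # ys))"] by simp
qed simp

lemma alternating_const: "P \<Longrightarrow> alternating e i m (\<lambda>_. P)"
proof (induction i arbitrary: e)
  case (Suc i)
  have "\<exists>y :: bool list. length y = m" by (rule exI[of _ "replicate m False"]) simp
  then show ?case using Suc by (simp add: alternating_Suc quantify_def)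
qed simp

lemma alternating_extend:
  "alternating e i m P \<Longrightarrow> alternating e (i + j) m (\<lambda>ys. P (take i ys))"
proof (induction i arbitrary: e P)
  case 0
  then show ?case by (simp add: alternating_const)
next
  case (Suc i)
  show ?case unfolding add_Suc alternating_Suc take_Suc_Cons
    by (rule quantify_mono[OF Suc.prems[unfolded alternating_Suc]]) (rule Suc.IH)
qed

definition evens :: "nat \<Rightarrow> bool list \<Rightarrow> bool list" where
  "evens a y = map (\<lambda>i. y ! (2 * i)) [0..<a]"

definition odds :: "nat \<Rightarrow> bool list \<Rightarrow> bool list" where
  "odds a y = map (\<lambda>i. y ! (2 * i + 1)) [0..<a]"

lemma length_evens [simp]: "length (evens a y) = a" and length_odds [simp]: "length (odds a y) = a"
  by (simp_all add: evens_def odds_def)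

text \<open>Two adjacent quantifiers of the same kind become one, because every pair of strings
  arises as the even and odd part of one string of length \<open>m\<close>.\<close>

lemma quantify_interleave:
  assumes "2 * a \<le> m" "2 * b \<le> m"
  shows "quantify e m (\<lambda>y. P (evens a y) (odds b y)) =
    quantify e a (\<lambda>u. quantify e b (\<lambda>w. P u w))"
proof -
  have ex: "\<exists>y. length y = m \<and> evens a y = u \<and> odds b y = w" if "length u = a" "length w = b" for u w
  proof -
    let ?y = "map (\<lambda>i. if even i then (i div 2 < a \<and> u ! (i div 2)) else (i div 2 < b \<and> w ! (i div 2))) [0..<m]"
    have "evens a ?y = u" "odds b ?y = w"
      using that assms by (auto intro!: nth_equalityI simp: evens_def odds_def)
    then show ?thesis by (intro exI[of _ ?y]) simp
  qed
  show ?thesis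
  proof
    assume l: "quantify e m (\<lambda>y. P (evens a y) (odds b y))"
    show "quantify e a (\<lambda>u. quantify e b (\<lambda>w. P u w))"
    proof (cases e)
      case True
      then obtain y where "P (evens a y) (odds b y)" using l by (auto simp: quantify_def)
      then have "\<exists>w. length w = b \<and> P (evens a y) w" by (intro exI[of _ "odds b y"]) simp
      then have "\<exists>u. length u = a \<and> (\<exists>w. length w = b \<and> P u w)"
        by (intro exI[of _ "evens a y"]) simp
      then show ?thesis using True by (simp add: quantify_def)
    next
      case False
      have "P u w" if "length u = a" "length w = b" for u w
        using ex[OF that] False l by (auto simp: quantify_def)
      then show ?thesis using False by (simp add: quantify_def)
    qed
  next
    assume r: "quantify e a (\<lambda>u. quantify e b (\<lambda>w. P u w))"
    show "quantify e m (\<lambda>y. P (evens a y) (odds b y))"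
    proof (cases e)
      case True
      then obtain u w where "length u = a" "length w = b" "P u w"
        using r by (auto simp: quantify_def)
      with ex[of u w] True show ?thesis by (auto simp: quantify_def)
    next
      case False
      then show ?thesis using r by (simp add: quantify_def)
    qed
  qed
qed

section \<open>Collapse of the hierarchy\<close>

text \<open>One family for both hierarchies: exchanging the quantifiers is negating
  \<open>e\<close>, so a single argument treats Sigma and Pi.\<close>

definition QC :: "gate_set \<Rightarrow> bool \<Rightarrow> nat \<Rightarrow> problem set" where
  "QC \<G> e i = {A. promise_problem A \<and> (\<exists>c s. admissible c s \<and> has_verifier \<G> e i c s A)}"

lemma QCSigma_eq: "QCSigma \<G> i = QC \<G> True i"
  by (auto simp: QCSigma_def QCSigma_cs_def QC_def)

lemma QCPi_eq: "QCPi \<G> i = QC \<G> False i"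
  by (auto simp: QCPi_def QCPi_cs_def QC_def)

lemma poly_nat_pos:
  fixes q :: "nat poly"
  assumes "q \<noteq> 0" "n \<ge> 1"
  shows "poly q n > 0"
  using assms(1)
proof (induction q)
  case (pCons a q)
  then show ?case using assms(2) by (cases "q = 0") auto
qed simp

text \<open>The gap at \<open>n\<close> is the old gap at \<open>h n\<close>, and it stays inverse
  polynomial because \<open>h\<close> is bounded by a polynomial. Divergence of \<open>h\<close>
  transfers a bound that holds only eventually.\<close>

lemma admissible_compose:
  assumes cs: "admissible c s" and h: "poly_time_computable (map_prefix h)"
    and lim: "filterlim h sequentially sequentially" and l: "\<And>n. h n \<le> poly l n"
  shows "admissible (\<lambda>n. c (h n)) (\<lambda>n. s (h n))"
proof -
  obtain q :: "nat poly" and C where q: "q \<noteq> 0" "C > 0"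
    "\<forall>\<^sub>F n in sequentially. c n - s n \<ge> C / real (poly q n)"
    using cs unfolding admissible_def by blast
  have pos: "poly q (poly l n) > 0" if "h n \<ge> 1" for n
    using that l[of n] by (intro poly_nat_pos q) simp
  have ge1: "\<forall>\<^sub>F n in sequentially. h n \<ge> 1"
    using lim unfolding filterlim_at_top by blast
  then obtain n where "h n \<ge> 1"
    by (metis eventually_happens trivial_limit_sequentially)
  then have "poly (pcompose q l) n \<noteq> 0" using pos by (simp add: poly_pcompose)
  then have nz: "pcompose q l \<noteq> 0" by auto
  have "\<forall>\<^sub>F n in sequentially. c (h n) - s (h n) \<ge> C / real (poly q (h n))"
    using lim q(3) by (rule eventually_compose_filterlim[rotated])
  then have ev: "\<forall>\<^sub>F n in sequentially. c (h n) - s (h n) \<ge> C / real (poly (pcompose q l) n)"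
    using ge1
  proof eventually_elim
    case (elim n)
    have "poly q (h n) > 0" using elim by (intro poly_nat_pos q) simp
    moreover have "poly q (h n) \<le> poly q (poly l n)" by (rule poly_nat_mono[OF l])
    ultimately have "C / real (poly (pcompose q l) n) \<le> C / real (poly q (h n))"
      using q(2) by (simp add: poly_pcompose frac_le)
    then show ?case using elim by simp
  qed
  have ran: "range (\<lambda>n. c (h n)) \<subseteq> {0..1}" "range (\<lambda>n. s (h n)) \<subseteq> {0..1}"
    using cs unfolding admissible_def by blast+
  have "poly_time_real (\<lambda>n. c (h n))" "poly_time_real (\<lambda>n. s (h n))"
    using cs poly_time_real_compose[OF _ h] unfolding admissible_def by blast+
  with ran ev nz q(2) show ?thesis unfolding admissible_def by blast
qed

lemma initial_bits_take:
  assumes "v \<in> input_wires n i m"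
  shows "initial_bits x (take i ys) v = initial_bits x ys v"
  using assms by (auto simp: input_wires_def)

lemma input_wires_mono: "i \<le> k \<Longrightarrow> input_wires n i m \<subseteq> input_wires n k m"
  unfolding input_wires_def by fastforce

lemma circuit_on_mono: "circuit_on W C \<Longrightarrow> W \<subseteq> W' \<Longrightarrow> circuit_on W' C"
  using circuit_on_rename[of W C "\<lambda>v. v" W'] by (simp add: rename_id)

text \<open>The additional quantifiers range over proofs that the circuit ignores.\<close>

lemma QC_mono:
  assumes "i \<le> k"
  shows "QC \<G> e i \<subseteq> QC \<G> e k"
proof
  fix A assume "A \<in> QC \<G> e i"
  then obtain c s and p :: "nat poly" and V where A: "promise_problem A" "admissible c s"
    and V: "poly_time_uniform V" "\<And>n. circuit_on (input_wires n i (poly p n)) (V n)"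
    and yes: "\<And>x. x \<in> fst A \<Longrightarrow> alternating e i (poly p (length x)) (\<lambda>ys. accept_prob \<G> (V (length x)) x ys \<ge> c (length x))"
    and no: "\<And>x. x \<in> snd A \<Longrightarrow> alternating (\<not> e) i (poly p (length x)) (\<lambda>ys. accept_prob \<G> (V (length x)) x ys \<le> s (length x))"
    unfolding QC_def has_verifier_def by blast
  obtain j where k: "k = i + j" using assms le_Suc_ex by blast
  have eq: "accept_prob \<G> (V n) x (take i ys) = accept_prob \<G> (V n) x ys" for n x ys
    by (rule accept_prob_cong[OF V(2)]) (rule initial_bits_take)
  have V': "circuit_on (input_wires n k (poly p n)) (V n)" for n
    by (rule circuit_on_mono[OF V(2) input_wires_mono[OF assms]])
  have "has_verifier \<G> e k c s A"
    unfolding has_verifier_def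
    using V(1) V' alternating_extend[OF yes, of _ j, unfolded eq] alternating_extend[OF no, of _ j, unfolded eq]
    by (intro exI[of _ p] exI[of _ V]) (auto simp: k)
  then show "A \<in> QC \<G> e k" using A unfolding QC_def by blast
qed

text \<open>Restricted to the wires of the circuit because \<open>Input_bit j\<close> with
  \<open>j \<ge> n\<close> would collide with a bit of the moved proof. For
  \<open>input_to_proof\<close> parity excludes collisions everywhere.\<close>

lemma inj_proof_to_input: "inj_on (proof_to_input n) (input_wires n i m)"
proof (rule inj_onI)
  fix v w assume vw: "v \<in> input_wires n i m" "w \<in> input_wires n i m"
    "proof_to_input n v = proof_to_input n w"
  then show "v = w"
    by (cases "(n, v)" rule: proof_to_input.cases; cases "(n, w)" rule: proof_to_input.cases)
      (auto simp: input_wires_def)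
qed

lemma inj_input_to_proof: "inj (input_to_proof n)"
proof (rule injI)
  fix v w assume "input_to_proof n v = input_to_proof n w"
  then show "v = w"
    by (cases "(n, v)" rule: input_to_proof.cases; cases "(n, w)" rule: input_to_proof.cases)
      (auto split: if_splits, presburger+)
qed

lemma proof_to_input_wires:
  assumes "n + a \<le> m" "a \<le> b"
  shows "proof_to_input n ` input_wires n (Suc i) a \<subseteq> input_wires m i b"
proof
  fix w assume "w \<in> proof_to_input n ` input_wires n (Suc i) a"
  then obtain v where v: "v \<in> input_wires n (Suc i) a" "w = proof_to_input n v" by blast
  then show "w \<in> input_wires m i b"
    using assms by (cases "(n, v)" rule: proof_to_input.cases) (auto simp: input_wires_def)
qed

lemma input_to_proof_wires:
  assumes "k \<ge> 1" "2 * m \<le> b" "2 * a \<le> b"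
  shows "input_to_proof n ` input_wires m k a \<subseteq> input_wires n k b"
proof
  fix w assume "w \<in> input_to_proof n ` input_wires m k a"
  then obtain v where v: "v \<in> input_wires m k a" "w = input_to_proof n v" by blast
  then show "w \<in> input_wires n k b"
    using assms by (cases "(n, v)" rule: input_to_proof.cases) (auto simp: input_wires_def)
qed

lemma accept_prob_proof_to_input:
  assumes C: "circuit_on (input_wires n (Suc i) a) C" and w: "n + a \<le> length w"
    and ys: "length ys = i" "\<forall>y \<in> set ys. length y = b" and ab: "a \<le> b"
  shows "accept_prob \<G> (rename (proof_to_input n) C) w ys =
    accept_prob \<G> C (take n w) (take a (drop n w) # map (take a) ys)"
proof (rule accept_prob_rename[OF C inj_proof_to_input])
  fix v assume "v \<in> input_wires n (Suc i) a"
  then show "initial_bits w ys (proof_to_input n v) =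
      initial_bits (take n w) (take a (drop n w) # map (take a) ys) v"
    using w ys ab by (cases "(n, v)" rule: proof_to_input.cases) (auto simp: input_wires_def)
qed

lemma accept_prob_input_to_proof:
  assumes C: "circuit_on (input_wires m (Suc i) a) C" and x: "length x = n" and nm: "n \<le> m"
    and ys: "length y = b" "length ys = i" "\<forall>y \<in> set ys. length y = b" and ab: "2 * m \<le> b" "2 * a \<le> b"
  shows "accept_prob \<G> (rename (input_to_proof n) C) x (y # ys) =
    accept_prob \<G> C (x @ evens (m - n) y) (odds a y # map (take a) ys)"
proof (rule accept_prob_rename[OF C inj_on_subset[OF inj_input_to_proof subset_UNIV]])
  fix v assume "v \<in> input_wires m (Suc i) a"
  then show "initial_bits x (y # ys) (input_to_proof n v) =
      initial_bits (x @ evens (m - n) y) (odds a y # map (take a) ys) v"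
    using x nm ys ab
    by (cases "(n, v)" rule: input_to_proof.cases)
      (auto simp: input_wires_def nth_append evens_def odds_def)
qed

text \<open>The quantifier over \<open>u\<close> has the kind \<open>e\<close> of the first
  quantifier behind it, so the two merge; the remaining proofs are only lengthened from
  \<open>a\<close> to \<open>b\<close>.\<close>

lemma alternating_merge:
  assumes "n \<le> m" "2 * m \<le> b" "2 * a \<le> b"
    and alt: "quantify e (m - n) (\<lambda>u. alternating e (Suc i) a (P u))"
    and P: "\<And>y ys. length y = b \<Longrightarrow> length ys = i \<Longrightarrow> \<forall>y \<in> set ys. length y = b \<Longrightarrow>
       P (evens (m - n) y) (odds a y # map (take a) ys) \<Longrightarrow> Q (y # ys)"
  shows "alternating e (Suc i) b Q"
proof -
  have ab: "a \<le> b" "2 * (m - n) \<le> b" using assms by simp_all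
  have "quantify e (m - n) (\<lambda>u. quantify e a (\<lambda>w. alternating (\<not> e) i a (\<lambda>ys. P u (w # ys))))"
    using alt by (simp only: alternating_Suc)
  then have "quantify e b (\<lambda>y. alternating (\<not> e) i a (\<lambda>ys. P (evens (m - n) y) (odds a y # ys)))"
    using quantify_interleave[OF ab(2) assms(3), of e "\<lambda>u w. alternating (\<not> e) i a (\<lambda>ys. P u (w # ys))"]
    by simp
  then show ?thesis unfolding alternating_Suc
  proof (rule quantify_mono)
    fix y assume y: "length y = b"
      "alternating (\<not> e) i a (\<lambda>ys. P (evens (m - n) y) (odds a y # ys))"
    from y(2) have "alternating (\<not> e) i b (\<lambda>ys. P (evens (m - n) y) (odds a y # map (take a) ys))"
      using alternating_take[OF ab(1), of "\<not> e" i "\<lambda>ys. P (evens (m - n) y) (odds a y # ys)"] by simp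
    then show "alternating (\<not> e) i b (\<lambda>ys. Q (y # ys))"
      by (rule alternating_mono) (use P[OF y(1)] in blast)
  qed
qed

text \<open>
  The first quantifier of \<open>A\<close> is moved into the input of a problem \<open>B\<close>.  An instance of \<open>B\<close> is
  the concatenation of an instance of \<open>A\<close>, a first proof and arbitrary bits; the latter bring it to
  a length from which the length of the instance of \<open>A\<close> can be recovered.
\<close>

lemma QC_remove_quantifier:
  assumes A: "A \<in> QC \<G> e (Suc i)" and sub: "QC \<G> (\<not> e) i \<subseteq> QC \<G> e k" and k: "k \<ge> 1"
  shows "A \<in> QC \<G> e k"
proof -
  obtain c s and p :: "nat poly" and V where promise: "promise_problem A" and cs: "admissible c s"
    and V: "poly_time_uniform V" "\<And>n. circuit_on (input_wires n (Suc i) (poly p n)) (V n)"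
    and yes: "\<And>x. x \<in> fst A \<Longrightarrow> alternating e (Suc i) (poly p (length x)) (\<lambda>ys. accept_prob \<G> (V (length x)) x ys \<ge> c (length x))"
    and no: "\<And>x. x \<in> snd A \<Longrightarrow> alternating (\<not> e) (Suc i) (poly p (length x)) (\<lambda>ys. accept_prob \<G> (V (length x)) x ys \<le> s (length x))"
    using A unfolding QC_def has_verifier_def by blast
  \<comment> \<open>The bound is on \<open>n + 1 + p (n + 1)\<close>, not on \<open>n + p n\<close>:
    \<open>h\<close> rounds up, so \<open>h m = n + 1\<close> only guarantees
    \<open>m > l n\<close>, and yet this \<open>m\<close> must have room for \<open>n + 1\<close>
    input bits and their first proof.\<close>
  obtain d0 where d0: "\<And>n. poly ([:1, 1:] + pcompose p [:1, 1:]) n \<le> (pad ^^ d0) n"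
    using pad_dominates_poly by blast
  \<comment> \<open>At least one iteration, since \<open>poly_time_map_prefix_funpow\<close> starts
    there.\<close>
  define d where "d = Suc d0"
  define l where "l = pad ^^ d"
  define h where "h = unpad ^^ d"
  have l_ge: "Suc n + poly p (Suc n) \<le> l n" for n
  proof -
    have "(pad ^^ d0) n \<le> l n" unfolding l_def d_def by (simp add: pad_def[of "(pad ^^ d0) n"])
    then show ?thesis using d0[of n] by (simp add: poly_pcompose)
  qed
  have l_room: "n + poly p n \<le> l n" for n
    using l_ge[of n] poly_nat_mono[of n "Suc n" p] by simp
  have hl: "h (l n) = n" for n by (simp add: h_def l_def unpad_pad_funpow)
  have h_le: "h m \<le> m" for m by (simp add: h_def unpad_funpow_le)
  have h_room: "h m + poly p (h m) \<le> m" if "l 0 \<le> m" for m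
  proof (cases "h m")
    case 0
    then show ?thesis using l_room[of 0] that by simp
  next
    case (Suc n)
    then have "\<not> h m \<le> n" by simp
    then have "l n < m" by (simp add: h_def l_def unpad_funpow_le_iff)
    then show ?thesis using l_ge[of n] Suc by simp
  qed
  have l_mono: "l 0 \<le> l n" for n
    using pad_strict_mono[of 0 n d] by (cases "n = 0") (auto simp: l_def)
  have l_poly_time: "poly_time_computable (map_prefix l)" and h_poly_time: "poly_time_computable (map_prefix h)"
    unfolding l_def h_def d_def
    by (rule poly_time_map_prefix_funpow[OF poly_time_pad] poly_time_map_prefix_funpow[OF poly_time_unpad])+

  \<comment> \<open>The length determines \<open>n\<close>, because \<open>h\<close> inverts
    \<open>l\<close>. Both sets demand that the prefix obeys the promise of \<open>A\<close>, from
    which their disjointness is inherited.\<close>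
  define Byes where "Byes = {w. \<exists>n. length w = l n \<and> take n w \<in> fst A \<and>
     alternating (\<not> e) i (poly p n) (\<lambda>ys. accept_prob \<G> (V n) (take n w) (take (poly p n) (drop n w) # ys) \<ge> c n)}"
  define Bno where "Bno = {w. \<exists>n. length w = l n \<and> take n w \<in> snd A \<and>
     alternating e i (poly p n) (\<lambda>ys. accept_prob \<G> (V n) (take n w) (take (poly p n) (drop n w) # ys) \<le> s n)}"
  \<comment> \<open>All instances have some length \<open>l n\<close>, which is at least
    \<open>l 0\<close>. Below that the renamed wires need not fit into the input, so a fixed circuit
    on an ancilla takes over.\<close>
  define VB where "VB = (\<lambda>m. if m < l 0 then Circuit [] (Ancilla 0)
      else rename (proof_to_input (h m)) (V (h m)))"

  have VB_on: "circuit_on (input_wires m i (poly p m)) (VB m)" for m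
  proof (cases "m < l 0")
    case True
    then show ?thesis by (auto simp: VB_def circuit_on_def input_wires_def)
  next
    case False
    then show ?thesis using h_room[of m] poly_nat_mono[OF h_le, of p m]
      by (auto simp: VB_def intro!: circuit_on_rename[OF V(2)] inj_proof_to_input
          proof_to_input_wires[THEN subsetD, of _ _ _ "poly p m"])
  qed
  have VB_accept: "accept_prob \<G> (VB (l n)) w ys =
      accept_prob \<G> (V n) (take n w) (take (poly p n) (drop n w) # map (take (poly p n)) ys)"
    if "length w = l n" "length ys = i" "\<forall>y \<in> set ys. length y = poly p (l n)" for n w ys
  proof -
    have "n \<le> l n" using l_room[of n] by simp
    then show ?thesis
      using accept_prob_proof_to_input[OF V(2), of n w ys "poly p (l n)" \<G>] that l_room[of n] l_mono[of n]
      by (simp add: VB_def hl poly_nat_mono)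
  qed
  have VB_alt: "alternating e' i (poly p (l n)) (\<lambda>ys. R (accept_prob \<G> (VB (l n)) w ys))"
    if w: "length w = l n"
      and alt: "alternating e' i (poly p n) (\<lambda>ys. R (accept_prob \<G> (V n) (take n w) (take (poly p n) (drop n w) # ys)))"
    for e' n w and R :: "real \<Rightarrow> bool"
  proof -
    have "poly p n \<le> poly p (l n)" using l_room[of n] by (intro poly_nat_mono) simp
    from alternating_take[OF this, of e' i "\<lambda>ys. R (accept_prob \<G> (V n) (take n w) (take (poly p n) (drop n w) # ys))"] alt
    have "alternating e' i (poly p (l n))
        (\<lambda>ys. R (accept_prob \<G> (V n) (take n w) (take (poly p n) (drop n w) # map (take (poly p n)) ys)))" by simp
    then show ?thesis by (rule alternating_mono) (simp add: VB_accept[OF w])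
  qed

  have "(Byes, Bno) \<in> QC \<G> (\<not> e) i"
    unfolding QC_def
  proof (intro CollectI conjI exI)
    have "False" if "w \<in> Byes" "w \<in> Bno" for w
    proof -
      obtain n n' where n: "length w = l n" "take n w \<in> fst A" "length w = l n'" "take n' w \<in> snd A"
        using \<open>w \<in> Byes\<close> \<open>w \<in> Bno\<close> unfolding Byes_def Bno_def by blast
      then have "n = n'" using hl by metis
      then show False using n promise by (auto simp: promise_problem_def)
    qed
    then show "promise_problem (Byes, Bno)" by (auto simp: promise_problem_def)
    show "admissible (\<lambda>m. c (h m)) (\<lambda>m. s (h m))"
      by (rule admissible_compose[OF cs h_poly_time, of "[:0, 1:]"])
        (use h_le in \<open>simp_all add: h_def filterlim_unpad_funpow\<close>)
    have VB_uniform: "poly_time_uniform VB"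
      unfolding VB_def
      by (rule poly_time_uniform_rename_before[OF V(1) h_poly_time wf_proof_to_input_machine renames_proof_to_input])
    have B_yes: "alternating (\<not> e) i (poly p (length w)) (\<lambda>ys. c (h (length w)) \<le> accept_prob \<G> (VB (length w)) w ys)"
      if "w \<in> Byes" for w
      using that VB_alt[of w _ "\<not> e" "\<lambda>r. c _ \<le> r"] by (auto simp: Byes_def hl)
    have B_no: "alternating (\<not> \<not> e) i (poly p (length w)) (\<lambda>ys. accept_prob \<G> (VB (length w)) w ys \<le> s (h (length w)))"
      if "w \<in> Bno" for w
      using that VB_alt[of w _ e "\<lambda>r. r \<le> s _"] by (auto simp: Bno_def hl)
    show "has_verifier \<G> (\<not> e) i (\<lambda>m. c (h m)) (\<lambda>m. s (h m)) (Byes, Bno)"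
      unfolding has_verifier_def fst_conv snd_conv using VB_uniform VB_on B_yes B_no by blast
  qed
  with sub have "(Byes, Bno) \<in> QC \<G> e k" by blast
  then obtain c' s' and p' :: "nat poly" and V' where cs': "admissible c' s'"
    and V': "poly_time_uniform V'" "\<And>n. circuit_on (input_wires n k (poly p' n)) (V' n)"
    and yes': "\<And>x. x \<in> Byes \<Longrightarrow> alternating e k (poly p' (length x)) (\<lambda>ys. accept_prob \<G> (V' (length x)) x ys \<ge> c' (length x))"
    and no': "\<And>x. x \<in> Bno \<Longrightarrow> alternating (\<not> e) k (poly p' (length x)) (\<lambda>ys. accept_prob \<G> (V' (length x)) x ys \<le> s' (length x))"
    unfolding QC_def has_verifier_def mem_Collect_eq fst_conv snd_conv by blast
  obtain k' where k': "k = Suc k'" using k by (cases k) auto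
  obtain lp :: "nat poly" where lp: "\<And>n. poly lp n = l n" using pad_funpow_poly unfolding l_def by blast
  \<comment> \<open>The even positions must hold the \<open>l n - n\<close> moved bits and the odd
    ones a proof of length \<open>poly p' (l n)\<close>.\<close>
  define P where "P = 2 * (lp + pcompose p' lp)"
  have P: "poly P n = 2 * (l n + poly p' (l n))" for n by (simp add: P_def poly_pcompose lp)
  define V'' where "V'' = (\<lambda>n. rename (input_to_proof n) (V' (l n)))"
  have V''_on: "circuit_on (input_wires n k (poly P n)) (V'' n)" for n
    unfolding V''_def
    by (rule circuit_on_rename[OF V'(2) inj_on_subset[OF inj_input_to_proof subset_UNIV] input_to_proof_wires])
      (use k in \<open>simp_all add: P\<close>)
  have V''_uniform: "poly_time_uniform V''"
    unfolding V''_def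
    by (rule poly_time_uniform_rename_after[OF V'(1) l_poly_time wf_input_to_proof_machine renames_input_to_proof])
  \<comment> \<open>The predicates \<open>R\<close> and \<open>R'\<close> stand for the old and the
    new threshold condition: the YES case takes \<open>e\<close> with lower bounds on the
    probability, the NO case \<open>\<not> e\<close> with upper bounds. The premise \<open>B\<close>
    will be the membership of \<open>x @ u\<close> in \<open>Byes\<close> or \<open>Bno\<close>,
    followed by the guarantee of the new verifier.\<close>
  have merge: "alternating e' k (poly P n) (\<lambda>ys. R' (accept_prob \<G> (V'' n) x ys))"
    if x: "length x = n"
      and alt: "alternating e' (Suc i) (poly p n) (\<lambda>ys. R (accept_prob \<G> (V n) x ys))"
      and B: "\<And>u. length u = l n - n \<Longrightarrow>
         alternating (\<not> e') i (poly p n) (\<lambda>ys. R (accept_prob \<G> (V n) x (take (poly p n) u # ys))) \<Longrightarrow>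
         alternating e' k (poly p' (l n)) (\<lambda>ys. R' (accept_prob \<G> (V' (l n)) (x @ u) ys))"
    for e' n x and R R' :: "real \<Rightarrow> bool"
  proof -
    have nl: "n \<le> l n" "poly p n \<le> l n - n" using l_room[of n] by simp_all
    \<comment> \<open>The first proof is lengthened until it fills the input up to length
      \<open>l n\<close>.\<close>
    have "quantify e' (l n - n) (\<lambda>u. alternating (\<not> e') i (poly p n)
        (\<lambda>ys. R (accept_prob \<G> (V n) x (take (poly p n) u # ys))))"
      using alt quantify_take[OF nl(2), of e' "\<lambda>y. alternating (\<not> e') i (poly p n)
        (\<lambda>ys. R (accept_prob \<G> (V n) x (y # ys)))"] by (simp add: alternating_Suc)
    then have q: "quantify e' (l n - n) (\<lambda>u. alternating e' (Suc k') (poly p' (l n))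
        (\<lambda>ys. R' (accept_prob \<G> (V' (l n)) (x @ u) ys)))"
      by (rule quantify_mono) (use B k' in simp)
    show ?thesis unfolding k'
    proof (rule alternating_merge[OF nl(1) _ _ q])
      fix y ys
      assume ys: "length y = poly P n" "length ys = k'" "\<forall>y\<in>set ys. length y = poly P n"
        and acc: "R' (accept_prob \<G> (V' (l n)) (x @ evens (l n - n) y) (odds (poly p' (l n)) y # map (take (poly p' (l n))) ys))"
      have "accept_prob \<G> (V'' n) x (y # ys) =
          accept_prob \<G> (V' (l n)) (x @ evens (l n - n) y) (odds (poly p' (l n)) y # map (take (poly p' (l n))) ys)"
        unfolding V''_def
        by (rule accept_prob_input_to_proof[OF V'(2)[unfolded k'] x nl(1) ys]) (simp_all add: P)
      with acc show "R' (accept_prob \<G> (V'' n) x (y # ys))" by simp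
    qed (simp_all add: P)
  qed
  have length_append: "length (x @ u) = l (length x)" if "length u = l (length x) - length x" for x u :: "bool list"
    using that l_room[of "length x"] by simp
  have A_yes: "alternating e k (poly P (length x)) (\<lambda>ys. c' (l (length x)) \<le> accept_prob \<G> (V'' (length x)) x ys)"
    if x: "x \<in> fst A" for x
  proof (rule merge[OF refl yes[OF x]])
    fix u :: "bool list"
    assume u: "length u = l (length x) - length x"
      "alternating (\<not> e) i (poly p (length x))
         (\<lambda>ys. c (length x) \<le> accept_prob \<G> (V (length x)) x (take (poly p (length x)) u # ys))"
    have "x @ u \<in> Byes" unfolding Byes_def
      by (intro CollectI exI[of _ "length x"]) (use x u length_append[OF u(1)] in simp)
    from yes'[OF this] show "alternating e k (poly p' (l (length x)))
         (\<lambda>ys. c' (l (length x)) \<le> accept_prob \<G> (V' (l (length x))) (x @ u) ys)"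
      unfolding length_append[OF u(1)] .
  qed
  have A_no: "alternating (\<not> e) k (poly P (length x)) (\<lambda>ys. accept_prob \<G> (V'' (length x)) x ys \<le> s' (l (length x)))"
    if x: "x \<in> snd A" for x
  proof (rule merge[OF refl no[OF x]])
    fix u :: "bool list"
    assume u: "length u = l (length x) - length x"
      "alternating (\<not> \<not> e) i (poly p (length x))
         (\<lambda>ys. accept_prob \<G> (V (length x)) x (take (poly p (length x)) u # ys) \<le> s (length x))"
    have "x @ u \<in> Bno" unfolding Bno_def
      by (intro CollectI exI[of _ "length x"]) (use x u length_append[OF u(1)] in simp)
    from no'[OF this] show "alternating (\<not> e) k (poly p' (l (length x)))
         (\<lambda>ys. accept_prob \<G> (V' (l (length x))) (x @ u) ys \<le> s' (l (length x)))"
      unfolding length_append[OF u(1)] .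
  qed
  have "admissible (\<lambda>n. c' (l n)) (\<lambda>n. s' (l n))"
    by (rule admissible_compose[OF cs' l_poly_time, of lp])
      (simp_all add: lp, simp add: l_def filterlim_pad_funpow)
  moreover have "has_verifier \<G> e k (\<lambda>n. c' (l n)) (\<lambda>n. s' (l n)) A"
    unfolding has_verifier_def using V''_uniform V''_on A_yes A_no by blast
  ultimately show ?thesis using promise unfolding QC_def by blast
qed

text \<open>
  Both hierarchies collapse in the same induction: no gate set is assumed to contain a negation, so
  the problems of one are not the complements of the problems of the other.
\<close>

lemma QC_collapse:
  assumes k: "k \<ge> 1" and eq: "QC \<G> True k = QC \<G> False k"
  shows "QC \<G> e (k + j) \<subseteq> QC \<G> e k"
proof (induction j arbitrary: e)
  case (Suc j)
  \<comment> \<open>The induction hypothesis for the opposite kind lands in level \<open>k\<close>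
    of that kind, and the assumed equality exchanges the kinds at level \<open>k\<close>.\<close>
  have "QC \<G> (\<not> e) (k + j) \<subseteq> QC \<G> e k"
    using Suc.IH[of "\<not> e"] eq by (cases e) auto
  then show ?case using QC_remove_quantifier[of _ \<G> e "k + j"] k by auto
qed simp

theorem theorem1:
  fixes \<G> :: gate_set and k :: nat
  assumes "unitary_gates \<G>"
    and "k \<ge> 1"
    and "QCSigma \<G> k = QCPi \<G> k"
  shows "QCPH \<G> = QCSigma \<G> k"
proof
  show "QCPH \<G> \<subseteq> QCSigma \<G> k"
    unfolding QCPH_def
  proof (rule UN_least)
    fix i
    \<comment> \<open>Going up to \<open>k + i\<close> avoids distinguishing whether
      \<open>i\<close> lies below or above \<open>k\<close>.\<close>
    have "QC \<G> True i \<subseteq> QC \<G> True (k + i)" by (rule QC_mono) simp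
    also have "\<dots> \<subseteq> QC \<G> True k"
      by (rule QC_collapse) (use assms in \<open>simp_all add: QCSigma_eq QCPi_eq\<close>)
    finally show "QCSigma \<G> i \<subseteq> QCSigma \<G> k" by (simp add: QCSigma_eq)
  qed
  show "QCSigma \<G> k \<subseteq> QCPH \<G>" using assms(2) by (auto simp: QCPH_def)
qed

end
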